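(* Let $B_1$ be the unit disk in $\mathbb{R}^2$ and $\delta=|\delta|e^{i\theta}\in\mathbb{R}^2\setminus\{(0,0)\}$ for some $\theta\in\mathbb{R}$. Then the pair of distinct points $(a_1^*,a_2^* )\in\partial B_1\times\partial B_1$ that minimises the renormalised energy $W^\delta_{B_1}(\{(a_1,1),(a_2,1)\})$ over all pairs of distinct points $a_1\neq a_2\in\partial B_1$ is unique (up to switching $a_1^*$ and $a_2^*$) and given by $$a_1^*=e^{i(\theta+\theta_\delta)}\quad\text{and}\quad a_2^*=e^{i(\theta+\pi-\theta_\delta)},\qquad\theta_\delta=\arcsin\Big(\sqrt{1+\frac1{16|\delta|^2}}-\frac1{4|\delta|}\Big).$$ In particular, $a_1^*$ and $a_2^*$ are symmetric with respect to $\delta^\perp$.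
   Context: Identify $\mathbb{R}^2\simeq\mathbb{C}$; $a^\perp=(-a_2,a_1)=ia$. "Symmetric with respect to $\delta^\perp$" means symmetric with respect to the line $\mathbb{R}\delta^\perp$. On $\partial B_1$: $\nu$ is the outer unit normal, $\tau=\nu^\perp$, $\partial_\tau$ the tangential derivative, and the curvature is $\kappa=1$. $\boldsymbol\delta_a$ is the Dirac mass at $a$. Renormalised energy in $\Omega=B_1$ with two vortices of multiplicity $1$: for $a_1\ne a_2\in\partial B_1$, let $\varphi_0\colon\partial B_1\to\mathbb{R}$ be a BV function with $e^{i\varphi_0}\cdot\nu=0$ on $\partial B_1\setminus\{a_1,a_2\}$ and $\partial_\tau\varphi_0=\mathcal H^1\llcorner\partial B_1-\pi(\boldsymbol\delta_{a_1}+\boldsymbol\delta_{a_2})$ as measure on $\partial B_1$, and let $\varphi_*$ be its harmonic extension to $B_1$. Then $$W^\delta_{B_1}(\{(a_1,1),(a_2,1)\})=\liminf_{r\to0}\Big(\int_{B_1\setminus(B_r(a_1)\cup B_r(a_2))}\big(|\nabla\varphi_*|^2-2\delta\cdot\nabla\varphi_*\big)dx-2\pi\log\frac1r\Big).$$ *)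

theory Defs
  imports "HOL-Analysis.Analysis"
begin

text \<open>
  The plane is the type \<^typ>\<open>complex\<close> with its real inner product, so that
  \<open>a\<^sup>\<bottom> = \<i> * a\<close>, the unit disk is \<^term>\<open>ball (0::complex) 1\<close>, and the outer unit normal
  of its boundary \<^term>\<open>sphere (0::complex) 1\<close> at \<open>x\<close> is \<open>x\<close> itself.
\<close>

section \<open>Measures and tangential derivatives on the unit circle\<close>

abbreviation circle_space :: "complex measure" where
  "circle_space \<equiv> restrict_space borel (sphere 0 1)"

text \<open>One-dimensional Hausdorff measure on the unit circle, that is, arc length.\<close>

definition circle_measure :: "complex measure" where
  "circle_measure = distr (restrict_space lborel {0..<2*pi}) circle_space cis"

text \<open>The measure \<open>\<pi> (\<delta>\<^sub>a\<^sub>1 + \<delta>\<^sub>a\<^sub>2)\<close>, for two distinct points of the circle.\<close>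

definition vortex_measure :: "complex \<Rightarrow> complex \<Rightarrow> complex measure" where
  "vortex_measure a1 a2 =
     distr (point_measure {a1, a2} (\<lambda>_. ennreal pi)) circle_space (\<lambda>x. x)"

text \<open>The derivative in direction \<open>\<tau> = \<i> * x\<close> of a function given on the circle only.\<close>

definition tangential_deriv :: "(complex \<Rightarrow> real) \<Rightarrow> complex \<Rightarrow> real" where
  "tangential_deriv \<zeta> x = deriv (\<lambda>s. \<zeta> (x * cis s)) 0"

definition C1_on_circle :: "(complex \<Rightarrow> real) \<Rightarrow> bool" where
  "C1_on_circle \<zeta> \<longleftrightarrow>
     (\<forall>x\<in>sphere 0 1. (\<lambda>s. \<zeta> (x * cis s)) differentiable at 0) \<and>
     continuous_on (sphere 0 1) (tangential_deriv \<zeta>)"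

text \<open>
  \<open>\<phi>\<close> is a function of bounded variation on the circle whose distributional tangential
  derivative is the finite signed measure \<open>\<mu> - \<nu>\<close>.
\<close>

definition has_BV_tangential_derivative ::
  "(complex \<Rightarrow> real) \<Rightarrow> complex measure \<Rightarrow> complex measure \<Rightarrow> bool" where
  "has_BV_tangential_derivative \<phi> \<mu> \<nu> \<longleftrightarrow>
     integrable circle_measure \<phi> \<and>
     finite_measure \<mu> \<and> sets \<mu> = sets circle_space \<and>
     finite_measure \<nu> \<and> sets \<nu> = sets circle_space \<and>
     (\<forall>\<zeta>. C1_on_circle \<zeta> \<longrightarrow>
        (LINT x|circle_measure. \<phi> x * tangential_deriv \<zeta> x)
          = - ((LINT x|\<mu>. \<zeta> x) - (LINT x|\<nu>. \<zeta> x)))"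

section \<open>Harmonic extension\<close>

definition grad :: "(complex \<Rightarrow> real) \<Rightarrow> complex \<Rightarrow> complex" where
  "grad u x = (THE D. GDERIV u x :> D)"

definition laplacian :: "(complex \<Rightarrow> real) \<Rightarrow> complex \<Rightarrow> real" where
  "laplacian u x = (\<Sum>b\<in>Basis. frechet_derivative (grad u) (at x) b \<bullet> b)"

text \<open>The first three conditions say that \<open>u\<close> is twice continuously differentiable.\<close>

definition harmonic_on :: "complex set \<Rightarrow> (complex \<Rightarrow> real) \<Rightarrow> bool" where
  "harmonic_on S u \<longleftrightarrow>
     (\<forall>x\<in>S. u differentiable at x) \<and>
     (\<forall>x\<in>S. grad u differentiable at x) \<and>
     (\<forall>b\<in>Basis. continuous_on S (\<lambda>x. frechet_derivative (grad u) (at x) b)) \<and>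
     (\<forall>x\<in>S. laplacian u x = 0)"

text \<open>
  The boundary data are discontinuous, and prescribing boundary values pointwise off the
  discontinuities would not determine a harmonic function (one could add Poisson kernels).
  The boundary values are therefore attained as an \<open>L\<^sup>1\<close> trace.
\<close>

definition is_harmonic_extension :: "(complex \<Rightarrow> real) \<Rightarrow> (complex \<Rightarrow> real) \<Rightarrow> bool" where
  "is_harmonic_extension \<phi> u \<longleftrightarrow>
     harmonic_on (ball 0 1) u \<and>
     ((\<lambda>r. LINT x|circle_measure. \<bar>u (r *\<^sub>R x) - \<phi> x\<bar>) \<longlongrightarrow> 0) (at_left 1)"

section \<open>Renormalised energy of two boundary vortices of multiplicity one\<close>

definition is_boundary_phase :: "complex \<Rightarrow> complex \<Rightarrow> (complex \<Rightarrow> real) \<Rightarrow> bool" where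
  "is_boundary_phase a1 a2 \<phi> \<longleftrightarrow>
     (\<forall>x\<in>sphere 0 1 - {a1, a2}. cis (\<phi> x) \<bullet> x = 0) \<and>
     has_BV_tangential_derivative \<phi> circle_measure (vortex_measure a1 a2)"

text \<open>
  The boundary phase is determined almost everywhere up to an additive constant, and the energy
  sees only the gradient of its harmonic extension, so the choice below is immaterial.
\<close>

definition vortex_phase :: "complex \<Rightarrow> complex \<Rightarrow> complex \<Rightarrow> real" where
  "vortex_phase a1 a2 =
     (SOME u. \<exists>\<phi>. is_boundary_phase a1 a2 \<phi> \<and> is_harmonic_extension \<phi> u)"

definition renormalised_energy :: "complex \<Rightarrow> complex \<Rightarrow> complex \<Rightarrow> ereal" where
  "renormalised_energy \<delta> a1 a2 =
     Liminf (at_right 0) (\<lambda>r. ereal (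
       (LINT x:ball 0 1 - (ball a1 r \<union> ball a2 r)|lborel.
          (norm (grad (vortex_phase a1 a2) x))\<^sup>2
            - 2 * (\<delta> \<bullet> grad (vortex_phase a1 a2) x))
       - 2 * pi * ln (1 / r)))"

section \<open>Reflection\<close>

text \<open>Reflection of the plane across the line \<open>\<real> v\<close>, for \<open>v \<noteq> 0\<close>.\<close>

definition reflect_across_line :: "complex \<Rightarrow> complex \<Rightarrow> complex" where
  "reflect_across_line v z = (2 * (z \<bullet> v) / (v \<bullet> v)) *\<^sub>R v - z"

end

theory Submission
  imports Defs "HOL-Complex_Analysis.Cauchy_Integral_Formula"
begin

text \<open>
  The renormalised energy of two vortices \<open>a \<noteq> b\<close> on the unit circle is, up to an
  absolute constant,
  \<open>- 2 * pi * ln (norm (a - b)) + 2 * pi * (\<delta> \<bullet> (\<i> * (a + b)))\<close>,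
  and this function of two points can be minimised by hand.

  The formula rests on an explicit phase. The argument of \<open>1 - cnj a * x\<close> grows along the circle at
  half the speed of arc length and drops by \<open>pi\<close> at \<open>a\<close>. The arguments that belong to \<open>a\<close> and \<open>b\<close>
  add up to a function with the prescribed tangential derivative, and a suitable constant makes the
  field tangent to the circle. Up to this constant it is the boundary value of the imaginary part of
  \<open>Ln (1 - cnj a * z) + Ln (1 - cnj b * z)\<close>, whose gradient is
  \<open>\<i> * cnj (1 / (z - a) + 1 / (z - b))\<close>. Every other admissible phase has the same gradient:
  the difference of two extensions is the real part of a holomorphic function, whose Fourier
  coefficients of positive order are determined by the tangential derivative of the boundary values
  and hence vanish (\<open>harmonic_extension_grad_unique\<close>, \<open>grad_vortex_phase\<close>).

  Expanding the square of the sum of the two poles gives three kinds of terms. The energy of one pole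
  outside a disc of radius \<open>r\<close> is \<open>pi * ln (1 / r) + K + o(1)\<close>, and by rotation invariance \<open>K\<close> is the
  same for all positions (\<open>self_energy_asymptotics\<close>). The mixed term and the term with \<open>\<delta>\<close> are
  integrable over the disc. Expansion into geometric series and orthogonality of the monomials give
  the logarithm of \<open>1 - cnj a * b\<close> for the former (\<open>disc_integral_pole_product\<close>), and \<open>cnj a + cnj b\<close>
  for the latter (\<open>disc_integral_pole\<close>).

  For the minimisation, the plane is rotated such that \<open>\<delta>\<close> becomes the positive number
  \<open>D = norm \<delta>\<close>. Since \<open>(norm (c1 - c2))\<^sup>2 = 4 - (norm (c1 + c2))\<^sup>2\<close> on the unit circle, the energy is
  a function of \<open>c1 + c2\<close>. It exceeds its value at \<open>c1 + c2 = 2 * \<i> * s\<close> by at least a positive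
  definite quadratic form in the deviation (\<open>reduced_energy_lower_bound\<close>), where \<open>s\<close> is the positive
  root of \<open>2 * D * (1 - s\<^sup>2) = s\<close>. Two unit vectors with this sum are determined up to their order.
\<close>

section \<open>Integration over the plane\<close>

lemma Complex_borel_measurable [measurable]: "(\<lambda>p. Complex (fst p) (snd p)) \<in> borel_measurable borel"
  by (intro borel_measurable_continuous_onI continuous_intros)

lemma lborel_complex_pair:
  "(lborel :: complex measure) = distr (lborel \<Otimes>\<^sub>M lborel) borel (\<lambda>(x, y). Complex x y)"
proof (rule lborel_eqI)
  have [measurable]: "(\<lambda>(x, y). Complex x y) \<in> borel \<Otimes>\<^sub>M borel \<rightarrow>\<^sub>M borel"
    using Complex_borel_measurable by (simp add: borel_prod case_prod_beta')
  fix l u :: complex assume le: "\<And>b. b \<in> Basis \<Longrightarrow> l \<bullet> b \<le> u \<bullet> b"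
  have le': "Re l \<le> Re u" "Im l \<le> Im u"
    using le[of 1] le[of \<i>] by (auto simp: Basis_complex_def)
  have "(\<lambda>(x, y). Complex x y) -` box l u = {Re l<..<Re u} \<times> {Im l<..<Im u}"
    by (auto simp: box_def Basis_complex_def)
  then show "emeasure (distr (lborel \<Otimes>\<^sub>M lborel) borel (\<lambda>(x, y). Complex x y)) (box l u)
      = ennreal (\<Prod>b\<in>Basis. (u - l) \<bullet> b)"
    using le'
    by (simp add: emeasure_distr space_pair_measure lborel.emeasure_pair_measure_Times
        Basis_complex_def ennreal_mult)
qed simp

lemma nn_integral_complex:
  assumes [measurable]: "f \<in> borel_measurable borel"
  shows "(\<integral>\<^sup>+z. f z \<partial>lborel) = (\<integral>\<^sup>+y. (\<integral>\<^sup>+x. f (Complex x y) \<partial>lborel) \<partial>lborel)"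
    and "(\<integral>\<^sup>+z. f z \<partial>lborel) = (\<integral>\<^sup>+x. (\<integral>\<^sup>+y. f (Complex x y) \<partial>lborel) \<partial>lborel)"
proof -
  have [measurable]: "(\<lambda>(x, y). Complex x y) \<in> borel \<Otimes>\<^sub>M borel \<rightarrow>\<^sub>M borel"
    using Complex_borel_measurable by (simp add: borel_prod case_prod_beta')
  have fm[measurable]: "(\<lambda>(x, y). f (Complex x y)) \<in> borel_measurable (lborel \<Otimes>\<^sub>M lborel)"
    using measurable_compose[OF \<open>(\<lambda>(x, y). Complex x y) \<in> _\<close> assms] by (simp add: case_prod_beta')
  have *: "(\<integral>\<^sup>+z. f z \<partial>lborel) = (\<integral>\<^sup>+(x, y). f (Complex x y) \<partial>(lborel \<Otimes>\<^sub>M lborel))"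
    by (subst lborel_complex_pair, subst nn_integral_distr) (auto simp: case_prod_beta')
  show "(\<integral>\<^sup>+z. f z \<partial>lborel) = (\<integral>\<^sup>+y. (\<integral>\<^sup>+x. f (Complex x y) \<partial>lborel) \<partial>lborel)"
    unfolding * using lborel_pair.nn_integral_snd[OF fm] by simp
  show "(\<integral>\<^sup>+z. f z \<partial>lborel) = (\<integral>\<^sup>+x. (\<integral>\<^sup>+y. f (Complex x y) \<partial>lborel) \<partial>lborel)"
    unfolding * using lborel.nn_integral_fst[OF fm] by simp
qed

text \<open>
  Lebesgue measure on each horizontal or vertical line is translation invariant, and the plane
  integral is an iterated integral along such lines.
\<close>

lemma nn_integral_shears:
  fixes f :: "complex \<Rightarrow> ennreal"
  assumes [measurable]: "f \<in> borel_measurable borel"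
  shows "(\<integral>\<^sup>+z. f (Complex (Re z + s * Im z) (Im z)) \<partial>lborel) = (\<integral>\<^sup>+z. f z \<partial>lborel)"
    and "(\<integral>\<^sup>+z. f (Complex (Re z) (Im z + s * Re z)) \<partial>lborel) = (\<integral>\<^sup>+z. f z \<partial>lborel)"
proof -
  have [measurable]: "(\<lambda>z. f (Complex (Re z + s * Im z) (Im z))) \<in> borel_measurable borel"
    "(\<lambda>z. f (Complex (Re z) (Im z + s * Re z))) \<in> borel_measurable borel"
    by (intro measurable_compose[OF _ assms] borel_measurable_continuous_onI continuous_intros)+
  have [measurable]: "(\<lambda>x. f (Complex x y)) \<in> borel_measurable borel"
    "(\<lambda>x. f (Complex y x)) \<in> borel_measurable borel" for y
    by (intro measurable_compose[OF _ assms] borel_measurable_continuous_onI continuous_intros)+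
  have "(\<integral>\<^sup>+x. f (Complex (x + s * y) y) \<partial>lborel) = (\<integral>\<^sup>+x. f (Complex x y) \<partial>lborel)" for y
    using nn_integral_real_affine[of "\<lambda>x. f (Complex x y)" 1 "s * y"] by (simp add: add.commute)
  then show "(\<integral>\<^sup>+z. f (Complex (Re z + s * Im z) (Im z)) \<partial>lborel) = (\<integral>\<^sup>+z. f z \<partial>lborel)"
    by (subst (1 2) nn_integral_complex(1)) simp_all
  have "(\<integral>\<^sup>+y. f (Complex x (y + s * x)) \<partial>lborel) = (\<integral>\<^sup>+y. f (Complex x y) \<partial>lborel)" for x
    using nn_integral_real_affine[of "\<lambda>y. f (Complex x y)" 1 "s * x"] by (simp add: add.commute)
  then show "(\<integral>\<^sup>+z. f (Complex (Re z) (Im z + s * Re z)) \<partial>lborel) = (\<integral>\<^sup>+z. f z \<partial>lborel)"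
    by (subst (1 2) nn_integral_complex(2)) simp_all
qed

text \<open>
  A rotation by \<open>c\<close> with \<open>Im c \<noteq> 0\<close> is a product of a horizontal,
  a vertical and again a horizontal shear, so it preserves area. The two remaining rotations are
  products of rotations of this kind.
\<close>

lemma nn_integral_rotate:
  fixes f :: "complex \<Rightarrow> ennreal"
  assumes [measurable]: "f \<in> borel_measurable borel" and c: "norm c = 1"
  shows "(\<integral>\<^sup>+z. f (c * z) \<partial>lborel) = (\<integral>\<^sup>+z. f z \<partial>lborel)"
proof -
  have main: "(\<integral>\<^sup>+z. g (c * z) \<partial>lborel) = (\<integral>\<^sup>+z. g z \<partial>lborel)"
    if [measurable]: "g \<in> borel_measurable borel" and c: "norm c = 1" and y: "Im c \<noteq> 0"
    for g :: "complex \<Rightarrow> ennreal" and c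
  proof -
    \<comment> \<open>\<open>p\<close> is the slope of the two outer shears, \<open>Im c\<close> that of the middle one.\<close>
    define p where "p = (Re c - 1) / Im c"
    have xy: "(Re c)\<^sup>2 + (Im c)\<^sup>2 = 1"
      using c by (metis cmod_power2 one_power2)
    define h where "h z = g (Complex (Re z + p * Im z) (Im z))" for z
    define k where "k z = h (Complex (Re z) (Im z + Im c * Re z))" for z
    have [measurable]: "h \<in> borel_measurable borel" unfolding h_def
      by (intro measurable_compose[OF _ that(1)] borel_measurable_continuous_onI continuous_intros)+
    have [measurable]: "k \<in> borel_measurable borel" unfolding k_def
      by (intro measurable_compose[OF _ \<open>h \<in> _\<close>] borel_measurable_continuous_onI continuous_intros)+
    have p: "1 + p * Im c = Re c" "p * (1 + Re c) = - Im c"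
      using y xy by (auto simp: p_def field_simps power2_eq_square)
    have re: "Re z + p * Im z + p * (Im z + Im c * (Re z + p * Im z)) = Re c * Re z - Im c * Im z" for z
    proof -
      have "Re z + p * Im z + p * (Im z + Im c * (Re z + p * Im z))
          = (1 + p * Im c) * Re z + p * (1 + (1 + p * Im c)) * Im z"
        by (simp add: algebra_simps)
      then show ?thesis unfolding p by simp
    qed
    have im: "Im z + Im c * (Re z + p * Im z) = Re c * Im z + Im c * Re z" for z
    proof -
      have "Im z + Im c * (Re z + p * Im z) = (1 + p * Im c) * Im z + Im c * Re z"
        by (simp add: algebra_simps)
      then show ?thesis unfolding p by simp
    qed
    have "c * z = Complex (Re z + p * Im z + p * (Im z + Im c * (Re z + p * Im z)))
        (Im z + Im c * (Re z + p * Im z))" for z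
      by (rule complex_eqI)
        (simp_all only: complex.sel times_complex.sel re[of z, symmetric] im[of z, symmetric])
    then have "g (c * z) = k (Complex (Re z + p * Im z) (Im z))" for z
      unfolding k_def h_def complex.sel by simp
    then have "(\<integral>\<^sup>+z. g (c * z) \<partial>lborel) = (\<integral>\<^sup>+z. k z \<partial>lborel)"
      by (simp add: nn_integral_shears(1))
    also have "\<dots> = (\<integral>\<^sup>+z. g z \<partial>lborel)"
      unfolding k_def by (simp add: nn_integral_shears(2)) (simp add: h_def nn_integral_shears(1))
    finally show ?thesis .
  qed
  show ?thesis
  proof (cases "Im c = 0")
    case True
    have "Im (c * - \<i>) \<noteq> 0"
      using c True by (auto simp: cmod_def)
    have "(\<integral>\<^sup>+z. f (c * z) \<partial>lborel) = (\<integral>\<^sup>+z. f ((c * - \<i>) * (\<i> * z)) \<partial>lborel)"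
      by (simp add: algebra_simps)
    also have "\<dots> = (\<integral>\<^sup>+z. f ((c * - \<i>) * z) \<partial>lborel)"
      by (rule main) (auto intro!: measurable_compose[OF _ assms(1)])
    also have "\<dots> = (\<integral>\<^sup>+z. f z \<partial>lborel)"
      by (rule main) (use c \<open>Im (c * - \<i>) \<noteq> 0\<close> in \<open>auto simp: norm_mult\<close>)
    finally show ?thesis .
  qed (use main c in auto)
qed

lemma lborel_distr_rotate:
  assumes c: "norm (c::complex) = 1"
  shows "distr lborel borel ((*) c) = lborel"
proof (rule measure_eqI)
  fix A assume "A \<in> sets (distr lborel borel ((*) c))"
  then have [measurable]: "A \<in> sets borel" by simp
  have "emeasure (distr lborel borel ((*) c)) A = (\<integral>\<^sup>+z. indicator A z \<partial>distr lborel borel ((*) c))"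
    by (simp add: nn_integral_indicator)
  also have "\<dots> = (\<integral>\<^sup>+z. indicator A (c * z) \<partial>lborel)"
    by (subst nn_integral_distr) auto
  also have "\<dots> = emeasure lborel A"
    by (subst nn_integral_rotate[OF _ c]) auto
  finally show "emeasure (distr lborel borel ((*) c)) A = emeasure lborel A" .
qed simp

lemma integral_rotate:
  fixes f :: "complex \<Rightarrow> 'a::{banach, second_countable_topology}"
  assumes c: "norm (c::complex) = 1" and [measurable]: "f \<in> borel_measurable borel"
  shows "(\<integral>z. f (c * z) \<partial>lborel) = (\<integral>z. f z \<partial>lborel)"
  by (subst (2) lborel_distr_rotate[OF c, symmetric], subst integral_distr) auto

text \<open>
  The disc of radius \<open>sqrt s\<close> has area \<open>pi * s\<close>, so the squared modulus
  carries planar Lebesgue measure to \<open>pi\<close> times Lebesgue measure on the half-line.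
  Radial integrals become one-dimensional without polar coordinates.
\<close>

lemma distr_norm_square:
  "distr lborel borel (\<lambda>z::complex. (norm z)\<^sup>2) = density lborel (\<lambda>s. ennreal pi * indicator {0..} s)"
    (is "?M = ?N")
proof -
  define E where "E = range (\<lambda>a::real. {..a})"
  have cball: "(\<lambda>z::complex. (norm z)\<^sup>2) -` {..a} = (if a < 0 then {} else cball 0 (sqrt a))" for a
    by (auto simp: dist_norm real_le_rsqrt) (smt (verit) zero_le_power2, use sqrt_ge_absD real_sqrt_le_iff in fastforce)
  have M: "emeasure ?M {..a} = ennreal (pi * max 0 a)" for a
  proof (cases "a < 0")
    case True then show ?thesis by (simp add: emeasure_distr cball)
  next
    case False
    then show ?thesis
      by (simp add: emeasure_distr cball emeasure_cball unit_ball_vol_2)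
  qed
  have N: "emeasure ?N {..a} = ennreal (pi * max 0 a)" for a
  proof -
    have "emeasure ?N {..a} = (\<integral>\<^sup>+x. ennreal pi * indicator {0..a} x \<partial>lborel)"
      by (subst emeasure_density) (auto intro!: nn_integral_cong split: split_indicator)
    also have "\<dots> = ennreal (pi * max 0 a)"
      by (cases "0 \<le> a") (auto simp: nn_integral_cmult ennreal_mult)
    finally show ?thesis .
  qed
  show ?thesis
  proof (rule measure_eqI_generator_eq)
    show "Int_stable E" by (auto simp: Int_stable_def E_def)
    show "E \<subseteq> Pow UNIV" by simp
    show "emeasure ?M X = emeasure ?N X" if "X \<in> E" for X
      using that M N by (auto simp: E_def)
    show "sets ?M = sigma_sets UNIV E" "sets ?N = sigma_sets UNIV E"
      by (simp_all add: E_def borel_eq_atMost)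
    show "range (\<lambda>i::nat. {..real i}) \<subseteq> E" by (auto simp: E_def)
    show "(\<Union>i::nat. {..real i}) = UNIV" by (auto simp: real_arch_simple)
    show "emeasure ?M {..real i} \<noteq> \<infinity>" for i unfolding M by simp
  qed
qed

lemma nn_integral_radial:
  assumes [measurable]: "f \<in> borel_measurable borel"
  shows "(\<integral>\<^sup>+z. f ((norm (z::complex))\<^sup>2) \<partial>lborel) = ennreal pi * (\<integral>\<^sup>+s. f s * indicator {0..} s \<partial>lborel)"
proof -
  have "(\<integral>\<^sup>+z. f ((norm (z::complex))\<^sup>2) \<partial>lborel) = (\<integral>\<^sup>+s. f s \<partial>distr lborel borel (\<lambda>z::complex. (norm z)\<^sup>2))"
    by (subst nn_integral_distr) auto
  also have "\<dots> = (\<integral>\<^sup>+s. ennreal pi * (f s * indicator {0..} s) \<partial>lborel)"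
    unfolding distr_norm_square by (subst nn_integral_density) (auto simp: mult_ac)
  finally show ?thesis by (simp add: nn_integral_cmult)
qed

section \<open>Integrals of monomials and geometric series over discs\<close>

lemma borel_measurable_complex_sets [measurable]:
  "ball (c::complex) r \<in> sets borel" "cball (c::complex) r \<in> sets borel"
  by simp_all

lemma borel_measurable_cnj [measurable]: "cnj \<in> borel_measurable borel"
  by (intro borel_measurable_continuous_onI continuous_intros)

text \<open>
  A Weierstrass M-test: on a finite measure space a uniform summable bound allows integration term
  by term.
\<close>

lemma integral_termwise:
  fixes f :: "nat \<Rightarrow> 'a \<Rightarrow> 'b::{banach, second_countable_topology}"
  assumes "finite_measure M" and [measurable]: "\<And>n. f n \<in> borel_measurable M"
    and bound: "\<And>n x. x \<in> space M \<Longrightarrow> norm (f n x) \<le> c n" and c: "summable c"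
    and s: "\<And>x. x \<in> space M \<Longrightarrow> (\<lambda>n. f n x) sums g x"
  shows "(\<lambda>n. \<integral>x. f n x \<partial>M) sums (\<integral>x. g x \<partial>M)"
proof -
  interpret finite_measure M by fact
  have int: "integrable M (f n)" for n
    by (rule integrable_const_bound[of _ "c n"]) (auto simp: bound)
  have "(\<lambda>n. \<integral>x. f n x \<partial>M) sums (\<integral>x. (\<Sum>n. f n x) \<partial>M)"
  proof (rule sums_integral[OF int])
    show "AE x in M. summable (\<lambda>i. norm (f i x))"
      by (intro AE_I2 summable_comparison_test'[OF c]) (auto simp: bound)
    have "norm (\<integral>x. norm (f n x) \<partial>M) \<le> c n * measure M (space M)" for n
    proof -
      have "norm (\<integral>x. norm (f n x) \<partial>M) = (\<integral>x. norm (f n x) \<partial>M)"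
        by simp
      also have "\<dots> \<le> (\<integral>x. c n \<partial>M)"
        by (intro integral_mono integrable_norm int) (auto simp: bound)
      finally show ?thesis by (simp add: mult.commute)
    qed
    then show "summable (\<lambda>n. \<integral>x. norm (f n x) \<partial>M)"
      by (intro summable_comparison_test'[OF summable_mult2[OF c]]) auto
  qed
  also have "(\<integral>x. (\<Sum>n. f n x) \<partial>M) = (\<integral>x. g x \<partial>M)"
    by (intro Bochner_Integration.integral_cong refl) (simp add: sums_unique[OF s])
  finally show ?thesis .
qed

lemma integral_geometric:
  fixes g w :: "'a \<Rightarrow> complex"
  assumes "finite_measure M" and [measurable]: "g \<in> borel_measurable M" "w \<in> borel_measurable M"
    and g: "\<And>x. x \<in> space M \<Longrightarrow> norm (g x) \<le> B"
    and w: "\<And>x. x \<in> space M \<Longrightarrow> norm (w x) \<le> q" and q: "0 \<le> q" "q < 1"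
  shows "(\<lambda>n. \<integral>x. w x ^ n * g x \<partial>M) sums (\<integral>x. 1 / (1 - w x) * g x \<partial>M)"
proof (rule integral_termwise[where c = "\<lambda>n. q ^ n * B"])
  show "summable (\<lambda>n. q ^ n * B)"
    using q by (intro summable_mult2 summable_geometric) auto
  fix n x assume x: "x \<in> space M"
  show "norm (w x ^ n * g x) \<le> q ^ n * B"
    unfolding norm_mult norm_power using g[OF x] w[OF x] q by (intro mult_mono power_mono) auto
  show "(\<lambda>n. w x ^ n * g x) sums (1 / (1 - w x) * g x)"
    using geometric_sums[of "w x"] w[OF x] q by (intro sums_mult2) auto
qed (use assms in auto)

lemma finite_measure_disc: "finite_measure (restrict_space lborel (ball (0::complex) \<rho>))"
  by (intro finite_measureI)
    (use emeasure_bounded_finite[OF bounded_ball, of "0::complex" \<rho>] in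
      \<open>auto simp: emeasure_restrict_space\<close>)

lemma disc_integral_norm_power:
  assumes "0 \<le> \<rho>"
  shows "(\<integral>z. (norm z) ^ (2 * n) \<partial>restrict_space lborel (ball (0::complex) \<rho>))
    = pi * \<rho> ^ (2 * n + 2) / (n + 1)"
proof -
  have *: "indicator {0..<\<rho>\<^sup>2} ((norm z)\<^sup>2) = (indicator (ball 0 \<rho>) z :: ennreal)" for z :: complex
  proof -
    have "(norm z)\<^sup>2 < \<rho>\<^sup>2 \<longleftrightarrow> norm z < \<rho>"
      using assms by (metis norm_ge_zero power2_less_imp_less power_strict_mono zero_less_numeral)
    then show ?thesis by (simp add: indicator_def)
  qed
  have "(\<integral>\<^sup>+z. ennreal (((norm z)\<^sup>2) ^ n) * indicator {0..<\<rho>\<^sup>2} ((norm (z::complex))\<^sup>2) \<partial>lborel)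
      = ennreal pi * (\<integral>\<^sup>+s. (ennreal (s ^ n) * indicator {0..<\<rho>\<^sup>2} s) * indicator {0..} s \<partial>lborel)"
    by (rule nn_integral_radial) simp
  also have "(\<integral>\<^sup>+s. (ennreal (s ^ n) * indicator {0..<\<rho>\<^sup>2} s) * indicator {0..} s \<partial>lborel)
      = (\<integral>\<^sup>+s. ennreal (s ^ n) * indicator {0..\<rho>\<^sup>2} s \<partial>lborel)"
    by (rule nn_integral_cong_AE, rule AE_mp[OF AE_lborel_singleton[of "\<rho>\<^sup>2"]])
      (auto intro!: AE_I2 simp: indicator_def)
  also have "\<dots> = ennreal ((\<rho>\<^sup>2) ^ Suc n / real (Suc n) - 0 ^ Suc n / real (Suc n))"
    by (rule nn_integral_FTC_Icc)
      (auto intro!: derivative_eq_intros simp del: power_Suc)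
  also have "ennreal pi * \<dots> = ennreal (pi * \<rho> ^ (2 * n + 2) / (n + 1))"
    by (simp add: ennreal_mult'[symmetric] power_mult[symmetric] del: power_Suc)
  finally have "(\<integral>\<^sup>+z. ennreal (((norm z)\<^sup>2) ^ n) * indicator {0..<\<rho>\<^sup>2} ((norm (z::complex))\<^sup>2) \<partial>lborel)
      = ennreal (pi * \<rho> ^ (2 * n + 2) / (n + 1))" .
  moreover have "ennreal (((norm z)\<^sup>2) ^ n) * indicator {0..<\<rho>\<^sup>2} ((norm (z::complex))\<^sup>2)
      = ennreal (indicator (ball 0 \<rho>) z * (norm (z::complex)) ^ (2 * n))" for z
    unfolding * by (cases "z \<in> ball 0 \<rho>") (simp_all add: power_mult)
  ultimately have "(\<integral>\<^sup>+z. ennreal (indicator (ball 0 \<rho>) z * (norm (z::complex)) ^ (2 * n)) \<partial>lborel)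
      = ennreal (pi * \<rho> ^ (2 * n + 2) / (n + 1))"
    by simp
  then have "has_bochner_integral lborel (\<lambda>z. indicator (ball 0 \<rho>) z * (norm (z::complex)) ^ (2 * n))
      (pi * \<rho> ^ (2 * n + 2) / (n + 1))"
    using assms by (intro has_bochner_integral_nn_integral) simp_all
  then show ?thesis
    by (subst integral_restrict_space) (auto simp: has_bochner_integral_iff)
qed

lemma disc_integral_rotate:
  fixes f :: "complex \<Rightarrow> complex"
  assumes [measurable]: "f \<in> borel_measurable borel" and c: "norm c = 1"
  shows "(\<integral>z. f (c * z) \<partial>restrict_space lborel (ball 0 \<rho>)) = (\<integral>z. f z \<partial>restrict_space lborel (ball 0 \<rho>))"
proof -
  have "(\<integral>z. indicator (ball 0 \<rho>) (c * z) *\<^sub>R f (c * z) \<partial>lborel)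
      = (\<integral>z. indicator (ball 0 \<rho>) z *\<^sub>R f z \<partial>lborel)"
    by (rule integral_rotate[OF c]) simp
  moreover have "indicator (ball 0 \<rho>) (c * z) = (indicator (ball 0 \<rho>) z :: real)" for z
    using c by (simp add: indicator_def norm_mult)
  ultimately show ?thesis
    by (simp add: integral_restrict_space)
qed

text \<open>
  The rotation by \<open>c\<close> changes the sign of \<open>z ^ n * cnj z ^ m\<close>, so the
  integral of this monomial against any rotation-invariant measure vanishes. This gives
  orthogonality on discs and on the circle.
\<close>

lemma unimodular_power_cnj:
  assumes "n \<noteq> m" obtains c :: complex where "norm c = 1" "c ^ n * cnj c ^ m = -1"
proof
  let ?c = "cis (pi / (real n - real m))"
  show "norm ?c = 1" by simp
  have "?c ^ n * cnj ?c ^ m = cis ((real n - real m) * (pi / (real n - real m)))"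
    by (simp only: cis_cnj Complex.DeMoivre cis_mult) (simp add: left_diff_distrib diff_divide_distrib)
  also have "(real n - real m) * (pi / (real n - real m)) = pi" using assms by simp
  finally show "?c ^ n * cnj ?c ^ m = -1" by simp
qed

lemma disc_integral_monomial:
  assumes "0 \<le> \<rho>"
  shows "(\<integral>z. z ^ n * cnj z ^ m \<partial>restrict_space lborel (ball 0 \<rho>))
    = (if n = m then of_real (pi * \<rho> ^ (2 * n + 2) / (n + 1)) else 0)"
proof (cases "n = m")
  case True
  have "z ^ n * cnj z ^ n = of_real (norm z ^ (2 * n))" for z
    by (metis complex_norm_square of_real_power power_mult power_mult_distrib)
  with True show ?thesis
    by (simp only: integral_complex_of_real disc_integral_norm_power[OF assms]) simp
next
  case False
  obtain c :: complex where c: "norm c = 1" "c ^ n * cnj c ^ m = -1"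
    using unimodular_power_cnj[OF False] .
  let ?I = "\<integral>z. z ^ n * cnj z ^ m \<partial>restrict_space lborel (ball 0 \<rho>)"
  have "?I = (\<integral>z. (c * z) ^ n * cnj (c * z) ^ m \<partial>restrict_space lborel (ball 0 \<rho>))"
    using disc_integral_rotate[OF _ c(1), of "\<lambda>z. z ^ n * cnj z ^ m" \<rho>]
    by (measurable, simp)
  also have "\<dots> = (\<integral>z. (c ^ n * cnj c ^ m) * (z ^ n * cnj z ^ m) \<partial>restrict_space lborel (ball 0 \<rho>))"
    by (simp add: power_mult_distrib mult_ac)
  also have "\<dots> = - ?I" unfolding c(2) by simp
  finally show ?thesis using False by simp
qed

text \<open>
  Both factors are geometric series, and orthogonality of the monomials leaves the diagonal of
  their product. For \<open>\<rho> < 1\<close> the series converge uniformly even when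
  \<open>a\<close> and \<open>b\<close> lie on the unit circle.
\<close>

lemma disc_integral_kernel:
  assumes a: "norm a \<le> 1" and b: "norm b \<le> 1" and \<rho>: "0 \<le> \<rho>" "\<rho> < 1"
  shows "(\<lambda>n. of_real (pi * \<rho> ^ (2 * n + 2) / (n + 1)) * (cnj a * b) ^ n) sums
    (\<integral>z. 1 / (1 - cnj a * z) * cnj (1 / (1 - cnj b * z)) \<partial>restrict_space lborel (ball 0 \<rho>))"
proof -
  let ?M = "restrict_space lborel (ball (0::complex) \<rho>)"
  have w: "norm (cnj a * z) \<le> \<rho>" if "z \<in> space ?M" "norm a \<le> 1" for a z
    using that mult_mono[of "norm a" 1 "norm z" \<rho>] by (simp add: space_restrict_space norm_mult)
  have bd: "norm (cnj (1 / (1 - cnj b * z))) \<le> 1 / (1 - \<rho>)" if "z \<in> space ?M" for z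
  proof -
    have "1 - \<rho> \<le> norm (1 - cnj b * z)"
      using w[OF that b] norm_triangle_ineq2[of 1 "cnj b * z"] by simp
    moreover have "norm (cnj (1 / (1 - cnj b * z))) = 1 / norm (1 - cnj b * z)"
      by (simp only: complex_mod_cnj norm_divide norm_one)
    ultimately show ?thesis using \<rho> by (simp only:) (simp add: frac_le)
  qed
  have [measurable]: "(\<lambda>z. cnj (1 / (1 - cnj b * z))) \<in> borel_measurable ?M"
    by (intro measurable_restrict_space1) measurable
  have [measurable]: "(\<lambda>z. z) \<in> borel_measurable ?M" "cnj \<in> borel_measurable ?M"
    by (intro measurable_restrict_space1; simp)+
  have inner: "(\<integral>z. (cnj a * z) ^ n * cnj (1 / (1 - cnj b * z)) \<partial>?M)
      = of_real (pi * \<rho> ^ (2 * n + 2) / (n + 1)) * (cnj a * b) ^ n" for n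
  proof -
    have "(\<lambda>m. \<integral>z. (b * cnj z) ^ m * (cnj a * z) ^ n \<partial>?M) sums
        (\<integral>z. 1 / (1 - b * cnj z) * (cnj a * z) ^ n \<partial>?M)"
    proof (rule integral_geometric[OF finite_measure_disc])
      show "norm ((cnj a * z) ^ n) \<le> 1" if "z \<in> space ?M" for z
        unfolding norm_power using w[OF that a] \<rho> by (intro power_le_one) auto
      show "norm (b * cnj z) \<le> \<rho>" if "z \<in> space ?M" for z
        using w[OF that b] by (simp add: norm_mult)
    qed (use \<rho> in auto)
    moreover have "(\<integral>z. (b * cnj z) ^ m * (cnj a * z) ^ n \<partial>?M)
        = (if m = n then of_real (pi * \<rho> ^ (2 * n + 2) / (n + 1)) * (cnj a * b) ^ n else 0)" for m
    proof -
      have "(\<integral>z. (b * cnj z) ^ m * (cnj a * z) ^ n \<partial>?M)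
          = (\<integral>z. (b ^ m * cnj a ^ n) * (z ^ n * cnj z ^ m) \<partial>?M)"
        by (simp add: power_mult_distrib mult_ac)
      also have "\<dots> = (b ^ m * cnj a ^ n) * (\<integral>z. z ^ n * cnj z ^ m \<partial>?M)"
        by (rule integral_mult_right_zero)
      finally show ?thesis
        by (simp add: disc_integral_monomial[OF \<rho>(1)] power_mult_distrib mult_ac)
    qed
    ultimately have "(\<integral>z. 1 / (1 - b * cnj z) * (cnj a * z) ^ n \<partial>?M)
        = of_real (pi * \<rho> ^ (2 * n + 2) / (n + 1)) * (cnj a * b) ^ n"
      using sums_unique2[OF _ sums_single[of n]] by (simp cong: if_cong)
    then show ?thesis by (simp add: mult.commute)
  qed
  show ?thesis
    unfolding inner[symmetric]
    by (rule integral_geometric[OF finite_measure_disc, of _ _ _ "1 / (1 - \<rho>)" \<rho>])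
      (use w[OF _ a] bd \<rho> in auto)
qed

section \<open>Poles on the unit circle\<close>

text \<open>
  With \<open>s\<close> the squared modulus, the integrand is \<open>s powr (-1/2)\<close>, which
  is integrable at \<open>0\<close>.
\<close>

lemma set_integrable_reciprocal_disc:
  "set_integrable lborel (ball 0 R) (\<lambda>z::complex. 1 / norm z)"
proof (cases "R \<ge> 0")
  case True
  have ind: "indicator {0..R\<^sup>2} ((norm z)\<^sup>2) = (indicator (cball 0 R) z :: ennreal)" for z :: complex
    using True abs_le_square_iff[of "norm z" R] by (auto simp: indicator_def)
  have "(\<integral>\<^sup>+z. ennreal (((norm z)\<^sup>2) powr (-1/2)) * indicator {0..R\<^sup>2} ((norm (z::complex))\<^sup>2) \<partial>lborel)
      = ennreal pi * (\<integral>\<^sup>+s. (ennreal (s powr (-1/2)) * indicator {0..R\<^sup>2} s) * indicator {0..} s \<partial>lborel)"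
    by (rule nn_integral_radial) measurable
  also have "(\<integral>\<^sup>+s. (ennreal (s powr (-1/2)) * indicator {0..R\<^sup>2} s) * indicator {0..} s \<partial>lborel)
      = (\<integral>\<^sup>+s. ennreal (s powr (-1/2)) * indicator {0..R\<^sup>2} s \<partial>lborel)"
    by (intro nn_integral_cong) (auto simp: indicator_def)
  also have "\<dots> = ennreal ((R\<^sup>2) powr (-1/2+1) / (-1/2+1))"
    by (intro nn_integral_has_integral_lebesgue' has_integral_powr_from_0) auto
  finally have *: "(\<integral>\<^sup>+z. ennreal (((norm z)\<^sup>2) powr (-1/2)) * indicator {0..R\<^sup>2} ((norm (z::complex))\<^sup>2) \<partial>lborel) < \<infinity>"
    by (simp add: ennreal_mult_less_top)
  have "ennreal (norm (indicat_real (cball 0 R) z *\<^sub>R (1 / norm z)))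
     = ennreal (((norm z)\<^sup>2) powr (-1/2)) * indicator {0..R\<^sup>2} ((norm (z::complex))\<^sup>2)" for z
    unfolding ind
    by (cases "z = 0") (auto simp: indicator_def powr_minus powr_half_sqrt field_simps)
  then have "set_integrable lborel (cball 0 R) (\<lambda>z::complex. 1 / norm z)"
    unfolding set_integrable_def using * by (intro integrableI_bounded) auto
  then show ?thesis by (rule set_integrable_subset) auto
qed (simp add: ball_empty)

lemma set_integrable_pole:
  assumes "norm a \<le> 1"
  shows "set_integrable lborel (ball 0 1) (\<lambda>z::complex. 1 / (z - a))"
proof -
  have "set_integrable lborel (ball 0 2) (\<lambda>z::complex. 1 / norm z)"
    by (rule set_integrable_reciprocal_disc)
  then have "integrable (distr lborel borel ((+) (- a))) (\<lambda>z. indicat_real (ball 0 2) z *\<^sub>R (1 / norm z))"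
    unfolding set_integrable_def lborel_distr_plus .
  then have "integrable lborel (\<lambda>z. indicat_real (ball 0 2) (- a + z) *\<^sub>R (1 / norm (- a + z)))"
    by (subst (asm) integrable_distr_eq) auto
  then have "integrable lborel (\<lambda>z. indicator (ball 0 1) z *\<^sub>R (1 / (z - a)))"
  proof (rule Bochner_Integration.integrable_bound)
    show "AE z in lborel. norm (indicat_real (ball 0 1) z *\<^sub>R (1 / (z - a)))
      \<le> norm (indicat_real (ball 0 2) (- a + z) *\<^sub>R (1 / norm (- a + z)))"
    proof (intro AE_I2)
      fix z
      show "norm (indicat_real (ball 0 1) z *\<^sub>R (1 / (z - a)))
        \<le> norm (indicat_real (ball 0 2) (- a + z) *\<^sub>R (1 / norm (- a + z)))"
      proof (cases "z \<in> ball 0 1")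
        case True
        then have "norm (- a + z) < 2"
          using norm_triangle_ineq[of "- a" z] assms by simp
        with True show ?thesis by (simp add: norm_divide)
      qed simp
    qed
  qed measurable
  then show ?thesis unfolding set_integrable_def .
qed

text \<open>
  At each point one of the two distances is at least half of \<open>norm (a - b)\<close>, so the
  product of the two poles is dominated by a multiple of the sum of their moduli.
\<close>

lemma set_integrable_pole_product:
  assumes a: "norm a \<le> 1" and b: "norm b \<le> 1" and ab: "a \<noteq> b"
  shows "set_integrable lborel (ball 0 1) (\<lambda>z::complex. 1 / (z - a) * cnj (1 / (z - b)))"
proof -
  let ?d = "norm (a - b)"
  have "set_integrable lborel (ball 0 1)
     (\<lambda>z. (2 / ?d) * (norm (1 / (z - a)) + norm (1 / (z - b))))"
    using set_integrable_norm[OF set_integrable_pole[OF a]] set_integrable_norm[OF set_integrable_pole[OF b]]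
    by auto
  then show ?thesis
  proof (rule set_integrable_bound)
    show "set_borel_measurable lborel (ball 0 1) (\<lambda>z. 1 / (z - a) * cnj (1 / (z - b)))"
      unfolding set_borel_measurable_def by measurable
    have d: "0 < ?d" using ab by simp
    have "1 / (x * y) \<le> 2 / ?d * (1 / x + 1 / y)" if "0 < x" "0 < y" "?d \<le> x + y" for x y
    proof -
      have "?d * 1 \<le> 2 * (x + y)" using that by simp
      then show ?thesis using that d by (simp add: field_simps)
    qed
    moreover have "?d \<le> norm (z - a) + norm (z - b)" for z
      using norm_triangle_ineq4[of "z - b" "z - a"] by simp
    ultimately have "norm (1 / (z - a)) * norm (1 / (z - b))
       \<le> 2 / ?d * (norm (1 / (z - a)) + norm (1 / (z - b)))" for z
      using d by (cases "z = a \<or> z = b") (auto simp: norm_divide)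
    then show "AE z in lborel. z \<in> ball 0 1 \<longrightarrow> norm (1 / (z - a) * cnj (1 / (z - b)))
       \<le> norm (2 / ?d * (norm (1 / (z - a)) + norm (1 / (z - b))))"
      by (intro AE_I2) (simp only: norm_mult complex_mod_cnj, simp)
  qed
qed

text \<open>
  Passes from the discs of radius less than one, where geometric series apply, to the unit disc.
\<close>

lemma disc_integral_limit:
  fixes f :: "complex \<Rightarrow> complex"
  assumes "set_integrable lborel (ball 0 1) f"
  shows "(\<lambda>k. \<integral>z. f z \<partial>restrict_space lborel (ball 0 (1 - 1 / real (Suc k)))) \<longlonglongrightarrow> (LINT z:ball 0 1|lborel. f z)"
proof -
  let ?A = "\<lambda>k. ball (0::complex) (1 - 1 / real (Suc k))"
  have "(\<Union>k. ?A k) = ball 0 1"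
  proof (intro equalityI subsetI)
    fix z :: complex assume "z \<in> ball 0 1"
    then obtain k where "1 / real (Suc k) < 1 - norm z"
      using nat_approx_posE[of "1 - norm z"] by auto
    then show "z \<in> (\<Union>k. ?A k)" by (intro UN_I[of k]) auto
  next
    fix z :: complex assume "z \<in> (\<Union>k. ?A k)"
    then obtain k where "norm z < 1 - 1 / real (Suc k)" by auto
    then show "z \<in> ball 0 1" by (smt (verit) divide_pos_pos mem_ball_0 of_nat_0_less_iff zero_less_Suc)
  qed
  moreover have "incseq ?A"
    by (intro monoI subset_ball diff_mono divide_left_mono) auto
  ultimately have "(\<lambda>k. LINT z:?A k|lborel. f z) \<longlonglongrightarrow> (LINT z:ball 0 1|lborel. f z)"
    using set_integral_cont_up[of ?A lborel f] assms by simp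
  then show ?thesis
    unfolding set_lebesgue_integral_def by (simp add: integral_restrict_space)
qed

lemma cnj_mult_unimodular:
  assumes "norm a = 1" shows "cnj a * a = 1" "a * cnj a = 1"
  using assms by (simp_all add: complex_norm_square[symmetric] mult.commute[of "cnj a"])

lemma pole_eq_geometric:
  assumes "norm a = 1"
  shows "1 / (z - a) = - cnj a * (1 / (1 - cnj a * z))"
proof -
  have "cnj a * a = 1" using assms by (rule cnj_mult_unimodular)
  then have "1 - cnj a * z = - cnj a * (z - a)" by (simp add: algebra_simps)
  moreover have "cnj a \<noteq> 0" using assms by auto
  ultimately show ?thesis by (simp add: divide_simps)
qed

text \<open>
  The second parameter \<open>0\<close> turns the kernel into a single pole factor, and only the
  constant term of its series survives.
\<close>

lemma disc_integral_pole:
  assumes a: "norm a = 1"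
  shows "(LINT z:ball 0 1|lborel. 1 / (z - a)) = - of_real pi * cnj a"
proof -
  let ?\<rho> = "\<lambda>k::nat. 1 - 1 / real (Suc k)"
  have small: "(\<integral>z. 1 / (z - a) \<partial>restrict_space lborel (ball 0 \<rho>)) = - cnj a * of_real (pi * \<rho>\<^sup>2)"
    if "0 \<le> \<rho>" "\<rho> < 1" for \<rho>
  proof -
    have "(\<lambda>n. of_real (pi * \<rho> ^ (2 * n + 2) / (n + 1)) * (cnj a * 0) ^ n) sums
      (\<integral>z. 1 / (1 - cnj a * z) * cnj (1 / (1 - cnj 0 * z)) \<partial>restrict_space lborel (ball 0 \<rho>))"
      by (rule disc_integral_kernel) (use a that in auto)
    moreover have "(\<lambda>n. of_real (pi * \<rho> ^ (2 * n + 2) / (n + 1)) * (cnj a * 0) ^ n)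
      = (\<lambda>n. if n = 0 then (of_real (pi * \<rho>\<^sup>2) :: complex) else 0)"
      by (simp add: fun_eq_iff power_0_left power2_eq_square)
    ultimately have "(\<lambda>n. if n = 0 then (of_real (pi * \<rho>\<^sup>2) :: complex) else 0) sums
      (\<integral>z. 1 / (1 - cnj a * z) \<partial>restrict_space lborel (ball 0 \<rho>))"
      by simp
    then have "(\<integral>z. 1 / (1 - cnj a * z) \<partial>restrict_space lborel (ball 0 \<rho>)) = of_real (pi * \<rho>\<^sup>2)"
      by (rule sums_unique2[OF _ sums_single])
    then show ?thesis
      unfolding pole_eq_geometric[OF a] by (subst integral_mult_right_zero) simp
  qed
  have "(\<integral>z. 1 / (z - a) \<partial>restrict_space lborel (ball 0 (?\<rho> k))) = - cnj a * of_real (pi * ?\<rho> k ^ 2)" for k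
    by (rule small) auto
  then have "(\<lambda>k. - cnj a * of_real (pi * ?\<rho> k ^ 2)) \<longlonglongrightarrow> (LINT z:ball 0 1|lborel. 1 / (z - a))"
    using disc_integral_limit[OF set_integrable_pole[of a]] a by simp
  moreover have "(\<lambda>k. - cnj a * of_real (pi * ?\<rho> k ^ 2)) \<longlonglongrightarrow> - cnj a * of_real (pi * (1 - 0) ^ 2)"
    by (intro tendsto_intros LIMSEQ_inverse_real_of_nat[unfolded inverse_eq_divide])
  ultimately show ?thesis
    using LIMSEQ_unique by fastforce
qed

text \<open>
  The diagonal of the double series is the series of \<open>- Ln (1 - \<rho>\<^sup>2 * w)\<close>
  with \<open>w = cnj a * b\<close>. Since \<open>w \<noteq> 1\<close> has modulus one, \<open>1 -
  w\<close> is off the branch cut and the limit \<open>\<rho> \<rightarrow> 1\<close> can be taken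
  inside the logarithm.
\<close>

lemma disc_integral_pole_product:
  assumes a: "norm a = 1" and b: "norm b = 1" and ab: "a \<noteq> b"
  shows "(LINT z:ball 0 1|lborel. 1 / (z - a) * cnj (1 / (z - b))) = - of_real pi * Ln (1 - cnj a * b)"
proof -
  let ?\<rho> = "\<lambda>k::nat. 1 - 1 / real (Suc k)"
  define w where "w = cnj a * b"
  have w: "norm w = 1" using a b by (simp add: w_def norm_mult)
  have w1: "w \<noteq> 1"
  proof
    assume "w = 1"
    then have "a * (cnj a * b) = a" by (simp add: w_def)
    moreover have "a * cnj a = 1" using a by (rule cnj_mult_unimodular)
    ultimately show False using ab by (simp add: mult.assoc[symmetric])
  qed
  have "(\<integral>z. 1 / (z - a) * cnj (1 / (z - b)) \<partial>restrict_space lborel (ball 0 (?\<rho> k)))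
      = - of_real pi * Ln (1 - of_real (?\<rho> k ^ 2) * w)" for k
  proof -
    let ?r = "?\<rho> k"
    have r: "0 \<le> ?r" "?r < 1" by auto
    have "(\<lambda>n. of_real (pi * ?r ^ (2 * n + 2) / (n + 1)) * (cnj a * b) ^ n) sums
      (\<integral>z. 1 / (1 - cnj a * z) * cnj (1 / (1 - cnj b * z)) \<partial>restrict_space lborel (ball 0 ?r))"
      by (rule disc_integral_kernel) (use a b in auto)
    then have "(\<lambda>n. w * (of_real (pi * ?r ^ (2 * n + 2) / (n + 1)) * (cnj a * b) ^ n)) sums
      (w * (\<integral>z. 1 / (1 - cnj a * z) * cnj (1 / (1 - cnj b * z)) \<partial>restrict_space lborel (ball 0 ?r)))"
      by (rule sums_mult)
    also have "w * (\<integral>z. 1 / (1 - cnj a * z) * cnj (1 / (1 - cnj b * z)) \<partial>restrict_space lborel (ball 0 ?r))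
      = (\<integral>z. w * (1 / (1 - cnj a * z) * cnj (1 / (1 - cnj b * z))) \<partial>restrict_space lborel (ball 0 ?r))"
      by (rule integral_mult_right_zero[symmetric])
    also have "\<dots> = (\<integral>z. 1 / (z - a) * cnj (1 / (z - b)) \<partial>restrict_space lborel (ball 0 ?r))"
      unfolding pole_eq_geometric[OF a] pole_eq_geometric[OF b] w_def by (simp add: mult_ac)
    also have "(\<lambda>n. w * (of_real (pi * ?r ^ (2 * n + 2) / (n + 1)) * (cnj a * b) ^ n))
      = (\<lambda>n. of_real pi * ((of_real (?r ^ 2) * w) ^ Suc n / of_nat (Suc n)))"
      by (rule ext) (simp add: w_def power_mult_distrib power_add power2_eq_square power_mult mult_ac del: of_real_diff)
    finally have 1: "(\<lambda>n. of_real pi * ((of_real (?r ^ 2) * w) ^ Suc n / of_nat (Suc n))) sums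
       (\<integral>z. 1 / (z - a) * cnj (1 / (z - b)) \<partial>restrict_space lborel (ball 0 ?r))" .
    have "norm (of_real (?r ^ 2) * w) = ?r ^ 2"
      unfolding norm_mult w norm_of_real using r by simp
    also have "\<dots> < 1" using r by (simp add: power_less_one_iff abs_square_less_1)
    finally have "norm (- (of_real (?r ^ 2) * w)) < 1" by simp
    from sums_minus[OF Ln_series'[OF this]]
    have "(\<lambda>n. (of_real (?r ^ 2) * w) ^ n / of_nat n) sums - Ln (1 - of_real (?r ^ 2) * w)"
      by (simp only: minus_minus minus_divide_left diff_conv_add_uminus)
    from sums_Suc_iff[THEN iffD2, of "\<lambda>n. (of_real (?r ^ 2) * w) ^ n / of_nat n"] this
    have "(\<lambda>n. (of_real (?r ^ 2) * w) ^ Suc n / of_nat (Suc n)) sums - Ln (1 - of_real (?r ^ 2) * w)"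
      by simp
    from sums_unique2[OF 1 sums_mult[OF this]] show ?thesis by simp
  qed
  then have "(\<lambda>k. - of_real pi * Ln (1 - of_real (?\<rho> k ^ 2) * w))
     \<longlonglongrightarrow> (LINT z:ball 0 1|lborel. 1 / (z - a) * cnj (1 / (z - b)))"
    using disc_integral_limit[OF set_integrable_pole_product[OF _ _ ab]] a b by simp
  moreover have "(\<lambda>k. - of_real pi * Ln (1 - of_real (?\<rho> k ^ 2) * w))
     \<longlonglongrightarrow> - of_real pi * Ln (1 - of_real ((1 - 0) ^ 2) * w)"
  proof (intro tendsto_intros LIMSEQ_inverse_real_of_nat[unfolded inverse_eq_divide])
    have "Re w < 1"
      using complex_Re_le_cmod[of w] w w1
      by (metis cmod_eq_Re complex_eqI less_eq_real_def norm_complex_def one_complex.simps(1) cmod_power2 add_cancel_right_right one_power2 zero_eq_power2 one_complex.simps(2))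
    then show "1 - of_real ((1 - 0) ^ 2) * w \<notin> \<real>\<^sub>\<le>\<^sub>0"
      by (auto simp: complex_nonpos_Reals_iff)
  qed
  ultimately show ?thesis
    using LIMSEQ_unique w_def by fastforce
qed

section \<open>The energy of one and of two poles\<close>

lemma integrable_indicator_bounded:
  fixes A :: "'a::euclidean_space set"
  assumes "bounded A" "A \<in> sets borel"
  shows "integrable lborel (indicat_real A)"
  using assms emeasure_bounded_finite[of A] by (intro integrable_real_indicator) auto

lemma integral_reflect_at:
  fixes f :: "complex \<Rightarrow> 'a::{banach, second_countable_topology}"
  assumes a: "norm a = 1" and [measurable]: "f \<in> borel_measurable borel"
  shows "(\<integral>z. f (a - a * z) \<partial>lborel) = (\<integral>z. f z \<partial>lborel)"
proof -
  have "(\<integral>z. f (a + (- a) * z) \<partial>lborel) = (\<integral>z. f (a + z) \<partial>lborel)"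
    by (rule integral_rotate[of "- a" "\<lambda>z. f (a + z)"]) (use a in auto)
  also have "\<dots> = (\<integral>z. f z \<partial>distr lborel borel ((+) a))"
    by (subst integral_distr) auto
  finally show ?thesis by (simp add: lborel_distr_plus)
qed

lemma annulus_integral:
  assumes r: "0 < r" "r < 1"
  shows "has_bochner_integral lborel (\<lambda>z::complex. indicator (cball 0 1 - ball 0 r) z * (1 / (norm z)\<^sup>2)) (2 * pi * ln (1 / r))"
proof -
  have ind: "indicator {r\<^sup>2..1} ((norm z)\<^sup>2) = (indicator (cball 0 1 - ball 0 r) z :: ennreal)" for z :: complex
    using r abs_le_square_iff[of "norm z" 1] abs_le_square_iff[of r "norm z"] by (auto simp: indicator_def)
  have "(\<integral>\<^sup>+z. ennreal (1 / (norm z)\<^sup>2) * indicator {r\<^sup>2..1} ((norm (z::complex))\<^sup>2) \<partial>lborel)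
      = ennreal pi * (\<integral>\<^sup>+s. (ennreal (1 / s) * indicator {r\<^sup>2..1} s) * indicator {0..} s \<partial>lborel)"
    by (rule nn_integral_radial) measurable
  also have "(\<integral>\<^sup>+s. (ennreal (1 / s) * indicator {r\<^sup>2..1} s) * indicator {0..} s \<partial>lborel)
      = (\<integral>\<^sup>+s. ennreal (1 / s) * indicator {r\<^sup>2..1} s \<partial>lborel)"
    by (intro nn_integral_cong) (auto simp: indicator_def intro: order_trans[OF zero_le_power2])
  also have "\<dots> = ennreal (ln 1 - ln (r\<^sup>2))"
  proof (rule nn_integral_FTC_Icc)
    fix x assume "x \<in> {r\<^sup>2..1}"
    then have "0 < x" using r by (smt (verit) zero_less_power atLeastAtMost_iff)
    then show "(ln has_field_derivative 1 / x) (at x)" "0 \<le> 1 / x"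
      by (auto intro!: derivative_eq_intros)
  next
    show "r\<^sup>2 \<le> 1" using r by (simp add: power_le_one)
  qed measurable
  also have "ennreal pi * \<dots> = ennreal (2 * pi * ln (1 / r))"
    using r by (simp add: ennreal_mult'[symmetric] ln_div ln_realpow mult_ac)
  finally have "(\<integral>\<^sup>+z. ennreal (1 / (norm z)\<^sup>2) * indicator {r\<^sup>2..1} ((norm (z::complex))\<^sup>2) \<partial>lborel)
      = ennreal (2 * pi * ln (1 / r))" .
  moreover have "ennreal (1 / (norm z)\<^sup>2) * indicator {r\<^sup>2..1} ((norm z)\<^sup>2)
    = ennreal (indicator (cball 0 1 - ball 0 r) z * (1 / (norm z)\<^sup>2))" for z :: complex
    unfolding ind by (auto simp: indicator_def)
  moreover have "0 \<le> 2 * pi * ln (1 / r)"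
    using r by (intro mult_nonneg_nonneg ln_ge_zero) auto
  ultimately show ?thesis
    by (intro has_bochner_integral_nn_integral) auto
qed

definition right_half :: "complex set" where "right_half = {z. 0 < Re z}"

lemma right_half_borel [measurable]: "right_half \<in> sets borel"
  unfolding right_half_def by (simp add: open_halfspace_Re_gt borel_open)

text \<open>
  The point reflection at \<open>0\<close> exchanges the two halves of the annulus, and the line
  between them is null.
\<close>

lemma half_annulus_integral:
  assumes r: "0 < r" "r < 1"
  shows "has_bochner_integral lborel
    (\<lambda>z. indicator (right_half \<inter> (cball 0 1 - ball 0 r)) z * (1 / (norm z)\<^sup>2)) (pi * ln (1 / r))"
proof -
  let ?f = "\<lambda>z::complex. indicator (cball 0 1 - ball 0 r) z * (1 / (norm z)\<^sup>2) :: real"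
  let ?g = "\<lambda>z. indicator right_half z * ?f z"
  note ann = annulus_integral[OF r, unfolded has_bochner_integral_iff]
  have int: "integrable lborel ?g"
    using integrable_mult_indicator[OF _ conjunct1[OF ann], of right_half] by simp
  have "{z. Re z = 0} \<in> null_sets lborel"
  proof -
    have "negligible {z::complex. z \<bullet> 1 = 0}"
      by (intro negligible_standard_hyperplane) (simp add: Basis_complex_def)
    moreover have "closed {z. Re z = 0}" by (intro closed_Collect_eq continuous_intros)
    ultimately show ?thesis
      by (auto simp: negligible_iff_null_sets null_sets_completion_iff)
  qed
  then have "AE z in lborel. Re z \<noteq> 0"
    by (rule AE_I'[of _ lborel]) auto
  then have "AE z in lborel. ?f z = ?g z + ?g (- z)"
    by eventually_elim (auto simp: indicator_def right_half_def)
  then have "(\<integral>z. ?f z \<partial>lborel) = (\<integral>z. ?g z + ?g (- z) \<partial>lborel)"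
    by (intro integral_cong_AE) simp_all
  moreover have int': "integrable lborel (\<lambda>z. ?g (- z))"
  proof -
    have "integrable (distr lborel borel ((*) (-1))) ?g"
      using int by (simp add: lborel_distr_rotate)
    then show ?thesis by (subst (asm) integrable_distr_eq) simp_all
  qed
  moreover have "(\<integral>z. ?g (- z) \<partial>lborel) = (\<integral>z. ?g z \<partial>lborel)"
    using integral_rotate[of "-1" ?g] by simp
  ultimately have "(\<integral>z. ?f z \<partial>lborel) = 2 * (\<integral>z. ?g z \<partial>lborel)"
    using int by simp
  with ann int have "has_bochner_integral lborel ?g (pi * ln (1 / r))"
    by (simp add: has_bochner_integral_iff)
  moreover have "?g = (\<lambda>z. indicator (right_half \<inter> (cball 0 1 - ball 0 r)) z * (1 / (norm z)\<^sup>2))"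
    by (auto simp: indicator_def)
  ultimately show ?thesis by simp
qed

text \<open>
  This is the region between the unit circle around \<open>1\<close> and its tangent at
  \<open>0\<close>. A point \<open>x + \<i> y\<close> of it satisfies \<open>0 < x \<le>
  y\<^sup>2\<close>, so it is so thin near \<open>0\<close> that each horizontal slice contributes
  at most \<open>y\<^sup>2 / y\<^sup>2\<close>.
\<close>

lemma tangent_region_integrable:
  "set_integrable lborel ((right_half - ball 1 1) \<inter> cball 0 1) (\<lambda>z. 1 / (norm z)\<^sup>2)"
proof -
  let ?T = "(right_half - ball 1 1) \<inter> cball 0 1"
  let ?h = "\<lambda>z. ennreal (norm (indicat_real ?T z *\<^sub>R (1 / (norm z)\<^sup>2)))"
  have bound: "?h (Complex x y) \<le> ennreal (1 / y\<^sup>2) * indicator {0..y\<^sup>2} x * indicator {-1..1} y" for x y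
  proof (cases "Complex x y \<in> ?T")
    case True
    then have x: "0 < x" and "1 \<le> norm (Complex x y - 1)" and n: "norm (Complex x y) \<le> 1"
      by (auto simp: right_half_def dist_norm norm_minus_commute)
    then have "1 \<le> (norm (Complex x y - 1))\<^sup>2" by simp
    then have 1: "1 \<le> (x - 1)\<^sup>2 + y\<^sup>2" by (simp add: cmod_power2)
    have "x \<le> 1" using n complex_Re_le_cmod[of "Complex x y"] by simp
    then have "x * x \<le> x" using x by (simp add: mult_left_le)
    with 1 have y: "x \<le> y\<^sup>2" by (simp add: power2_eq_square algebra_simps)
    have "\<bar>y\<bar> \<le> 1" using n abs_Im_le_cmod[of "Complex x y"] by simp
    moreover have "1 / (norm (Complex x y))\<^sup>2 \<le> 1 / y\<^sup>2"
      using x y by (intro divide_left_mono mult_pos_pos) (auto simp: cmod_power2 intro: add_pos_nonneg)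
    ultimately show ?thesis using True x y by (simp add: ennreal_leI indicator_def abs_le_iff)
  qed simp
  have "(\<integral>\<^sup>+z. ?h z \<partial>lborel) = (\<integral>\<^sup>+y. (\<integral>\<^sup>+x. ?h (Complex x y) \<partial>lborel) \<partial>lborel)"
    by (rule nn_integral_complex(1)) measurable
  also have "\<dots> \<le> (\<integral>\<^sup>+y. (\<integral>\<^sup>+x. ennreal (1 / y\<^sup>2) * indicator {0..y\<^sup>2} x * indicator {-1..1} y \<partial>lborel) \<partial>lborel)"
    by (intro nn_integral_mono bound)
  also have "\<dots> \<le> (\<integral>\<^sup>+y. indicator {-1..1::real} y \<partial>lborel)"
  proof (intro nn_integral_mono)
    fix y :: real
    have "(\<integral>\<^sup>+x. ennreal (1 / y\<^sup>2) * indicator {0..y\<^sup>2} x * indicator {-1..1} y \<partial>lborel)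
      = ennreal (1 / y\<^sup>2) * ennreal (y\<^sup>2) * indicator {-1..1} y"
      by (simp add: nn_integral_multc nn_integral_cmult)
    also have "\<dots> \<le> 1 * indicator {-1..1} y"
      by (intro mult_right_mono) (auto simp flip: ennreal_mult')
    finally show "(\<integral>\<^sup>+x. ennreal (1 / y\<^sup>2) * indicator {0..y\<^sup>2} x * indicator {-1..1} y \<partial>lborel)
      \<le> indicator {-1..1} y" by simp
  qed
  also have "\<dots> < \<infinity>" by simp
  finally show ?thesis
    unfolding set_integrable_def by (intro integrableI_bounded) auto
qed

text \<open>
  The Dirichlet energy that a pole at \<open>a\<close> has in the unit disc outside the disc of
  radius \<open>r\<close> around it.
\<close>

definition self_energy :: "complex \<Rightarrow> real \<Rightarrow> real" where
  "self_energy a r = (LINT z:ball 0 1 - ball a r|lborel. (norm (1 / (z - a)))\<^sup>2)"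

text \<open>
  The isometry \<open>z \<mapsto> a - a * z\<close> moves the pole to \<open>0\<close> and the
  unit disc to the disc that touches the imaginary axis there, whatever \<open>a\<close> is.
\<close>

lemma self_energy_eq:
  assumes a: "norm a = 1"
  shows "self_energy a r = (LINT z:ball 1 1 - ball 0 r|lborel. 1 / (norm (z::complex))\<^sup>2)"
proof -
  have "self_energy a r = (\<integral>z. indicator (ball 0 1 - ball a r) (a - a * z) *\<^sub>R (norm (1 / ((a - a * z) - a)))\<^sup>2 \<partial>lborel)"
    unfolding self_energy_def set_lebesgue_integral_def
    by (rule integral_reflect_at[OF a, symmetric]) measurable
  also have "\<dots> = (\<integral>z. indicator (ball 1 1 - ball 0 r) z *\<^sub>R (1 / (norm (z::complex))\<^sup>2) \<partial>lborel)"
  proof (intro Bochner_Integration.integral_cong refl)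
    fix z
    have "norm (a - a * z) = norm (1 - z)"
      using a by (metis mult.right_neutral mult_1 norm_mult right_diff_distrib)
    moreover from this have "norm (a * z - a) = norm (1 - z)" by (simp add: norm_minus_commute)
    ultimately show "indicator (ball 0 1 - ball a r) (a - a * z) *\<^sub>R (norm (1 / ((a - a * z) - a)))\<^sup>2
        = indicator (ball 1 1 - ball 0 r) z *\<^sub>R (1 / (norm z)\<^sup>2)"
      using a by (simp add: indicator_def dist_norm norm_mult norm_divide power_divide)
  qed
  finally show ?thesis unfolding set_lebesgue_integral_def .
qed

text \<open>
  Seen from the pole, the disc differs from the right half of the unit disc by two regions on
  which \<open>1 / (norm z)\<^sup>2\<close> is integrable, and on the half-disc without the small
  disc the energy is exactly \<open>pi * ln (1 / r)\<close>. The constant is the same for all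
  poles on the circle.
\<close>

lemma self_energy_asymptotics:
  obtains K where "\<And>a. norm a = 1 \<Longrightarrow> ((\<lambda>r. self_energy a r - pi * ln (1 / r)) \<longlongrightarrow> K) (at_right 0)"
proof
  let ?f = "\<lambda>z::complex. 1 / (norm z)\<^sup>2"
  let ?T = "(right_half - ball 1 1) \<inter> cball 0 1"
  define K1 where "K1 = (LINT z:ball 1 1 - cball 0 1|lborel. ?f z)"
  define K2 where "K2 = (LINT z:?T|lborel. ?f z)"
  fix a :: complex assume a: "norm a = 1"
  have sub: "z \<in> right_half" if "z \<in> ball 1 1" for z
    using that complex_Re_le_cmod[of "1 - z"] by (simp add: right_half_def dist_norm)
  have int1: "set_integrable lborel (ball 1 1 - cball 0 1) ?f"
  proof -
    have "integrable lborel (indicat_real (ball 1 1 - cball (0::complex) 1))"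
      by (intro integrable_indicator_bounded) (auto intro: bounded_diff)
    then have "set_integrable lborel (ball 1 1 - cball (0::complex) 1) (\<lambda>z. 1 :: real)"
      by (simp add: set_integrable_def)
    then show ?thesis
    proof (rule set_integrable_bound)
      have "1 / (norm z)\<^sup>2 \<le> 1" if "1 < norm z" for z :: complex
        using that by (simp add: divide_le_eq_1 one_le_power)
      then show "AE z in lborel. z \<in> ball 1 1 - cball 0 1 \<longrightarrow> norm (?f z) \<le> norm (1 :: real)"
        by (intro AE_I2) simp
    qed (simp add: set_borel_measurable_def)
  qed
  have split: "self_energy a r - pi * ln (1 / r) = K1 - (LINT z:?T - ball 0 r|lborel. ?f z)" if r: "0 < r" "r < 1" for r
  proof -
    let ?g = "\<lambda>z. indicator (right_half \<inter> (cball 0 1 - ball 0 r)) z * ?f z :: real"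
    have half: "integrable lborel ?g" "(\<integral>z. ?g z \<partial>lborel) = pi * ln (1 / r)"
      using half_annulus_integral[OF r] by (auto simp: has_bochner_integral_iff)
    have int2: "set_integrable lborel (?T - ball 0 r) ?f"
      by (rule set_integrable_subset[OF tangent_region_integrable]) auto
    \<comment> \<open>The punctured disc is the half-annulus, plus the part of the disc outside the unit disc, minus the part of the half-annulus outside the disc.\<close>
    have "indicator (ball 1 1 - ball 0 r) z *\<^sub>R ?f z
      = ?g z + indicator (ball 1 1 - cball 0 1) z *\<^sub>R ?f z - indicator (?T - ball 0 r) z *\<^sub>R ?f z" for z
      using sub[of z] r by (auto simp: indicator_def)
    then have "self_energy a r
      = (\<integral>z. ?g z + indicator (ball 1 1 - cball 0 1) z *\<^sub>R ?f z - indicator (?T - ball 0 r) z *\<^sub>R ?f z \<partial>lborel)"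
      unfolding self_energy_eq[OF a] set_lebesgue_integral_def by simp
    also have "\<dots> = pi * ln (1 / r) + K1 - (LINT z:?T - ball 0 r|lborel. ?f z)"
      using half int1 int2 unfolding K1_def set_lebesgue_integral_def set_integrable_def
      by simp
    finally show ?thesis by simp
  qed
  have "((\<lambda>r. LINT z:?T - ball 0 r|lborel. ?f z) \<longlongrightarrow> K2) (at_right 0)"
  proof (rule tendsto_at_right_sequentially[OF zero_less_one])
    fix S :: "nat \<Rightarrow> real"
    assume S: "\<And>n. 0 < S n" "decseq S" "S \<longlonglongrightarrow> 0"
    have "(\<Union>n. ?T - ball 0 (S n)) = ?T"
    proof (intro equalityI subsetI)
      fix z assume z: "z \<in> ?T"
      then have "0 < norm z" by (auto simp: right_half_def)
      then have "eventually (\<lambda>n. S n < norm z) sequentially"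
        using S(3) by (rule order_tendstoD(2)[rotated])
      then obtain n where "S n < norm z" by (auto simp: eventually_sequentially)
      with z show "z \<in> (\<Union>n. ?T - ball 0 (S n))" by (intro UN_I[of n]) auto
    qed auto
    moreover have "incseq (\<lambda>n. ?T - ball 0 (S n))"
      using S(2) by (auto simp: incseq_def decseq_def) (meson dual_order.strict_trans1 not_le)
    ultimately show "(\<lambda>n. LINT z:?T - ball 0 (S n)|lborel. ?f z) \<longlonglongrightarrow> K2"
      unfolding K2_def using set_integral_cont_up[of "\<lambda>n. ?T - ball 0 (S n)" lborel ?f] tangent_region_integrable
      by simp
  qed
  then have "((\<lambda>r. K1 - (LINT z:?T - ball 0 r|lborel. ?f z)) \<longlongrightarrow> K1 - K2) (at_right 0)"
    by (intro tendsto_intros)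
  moreover have "eventually (\<lambda>r. K1 - (LINT z:?T - ball 0 r|lborel. ?f z) = self_energy a r - pi * ln (1 / r)) (at_right 0)"
    unfolding eventually_at_right_field using split by (intro exI[of _ 1]) auto
  ultimately show "((\<lambda>r. self_energy a r - pi * ln (1 / r)) \<longlongrightarrow> K1 - K2) (at_right 0)"
    by (rule Lim_transform_eventually)
qed

lemma punctured_discs_limit:
  fixes f :: "complex \<Rightarrow> real"
  assumes f: "set_integrable lborel (ball 0 1) f" and a: "norm a = 1" and b: "norm b = 1"
  shows "((\<lambda>r. LINT z:ball 0 1 - (ball a r \<union> ball b r)|lborel. f z) \<longlongrightarrow> (LINT z:ball 0 1|lborel. f z)) (at_right 0)"
proof (rule tendsto_at_right_sequentially[OF zero_less_one])
  fix S :: "nat \<Rightarrow> real"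
  assume S: "\<And>n. 0 < S n" "decseq S" "S \<longlonglongrightarrow> 0"
  let ?A = "\<lambda>n. ball 0 1 - (ball a (S n) \<union> ball b (S n))"
  have "(\<Union>n. ?A n) = ball 0 1"
  proof (intro equalityI subsetI)
    fix z :: complex assume z: "z \<in> ball 0 1"
    then have "0 < min (dist a z) (dist b z)" using a b by auto
    then have "eventually (\<lambda>n. S n < min (dist a z) (dist b z)) sequentially"
      using S(3) by (rule order_tendstoD(2)[rotated])
    then obtain n where "S n < min (dist a z) (dist b z)" by (auto simp: eventually_sequentially)
    with z show "z \<in> (\<Union>n. ?A n)" by (intro UN_I[of n]) auto
  qed auto
  moreover have "incseq ?A"
    using S(2) by (auto simp: incseq_def decseq_def) (meson dual_order.strict_trans1 not_le)+
  ultimately show "(\<lambda>n. LINT z:?A n|lborel. f z) \<longlonglongrightarrow> (LINT z:ball 0 1|lborel. f z)"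
    using set_integral_cont_up[of ?A lborel f] f by simp
qed

text \<open>
  Around the other pole \<open>b\<close> the density of the pole \<open>a\<close> is bounded, so
  cutting out a small disc there costs nothing in the limit.
\<close>

lemma shrinking_disc_limit:
  fixes a b :: complex
  assumes a: "norm a = 1" and b: "norm b = 1" and ab: "a \<noteq> b"
  shows "((\<lambda>r. LINT z:ball 0 1 \<inter> ball b r|lborel. (norm (1 / (z - a)))\<^sup>2) \<longlongrightarrow> 0) (at_right 0)"
proof (rule tendsto_at_right_sequentially)
  show d: "0 < norm (a - b) / 2" using ab by simp
  fix S :: "nat \<Rightarrow> real"
  assume S: "\<And>n. 0 < S n" "\<And>n. S n < norm (a - b) / 2" "decseq S" "S \<longlonglongrightarrow> 0"
  let ?f = "\<lambda>z::complex. (norm (1 / (z - a)))\<^sup>2"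
  let ?A = "\<lambda>n. ball 0 1 \<inter> ball b (S n)"
  have "(\<Inter>n. ?A n) = {}"
  proof (rule ccontr)
    assume "(\<Inter>n. ?A n) \<noteq> {}"
    then obtain z where z: "\<And>n. z \<in> ?A n" by blast
    then have "0 < dist b z" using b by auto
    then have "eventually (\<lambda>n. S n < dist b z) sequentially"
      using S(4) by (rule order_tendstoD(2)[rotated])
    then obtain n where "S n < dist b z" by (auto simp: eventually_sequentially)
    with z[of n] show False by auto
  qed
  moreover have "decseq ?A"
    using S(3) by (auto simp: decseq_def) (meson less_le_trans)
  moreover have "set_integrable lborel (?A 0) ?f"
  proof -
    have "set_integrable lborel (?A 0) (\<lambda>z. (2 / norm (a - b))\<^sup>2)"
      using integrable_indicator_bounded[of "?A 0"] by (auto simp: set_integrable_def bounded_Int)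
    then show ?thesis
    proof (rule set_integrable_bound)
      have "?f z \<le> (2 / norm (a - b))\<^sup>2" if "z \<in> ?A 0" for z
      proof -
        have "norm (a - b) / 2 \<le> norm (z - a)"
          using that S(2)[of 0] norm_triangle_ineq4[of "z - b" "z - a"] by (simp add: dist_norm norm_minus_commute)
        then have "norm (1 / (z - a)) \<le> 1 / (norm (a - b) / 2)"
          unfolding norm_divide norm_one using d by (intro divide_left_mono mult_pos_pos) auto
        then show ?thesis by (intro power_mono) auto
      qed
      then show "AE z in lborel. z \<in> ?A 0 \<longrightarrow> norm (?f z) \<le> norm ((2 / norm (a - b))\<^sup>2)"
        by (intro AE_I2) (simp add: power2_eq_square)
    qed (simp add: set_borel_measurable_def)
  qed
  ultimately show "(\<lambda>n. LINT z:?A n|lborel. ?f z) \<longlonglongrightarrow> 0"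
    using set_integral_cont_down[of ?A lborel ?f] by (simp add: set_lebesgue_integral_def)
qed


text \<open>
  Expanding the square leaves the two self-energies, up to the small disc around the other pole,
  and a remainder that is the real part of a function integrable over the whole disc. The integral
  of this function is known from the integrals of one pole and of a product of two poles.
\<close>

lemma two_pole_energy_limit:
  fixes a b \<delta> :: complex
  assumes a: "norm a = 1" and b: "norm b = 1" and ab: "a \<noteq> b"
    and K: "\<And>c. norm c = 1 \<Longrightarrow> ((\<lambda>r. self_energy c r - pi * ln (1 / r)) \<longlongrightarrow> K) (at_right 0)"
  shows "((\<lambda>r. (LINT z:ball 0 1 - (ball a r \<union> ball b r)|lborel.
      (norm (1 / (z - a) + 1 / (z - b)))\<^sup>2 - 2 * (\<delta> \<bullet> (\<i> * cnj (1 / (z - a) + 1 / (z - b)))))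
      - 2 * pi * ln (1 / r))
    \<longlongrightarrow> 2 * K - 2 * pi * ln (norm (a - b)) + 2 * pi * (\<delta> \<bullet> (\<i> * (a + b)))) (at_right 0)"
proof -
  let ?P = "\<lambda>z::complex. 1 / (z - a)" and ?Q = "\<lambda>z::complex. 1 / (z - b)"
  let ?S = "\<lambda>r. ball 0 1 - (ball a r \<union> ball b r)"
  let ?h = "\<lambda>z. 2 * (?P z * cnj (?Q z)) + 2 * \<i> * \<delta> * (?P z + ?Q z)"
  have intP': "set_integrable lborel (ball 0 1) ?P" and intQ': "set_integrable lborel (ball 0 1) ?Q"
    and intPQ: "set_integrable lborel (ball 0 1) (\<lambda>z. ?P z * cnj (?Q z))"
    by (rule set_integrable_pole set_integrable_pole_product[OF _ _ ab]; use a b in simp)+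
  have inth: "set_integrable lborel (ball 0 1) ?h"
    by (intro set_integral_add(1) set_integrable_mult_right intP' intQ' intPQ)
  have intRe: "set_integrable lborel (ball 0 1) (\<lambda>z. Re (?h z))"
    using integrable_Re[OF inth[unfolded set_integrable_def]] by (simp add: set_integrable_def)
  have "(LINT z:ball 0 1|lborel. ?h z)
      = (LINT z:ball 0 1|lborel. 2 * (?P z * cnj (?Q z))) + (LINT z:ball 0 1|lborel. 2 * \<i> * \<delta> * (?P z + ?Q z))"
    by (intro set_integral_add(2) set_integral_add(1) set_integrable_mult_right intP' intQ' intPQ)
  also have "\<dots> = 2 * (LINT z:ball 0 1|lborel. ?P z * cnj (?Q z))
      + 2 * \<i> * \<delta> * ((LINT z:ball 0 1|lborel. ?P z) + (LINT z:ball 0 1|lborel. ?Q z))"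
    using intP' intQ' by (simp only: set_integral_mult_right set_integral_add(2))
  also have "\<dots> = 2 * (- of_real pi * Ln (1 - cnj a * b)) + 2 * \<i> * \<delta> * (- of_real pi * cnj a + - of_real pi * cnj b)"
    unfolding disc_integral_pole[OF a] disc_integral_pole[OF b] disc_integral_pole_product[OF a b ab] ..
  finally have inth_eq: "(LINT z:ball 0 1|lborel. ?h z) =
    2 * (- of_real pi * Ln (1 - cnj a * b)) + 2 * \<i> * \<delta> * (- of_real pi * cnj a + - of_real pi * cnj b)" .
  have na: "norm (1 - cnj a * b) = norm (a - b)"
  proof -
    have "cnj a * a = 1" using a by (rule cnj_mult_unimodular)
    then have "norm (1 - cnj a * b) = norm (cnj a * (a - b))" by (simp add: right_diff_distrib)
    then show ?thesis using a by (simp add: norm_mult)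
  qed
  then have nz: "1 - cnj a * b \<noteq> 0" using ab by (metis norm_eq_zero right_minus_eq)
  have na': "norm (1 - b * cnj a) = norm (a - b)" using na by (simp add: mult.commute)
  have "(LINT z:ball 0 1|lborel. Re (?h z)) = Re (LINT z:ball 0 1|lborel. ?h z)"
    using integral_Re[OF inth[unfolded set_integrable_def]] by (simp add: set_lebesgue_integral_def)
  also have "\<dots> = - 2 * pi * ln (norm (a - b)) + 2 * pi * (\<delta> \<bullet> (\<i> * (a + b)))"
    unfolding inth_eq using nz by (simp add: na' inner_complex_def algebra_simps)
  finally have Re_eq: "(LINT z:ball 0 1|lborel. Re (?h z)) = \<dots>" .
  have split: "(LINT z:?S r|lborel. (norm (?P z + ?Q z))\<^sup>2 - 2 * (\<delta> \<bullet> (\<i> * cnj (?P z + ?Q z)))) - 2 * pi * ln (1 / r)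
      = (self_energy a r - pi * ln (1 / r)) - (LINT z:ball 0 1 \<inter> ball b r|lborel. (norm (?P z))\<^sup>2)
        + ((self_energy b r - pi * ln (1 / r)) - (LINT z:ball 0 1 \<inter> ball a r|lborel. (norm (?Q z))\<^sup>2))
        + (LINT z:?S r|lborel. Re (?h z))"
    if r: "0 < r" "r < norm (a - b) / 2" for r
  proof -
    have disj: "ball a r \<inter> ball b r = {}"
      by (rule disjoint_ballI) (use r in \<open>simp add: dist_norm\<close>)
    have int: "set_integrable lborel (ball 0 1 - ball c r) (\<lambda>z. (norm (1 / (z - c)))\<^sup>2)" for c :: complex
    proof -
      have "integrable lborel (indicat_real (ball 0 1 - ball c r))"
        by (intro integrable_indicator_bounded) (auto intro: bounded_diff)
      then have "set_integrable lborel (ball 0 1 - ball c r) (\<lambda>z. (1 / r)\<^sup>2)"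
        by (simp add: set_integrable_def)
      then show ?thesis
      proof (rule set_integrable_bound)
        show "AE z in lborel. z \<in> ball 0 1 - ball c r \<longrightarrow> norm ((norm (1 / (z - c)))\<^sup>2) \<le> norm ((1 / r)\<^sup>2)"
        proof (intro AE_I2 impI)
          fix z assume "z \<in> ball 0 1 - ball c r"
          then have "r \<le> norm (z - c)" by (simp add: dist_norm norm_minus_commute)
          then have "norm (1 / (z - c)) \<le> 1 / r"
            unfolding norm_divide norm_one using r by (intro divide_left_mono mult_pos_pos) auto
          then show "norm ((norm (1 / (z - c)))\<^sup>2) \<le> norm ((1 / r)\<^sup>2)"
            unfolding norm_power using r by (intro power_mono) auto
        qed
      qed (simp add: set_borel_measurable_def)
    qed
    have cut: "set_integrable lborel (?S r) (\<lambda>z. (norm (1 / (z - c)))\<^sup>2)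
        \<and> (LINT z:?S r|lborel. (norm (1 / (z - c)))\<^sup>2)
          = self_energy c r - (LINT z:ball 0 1 \<inter> ball d r|lborel. (norm (1 / (z - c)))\<^sup>2)"
      if cd: "c = a \<and> d = b \<or> c = b \<and> d = a" for c d
    proof -
      have eq: "ball 0 1 - ball c r = ?S r \<union> (ball 0 1 \<inter> ball d r)" using disj cd by blast
      have 1: "set_integrable lborel (?S r) (\<lambda>z. (norm (1 / (z - c)))\<^sup>2)"
        and 2: "set_integrable lborel (ball 0 1 \<inter> ball d r) (\<lambda>z. (norm (1 / (z - c)))\<^sup>2)"
        by (rule set_integrable_subset[OF int[of c]]; use eq in auto)+
      have "self_energy c r = (LINT z:?S r|lborel. (norm (1 / (z - c)))\<^sup>2)
          + (LINT z:ball 0 1 \<inter> ball d r|lborel. (norm (1 / (z - c)))\<^sup>2)"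
        unfolding self_energy_def eq using cd by (intro set_integral_Un 1 2) blast
      with 1 show ?thesis by simp
    qed
    have intSP: "set_integrable lborel (?S r) (\<lambda>z. (norm (?P z))\<^sup>2)"
      and intSQ: "set_integrable lborel (?S r) (\<lambda>z. (norm (?Q z))\<^sup>2)"
      using cut[of a b] cut[of b a] by blast+
    have intS: "set_integrable lborel (?S r) (\<lambda>z. Re (?h z))"
      by (rule set_integrable_subset[OF intRe]) auto
    have "(norm (?P z + ?Q z))\<^sup>2 - 2 * (\<delta> \<bullet> (\<i> * cnj (?P z + ?Q z)))
        = (norm (?P z))\<^sup>2 + (norm (?Q z))\<^sup>2 + Re (?h z)" for z
    proof -
      have "(norm (p + q))\<^sup>2 - 2 * (\<delta> \<bullet> (\<i> * cnj (p + q)))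
        = (norm p)\<^sup>2 + (norm q)\<^sup>2 + Re (2 * (p * cnj q) + 2 * \<i> * \<delta> * (p + q))" for p q
        unfolding cmod_power2 by (simp add: inner_complex_def power2_eq_square algebra_simps)
      then show ?thesis .
    qed
    then have "(LINT z:?S r|lborel. (norm (?P z + ?Q z))\<^sup>2 - 2 * (\<delta> \<bullet> (\<i> * cnj (?P z + ?Q z))))
        = (LINT z:?S r|lborel. ((norm (?P z))\<^sup>2 + (norm (?Q z))\<^sup>2) + Re (?h z))"
      by (simp only:)
    also have "\<dots> = (LINT z:?S r|lborel. (norm (?P z))\<^sup>2) + (LINT z:?S r|lborel. (norm (?Q z))\<^sup>2)
        + (LINT z:?S r|lborel. Re (?h z))"
      by (simp only: set_integral_add(2)[OF set_integral_add(1)[OF intSP intSQ] intS]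
          set_integral_add(2)[OF intSP intSQ])
    finally show ?thesis
      using cut[of a b] cut[of b a] by (simp only: simp_thms)
  qed
  have lim: "((\<lambda>r. (self_energy a r - pi * ln (1 / r)) - (LINT z:ball 0 1 \<inter> ball b r|lborel. (norm (?P z))\<^sup>2)
        + ((self_energy b r - pi * ln (1 / r)) - (LINT z:ball 0 1 \<inter> ball a r|lborel. (norm (?Q z))\<^sup>2))
        + (LINT z:?S r|lborel. Re (?h z)))
      \<longlongrightarrow> (K - 0) + (K - 0) + (- 2 * pi * ln (norm (a - b)) + 2 * pi * (\<delta> \<bullet> (\<i> * (a + b))))) (at_right 0)"
    unfolding Re_eq[symmetric]
    by (intro tendsto_add tendsto_diff K a b shrinking_disc_limit ab ab[symmetric] punctured_discs_limit intRe)
  have ev: "eventually (\<lambda>r. r < norm (a - b) / 2) (at_right 0)"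
    using ab by (intro order_tendstoD(2)[OF tendsto_ident_at]) auto
  show ?thesis
  proof (rule Lim_transform_eventually)
    show "eventually (\<lambda>r. (self_energy a r - pi * ln (1 / r)) - (LINT z:ball 0 1 \<inter> ball b r|lborel. (norm (?P z))\<^sup>2)
        + ((self_energy b r - pi * ln (1 / r)) - (LINT z:ball 0 1 \<inter> ball a r|lborel. (norm (?Q z))\<^sup>2))
        + (LINT z:?S r|lborel. Re (?h z))
      = (LINT z:?S r|lborel. (norm (?P z + ?Q z))\<^sup>2 - 2 * (\<delta> \<bullet> (\<i> * cnj (?P z + ?Q z)))) - 2 * pi * ln (1 / r))
      (at_right 0)"
      using ev eventually_at_right_less[of 0] by eventually_elim (rule split[symmetric])
    show "((\<lambda>r. (self_energy a r - pi * ln (1 / r)) - (LINT z:ball 0 1 \<inter> ball b r|lborel. (norm (?P z))\<^sup>2)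
        + ((self_energy b r - pi * ln (1 / r)) - (LINT z:ball 0 1 \<inter> ball a r|lborel. (norm (?Q z))\<^sup>2))
        + (LINT z:?S r|lborel. Re (?h z)))
      \<longlongrightarrow> 2 * K - 2 * pi * ln (norm (a - b)) + 2 * pi * (\<delta> \<bullet> (\<i> * (a + b)))) (at_right 0)"
      using lim by (simp add: algebra_simps)
  qed
qed

section \<open>Harmonic functions as real parts of holomorphic functions\<close>

lemma grad_eq: "GDERIV u z :> D \<Longrightarrow> grad u z = D"
  unfolding grad_def
proof (rule the_equality)
  fix E assume "GDERIV u z :> D" "GDERIV u z :> E"
  then have "(\<lambda>h. h \<bullet> D) = (\<lambda>h. h \<bullet> E)"
    unfolding gderiv_def by (rule has_derivative_unique)
  then have "h \<bullet> D = h \<bullet> E" for h by (rule fun_cong)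
  then have "(E - D) \<bullet> (E - D) = 0" by (simp add: inner_diff_right)
  then show "E = D" by simp
qed

lemma differentiable_GDERIV_grad:
  assumes "u differentiable at z" shows "GDERIV u z :> grad u z"
proof -
  obtain f where f: "(u has_derivative f) (at z)"
    using assms by (auto simp: differentiable_def)
  then interpret bounded_linear f by (rule has_derivative_bounded_linear)
  have "f h = h \<bullet> Complex (f 1) (f \<i>)" for h
  proof -
    have "f h = f (Re h *\<^sub>R 1 + Im h *\<^sub>R \<i>)"
      by (intro arg_cong[of _ _ f]) (simp add: complex_eq_iff)
    also have "\<dots> = Re h * f 1 + Im h * f \<i>" by (simp only: add scaleR real_scaleR_def)
    finally show ?thesis by (simp add: inner_complex_def)
  qed
  then have "f = (\<lambda>h. h \<bullet> Complex (f 1) (f \<i>))" by (rule ext)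
  with f have D: "GDERIV u z :> Complex (f 1) (f \<i>)" unfolding gderiv_def by simp
  then show ?thesis by (simp only: grad_eq[OF D])
qed

lemma GDERIV_Re:
  assumes "(F has_field_derivative D) (at z)"
  shows "GDERIV (\<lambda>z. Re (F z)) z :> cnj D"
proof -
  have "((\<lambda>z. Re (F z)) has_derivative (\<lambda>h. Re (D * h))) (at z)"
    using assms unfolding has_field_derivative_def by (rule bounded_linear.has_derivative[OF bounded_linear_Re])
  moreover have "(\<lambda>h. Re (D * h)) = (\<lambda>h. h \<bullet> cnj D)"
    by (simp add: fun_eq_iff inner_complex_def algebra_simps)
  ultimately show ?thesis unfolding gderiv_def by simp
qed

lemma harmonic_on_Re:
  assumes F: "F holomorphic_on S" and S: "open S"
  shows "harmonic_on S (\<lambda>z. Re (F z))"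
proof -
  let ?u = "\<lambda>z. Re (F z)"
  have F1: "(F has_field_derivative deriv F z) (at z)" if "z \<in> S" for z
    using F S that by (rule holomorphic_derivI)
  have F2: "(deriv F has_field_derivative deriv (deriv F) z) (at z)" if "z \<in> S" for z
    using holomorphic_deriv[OF F S] S that by (rule holomorphic_derivI)
  have g: "grad ?u z = cnj (deriv F z)" if "z \<in> S" for z
    by (intro grad_eq GDERIV_Re F1 that)
  have D: "(grad ?u has_derivative (\<lambda>h. cnj (deriv (deriv F) z * h))) (at z)" if z: "z \<in> S" for z
  proof (rule has_derivative_transform_within_open[OF _ S z])
    show "((\<lambda>z. cnj (deriv F z)) has_derivative (\<lambda>h. cnj (deriv (deriv F) z * h))) (at z)"
      using F2[OF z] unfolding has_field_derivative_def
      by (rule bounded_linear.has_derivative[OF bounded_linear_cnj])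
  qed (use g in simp)
  have fd: "frechet_derivative (grad ?u) (at z) = (\<lambda>h. cnj (deriv (deriv F) z * h))" if "z \<in> S" for z
    using frechet_derivative_at[OF D[OF that]] by simp
  show ?thesis
    unfolding harmonic_on_def
  proof (intro conjI ballI)
    fix z assume z: "z \<in> S"
    show "?u differentiable at z"
      using GDERIV_Re[OF F1[OF z]] unfolding gderiv_def differentiable_def by blast
    show "grad ?u differentiable at z"
      using D[OF z] unfolding differentiable_def by blast
    show "laplacian ?u z = 0"
      unfolding laplacian_def fd[OF z] by (simp add: Basis_complex_def inner_complex_def)
  next
    fix b :: complex
    have "continuous_on S (\<lambda>z. cnj (deriv (deriv F) z * b))"
      by (intro continuous_intros holomorphic_on_imp_continuous_on holomorphic_deriv F S)
    then show "continuous_on S (\<lambda>z. frechet_derivative (grad ?u) (at z) b)"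
      by (rule continuous_on_eq) (simp add: fd)
  qed
qed

text \<open>
  The mean value theorem in direction \<open>v\<close> and then in direction \<open>w\<close>. The
  left-hand side is symmetric in \<open>v\<close> and \<open>w\<close>, the right-hand side is a
  second derivative taken in a definite order.
\<close>

lemma second_difference:
  fixes u :: "'a::real_inner \<Rightarrow> real"
  assumes u: "\<And>p. p \<in> ball x r \<Longrightarrow> GDERIV u p :> g p"
    and g: "\<And>p. p \<in> ball x r \<Longrightarrow> (g has_derivative D p) (at p)"
    and h: "0 < h" "2 * h < r" and v: "norm v \<le> 1" "norm w \<le> 1"
  obtains p where "dist x p \<le> 2 * h"
    "u (x + h *\<^sub>R v + h *\<^sub>R w) - u (x + h *\<^sub>R v) - u (x + h *\<^sub>R w) + u x = h * h * (D p w \<bullet> v)"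
proof -
  have inb: "dist x (x + t *\<^sub>R v + s *\<^sub>R w) \<le> 2 * h" if "0 \<le> t" "t \<le> h" "0 \<le> s" "s \<le> h" for s t
  proof -
    have "norm (t *\<^sub>R v + s *\<^sub>R w) \<le> t * norm v + s * norm w"
      using norm_triangle_ineq[of "t *\<^sub>R v" "s *\<^sub>R w"] that by simp
    also have "\<dots> \<le> h * 1 + h * 1" using that v by (intro add_mono mult_mono) auto
    finally have "norm (t *\<^sub>R v + s *\<^sub>R w) \<le> 2 * h" by simp
    moreover have "x - (x + t *\<^sub>R v + s *\<^sub>R w) = - (t *\<^sub>R v + s *\<^sub>R w)" by simp
    ultimately show ?thesis unfolding dist_norm by (simp only: norm_minus_cancel)
  qed
  have inb': "x + t *\<^sub>R v + s *\<^sub>R w \<in> ball x r" if "0 \<le> t" "t \<le> h" "0 \<le> s" "s \<le> h" for s t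
    using inb[OF that] h by simp
  define \<phi> where "\<phi> s t = u (x + t *\<^sub>R v + s *\<^sub>R w)" for s t
  have d\<phi>: "DERIV (\<phi> s) t :> v \<bullet> g (x + t *\<^sub>R v + s *\<^sub>R w)" if "0 \<le> t" "t \<le> h" "0 \<le> s" "s \<le> h" for s t
  proof -
    have "((\<lambda>t. x + t *\<^sub>R v + s *\<^sub>R w) has_derivative (\<lambda>t. t *\<^sub>R v)) (at t)"
      by (auto intro!: derivative_eq_intros)
    from has_derivative_compose[OF this u[OF inb'[OF that], unfolded gderiv_def]]
    show ?thesis unfolding \<phi>_def by (rule has_derivative_imp_has_field_derivative) simp
  qed
  have "DERIV (\<lambda>t. \<phi> h t - \<phi> 0 t) t :> v \<bullet> g (x + t *\<^sub>R v + h *\<^sub>R w) - v \<bullet> g (x + t *\<^sub>R v + 0 *\<^sub>R w)"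
    if "0 \<le> t" "t \<le> h" for t
    using that h by (intro derivative_intros d\<phi>) auto
  from MVT2[OF h(1) this] obtain t where t: "0 < t" "t < h"
    and 1: "(\<phi> h h - \<phi> 0 h) - (\<phi> h 0 - \<phi> 0 0) = h * (v \<bullet> g (x + t *\<^sub>R v + h *\<^sub>R w) - v \<bullet> g (x + t *\<^sub>R v + 0 *\<^sub>R w))"
    by auto
  have "DERIV (\<lambda>s. v \<bullet> g (x + t *\<^sub>R v + s *\<^sub>R w)) s :> v \<bullet> D (x + t *\<^sub>R v + s *\<^sub>R w) w"
    if s: "0 \<le> s" "s \<le> h" for s
  proof -
    have t': "0 \<le> t" "t \<le> h" using t by auto
    have "((\<lambda>s. x + t *\<^sub>R v + s *\<^sub>R w) has_derivative (\<lambda>s. s *\<^sub>R w)) (at s)"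
      by (auto intro!: derivative_eq_intros)
    from has_derivative_compose[OF this g[OF inb'[OF t' s]]]
    have "((\<lambda>s. g (x + t *\<^sub>R v + s *\<^sub>R w)) has_derivative (\<lambda>s'. D (x + t *\<^sub>R v + s *\<^sub>R w) (s' *\<^sub>R w))) (at s)" .
    from has_derivative_inner_right[OF this, of v]
    show ?thesis
      by (rule has_derivative_imp_has_field_derivative)
        (simp add: linear_scale[OF has_derivative_linear[OF g[OF inb'[OF t' s]]]])
  qed
  from MVT2[OF h(1) this] obtain s where s: "0 < s" "s < h"
    and 2: "v \<bullet> g (x + t *\<^sub>R v + h *\<^sub>R w) - v \<bullet> g (x + t *\<^sub>R v + 0 *\<^sub>R w) = h * (v \<bullet> D (x + t *\<^sub>R v + s *\<^sub>R w) w)"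
    by auto
  show ?thesis
  proof
    show "dist x (x + t *\<^sub>R v + s *\<^sub>R w) \<le> 2 * h" using t s by (intro inb) auto
    show "u (x + h *\<^sub>R v + h *\<^sub>R w) - u (x + h *\<^sub>R v) - u (x + h *\<^sub>R w) + u x
        = h * h * (D (x + t *\<^sub>R v + s *\<^sub>R w) w \<bullet> v)"
      using 1 unfolding 2 \<phi>_def by (simp add: inner_commute algebra_simps)
  qed
qed

text \<open>
  The second difference, divided by the square of the step, converges to the second derivative in
  either order.
\<close>

lemma symmetric_second_derivative:
  fixes u :: "'a::real_inner \<Rightarrow> real"
  assumes S: "open S" "x \<in> S"
    and u: "\<And>p. p \<in> S \<Longrightarrow> GDERIV u p :> g p"
    and g: "\<And>p. p \<in> S \<Longrightarrow> (g has_derivative D p) (at p)"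
    and v: "norm v \<le> 1" "continuous_on S (\<lambda>p. D p v)"
    and w: "norm w \<le> 1" "continuous_on S (\<lambda>p. D p w)"
  shows "D x v \<bullet> w = D x w \<bullet> v"
proof -
  obtain r where r: "0 < r" "ball x r \<subseteq> S" by (rule openE[OF S])
  \<comment> \<open>Two steps of length \<open>h n\<close> stay inside the ball of radius \<open>r\<close>.\<close>
  define h where "h n = r / 3 / real (Suc n)" for n
  have h: "0 < h n" "2 * h n < r" for n
  proof -
    show "0 < h n" using r by (simp add: h_def)
    have "r / 3 / real (Suc n) \<le> r / 3 / 1" using r by (intro divide_left_mono) auto
    then have "h n \<le> r / 3" by (simp only: h_def div_by_1)
    then show "2 * h n < r" using r by simp
  qed
  have h0: "h \<longlonglongrightarrow> 0"
    unfolding h_def by (rule real_tendsto_divide_at_top[OF tendsto_const filterlim_compose[OF filterlim_real_sequentially filterlim_Suc]])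
  let ?\<Delta> = "\<lambda>n. u (x + h n *\<^sub>R v + h n *\<^sub>R w) - u (x + h n *\<^sub>R v) - u (x + h n *\<^sub>R w) + u x"
  have u': "GDERIV u p :> g p" and g': "(g has_derivative D p) (at p)" if "p \<in> ball x r" for p
    by (rule u[OF subsetD[OF r(2) that]], rule g[OF subsetD[OF r(2) that]])
  have "\<exists>p. dist x p \<le> 2 * h n \<and> ?\<Delta> n = h n * h n * (D p w \<bullet> v)" for n
  proof -
    obtain p where "dist x p \<le> 2 * h n" "?\<Delta> n = h n * h n * (D p w \<bullet> v)"
      by (rule second_difference[OF u' g' h(1)[of n] h(2)[of n] v(1) w(1)])
    then show ?thesis by blast
  qed
  then have "\<forall>n. \<exists>p. dist x p \<le> 2 * h n \<and> ?\<Delta> n = h n * h n * (D p w \<bullet> v)" by (rule allI)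
  from choice[OF this] obtain p where
    p: "\<forall>n. dist x (p n) \<le> 2 * h n \<and> ?\<Delta> n = h n * h n * (D (p n) w \<bullet> v)" ..
  have "\<exists>q. dist x q \<le> 2 * h n \<and> ?\<Delta> n = h n * h n * (D q v \<bullet> w)" for n
  proof -
    obtain q where q: "dist x q \<le> 2 * h n"
      "u (x + h n *\<^sub>R w + h n *\<^sub>R v) - u (x + h n *\<^sub>R w) - u (x + h n *\<^sub>R v) + u x = h n * h n * (D q v \<bullet> w)"
      by (rule second_difference[OF u' g' h(1)[of n] h(2)[of n] w(1) v(1)])
    moreover have "u (x + h n *\<^sub>R w + h n *\<^sub>R v) = u (x + h n *\<^sub>R v + h n *\<^sub>R w)"
      by (simp add: add_ac)
    ultimately have "?\<Delta> n = h n * h n * (D q v \<bullet> w)" by linarith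
    with q(1) show ?thesis by blast
  qed
  then have "\<forall>n. \<exists>q. dist x q \<le> 2 * h n \<and> ?\<Delta> n = h n * h n * (D q v \<bullet> w)" by (rule allI)
  from choice[OF this] obtain q where
    q: "\<forall>n. dist x (q n) \<le> 2 * h n \<and> ?\<Delta> n = h n * h n * (D (q n) v \<bullet> w)" ..
  have lim: "y \<longlonglongrightarrow> x" if "\<And>n. dist x (y n) \<le> 2 * h n" for y
  proof (rule Lim_null_comparison[THEN LIM_zero_cancel])
    show "eventually (\<lambda>n. norm (y n - x) \<le> 2 * h n) sequentially"
      using that by (simp add: dist_norm norm_minus_commute)
    show "(\<lambda>n. 2 * h n) \<longlonglongrightarrow> 0" using tendsto_mult_left[OF h0, of 2] by simp
  qed
  have cont: "isCont (\<lambda>p. D p v) x" "isCont (\<lambda>p. D p w) x"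
    using v(2) w(2) S(2) unfolding continuous_on_eq_continuous_at[OF S(1)] by blast+
  have px: "p \<longlonglongrightarrow> x" and qx: "q \<longlonglongrightarrow> x" using p q by (blast intro: lim)+
  have "(\<lambda>n. D (q n) v \<bullet> w) \<longlonglongrightarrow> D x v \<bullet> w"
    by (rule tendsto_inner[OF isCont_tendsto_compose[OF cont(1) qx] tendsto_const])
  moreover have "(\<lambda>n. D (p n) w \<bullet> v) \<longlonglongrightarrow> D x w \<bullet> v"
    by (rule tendsto_inner[OF isCont_tendsto_compose[OF cont(2) px] tendsto_const])
  moreover have "D (q n) v \<bullet> w = D (p n) w \<bullet> v" for n
  proof -
    have "h n * h n * (D (q n) v \<bullet> w) = h n * h n * (D (p n) w \<bullet> v)"
      using spec[OF p, of n] spec[OF q, of n] by linarith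
    then show ?thesis using h(1)[of n] by simp
  qed
  ultimately show ?thesis using LIMSEQ_unique by simp
qed

text \<open>
  The conjugate of the gradient satisfies the Cauchy-Riemann equations: one is the symmetry of the
  second derivatives, the other is the vanishing of the Laplacian. A primitive of it has real part
  \<open>u\<close> up to a constant.
\<close>

lemma harmonic_on_imp_Re_holomorphic:
  assumes u: "harmonic_on S u" and S: "open S" "convex S"
  shows "\<exists>F. F holomorphic_on S \<and> (\<forall>z\<in>S. u z = Re (F z))"
proof -
  define D where "D z = frechet_derivative (grad u) (at z)" for z
  have H: "\<forall>z\<in>S. u differentiable at z" "\<forall>z\<in>S. grad u differentiable at z"
    "\<forall>b\<in>Basis. continuous_on S (\<lambda>z. D z b)" "\<forall>z\<in>S. laplacian u z = 0"
    using u unfolding harmonic_on_def D_def by blast+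
  have du: "GDERIV u z :> grad u z" if "z \<in> S" for z
    using H(1) that by (intro differentiable_GDERIV_grad) blast
  have dg: "(grad u has_derivative D z) (at z)" if "z \<in> S" for z
    using H(2) that unfolding D_def frechet_derivative_works[symmetric] by blast
  have cont: "continuous_on S (\<lambda>z. D z 1)" "continuous_on S (\<lambda>z. D z \<i>)"
    by (rule bspec[OF H(3)], simp add: Basis_complex_def)+
  have hol: "((\<lambda>z. cnj (grad u z)) has_field_derivative cnj (D z 1)) (at z)" if z: "z \<in> S" for z
  proof -
    have "D z 1 \<bullet> \<i> = D z \<i> \<bullet> 1"
      by (rule symmetric_second_derivative[OF S(1) z du dg]) (simp_all add: cont)
    moreover have "D z 1 \<bullet> 1 + D z \<i> \<bullet> \<i> = 0"
      using bspec[OF H(4) z] unfolding laplacian_def D_def by (simp add: Basis_complex_def)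
    ultimately have Di: "D z \<i> = - \<i> * D z 1"
      by (simp add: complex_eq_iff inner_complex_def)
    interpret bounded_linear "D z" using dg[OF z] by (rule has_derivative_bounded_linear)
    have "cnj (D z h) = cnj (D z 1) * h" for h
    proof -
      have "D z h = D z (Re h *\<^sub>R 1 + Im h *\<^sub>R \<i>)"
        by (intro arg_cong[of _ _ "D z"]) (simp add: complex_eq_iff)
      also have "\<dots> = Re h *\<^sub>R D z 1 + Im h *\<^sub>R (- \<i> * D z 1)" by (simp only: add scaleR Di)
      finally show ?thesis by (simp add: complex_eq_iff algebra_simps)
    qed
    then have "(\<lambda>h. cnj (D z h)) = (*) (cnj (D z 1))" by (rule ext)
    then show ?thesis
      using bounded_linear.has_derivative[OF bounded_linear_cnj dg[OF z]]
      unfolding has_field_derivative_def by (simp only:)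
  qed
  have hol': "(\<lambda>z. cnj (grad u z)) holomorphic_on S"
    unfolding holomorphic_on_open[OF S(1)] by (intro ballI exI) (rule hol)
  obtain F where F': "\<And>z. z \<in> S \<Longrightarrow> (F has_field_derivative cnj (grad u z)) (at z within S)"
  proof (rule holomorphic_convex_primitive'[OF S(2,1) hol'])
    fix g assume "\<And>z. z \<in> S \<Longrightarrow> (g has_field_derivative cnj (grad u z)) (at z within S)"
    then show thesis by (rule that)
  qed
  have F: "(F has_field_derivative cnj (grad u z)) (at z)" if "z \<in> S" for z
    using F'[OF that] by (simp only: at_within_open[OF that S(1)])
  have "((\<lambda>z. u z - Re (F z)) has_derivative (\<lambda>h. 0)) (at z within S)" if z: "z \<in> S" for z
  proof (rule has_derivative_at_withinI)
    show "((\<lambda>z. u z - Re (F z)) has_derivative (\<lambda>h. 0)) (at z)"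
      using GDERIV_diff[OF du[OF z] GDERIV_Re[OF F[OF z]]] unfolding gderiv_def by simp
  qed
  from has_derivative_zero_constant[OF S(2) this]
  obtain c where c: "\<And>z. z \<in> S \<Longrightarrow> u z - Re (F z) = c" by blast
  show ?thesis
  proof (intro exI conjI ballI)
    show "(\<lambda>z. F z + of_real c) holomorphic_on S"
    proof (intro holomorphic_intros)
      show "F holomorphic_on S"
        unfolding holomorphic_on_open[OF S(1)] by (intro ballI exI) (rule F)
    qed
    show "u z = Re (F z + of_real c)" if "z \<in> S" for z using c[OF that] by simp
  qed
qed

section \<open>Arc length and Fourier coefficients on the circle\<close>

lemma circle_measure_simps [simp]:
  "space circle_measure = sphere 0 1" "sets circle_measure = sets circle_space"
  by (simp_all add: circle_measure_def space_restrict_space)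

lemma cis_measurable_circle [measurable]: "cis \<in> borel \<rightarrow>\<^sub>M circle_space"
  by (intro measurable_restrict_space2 borel_measurable_continuous_onI continuous_intros) auto

lemma cis_measurable_circle' [measurable]: "cis \<in> restrict_space lborel A \<rightarrow>\<^sub>M circle_space"
  by (intro measurable_restrict_space1) simp

lemma times_measurable_circle:
  assumes "norm c = 1" shows "(\<lambda>x. c * x) \<in> circle_space \<rightarrow>\<^sub>M circle_space"
  by (intro measurable_restrict_space3 borel_measurable_continuous_onI continuous_intros)
    (use assms in \<open>auto simp: norm_mult\<close>)

lemma borel_measurable_circle:
  fixes f :: "complex \<Rightarrow> 'a::topological_space"
  shows "continuous_on (sphere 0 1) f \<Longrightarrow> f \<in> borel_measurable circle_space"
  by (rule borel_measurable_continuous_on_restrict)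

lemma nn_integral_circle:
  assumes [measurable]: "f \<in> borel_measurable circle_space"
  shows "(\<integral>\<^sup>+x. f x \<partial>circle_measure) = (\<integral>\<^sup>+t. f (cis t) * indicator {0..<2*pi} t \<partial>lborel)"
  unfolding circle_measure_def
  by (subst nn_integral_distr) (simp_all add: nn_integral_restrict_space)

lemma integral_circle:
  fixes f :: "complex \<Rightarrow> 'a::{banach, second_countable_topology}"
  assumes [measurable]: "f \<in> borel_measurable circle_space"
  shows "(\<integral>x. f x \<partial>circle_measure) = (\<integral>t. indicator {0..<2*pi} t *\<^sub>R f (cis t) \<partial>lborel)"
  unfolding circle_measure_def
  by (subst integral_distr) (simp_all add: integral_restrict_space)

lemma emeasure_circle: "emeasure circle_measure (sphere 0 1) = ennreal (2 * pi)"
proof -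
  have "emeasure circle_measure (sphere 0 1) = (\<integral>\<^sup>+x. 1 \<partial>circle_measure)"
    by (subst nn_integral_const) simp
  also have "\<dots> = ennreal (2 * pi)"
    by (subst nn_integral_circle) simp_all
  finally show ?thesis .
qed

lemma finite_measure_circle: "finite_measure circle_measure"
  by (intro finite_measureI) (simp add: emeasure_circle)

text \<open>
  In the angle, the rotation is a translation of a function of period \<open>2 * pi\<close>; the
  part of the interval that leaves \<open>{0..<2*pi}\<close> is moved back by one period.
\<close>

lemma nn_integral_circle_rotate:
  assumes [measurable]: "f \<in> borel_measurable circle_space" and c: "norm c = 1"
  shows "(\<integral>\<^sup>+x. f (c * x) \<partial>circle_measure) = (\<integral>\<^sup>+x. f x \<partial>circle_measure)"
proof -
  define \<alpha> where "\<alpha> = Arg2pi c"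
  have \<alpha>: "0 \<le> \<alpha>" "\<alpha> < 2 * pi" using Arg2pi[of c] by (auto simp: \<alpha>_def)
  have c_eq: "c = cis \<alpha>" using Arg2pi_eq[of c] c by (simp add: \<alpha>_def cis_conv_exp)
  define g where "g t = f (cis t)" for t
  have [measurable]: "g \<in> borel_measurable borel" unfolding g_def by measurable
  have per: "g (2 * pi + t) = g t" for t by (simp add: g_def cis_mult[symmetric])
  have fm: "(\<lambda>x. f (c * x)) \<in> borel_measurable circle_space"
    using times_measurable_circle[OF c] assms(1) by (rule measurable_compose)
  have "(\<integral>\<^sup>+x. f (c * x) \<partial>circle_measure) = (\<integral>\<^sup>+t. g (\<alpha> + t) * indicator {\<alpha>..<\<alpha>+2*pi} (\<alpha> + t) \<partial>lborel)"
    unfolding nn_integral_circle[OF fm]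
    by (intro nn_integral_cong) (simp add: g_def c_eq cis_mult indicator_def)
  also have "\<dots> = (\<integral>\<^sup>+t. g t * indicator {\<alpha>..<\<alpha>+2*pi} t \<partial>lborel)"
    using nn_integral_real_affine[of "\<lambda>t. g t * indicator {\<alpha>..<\<alpha>+2*pi} t" 1 \<alpha>] by simp
  also have "\<dots> = (\<integral>\<^sup>+t. g t * indicator {\<alpha>..<2*pi} t + g t * indicator {2*pi..<\<alpha>+2*pi} t \<partial>lborel)"
    by (intro nn_integral_cong) (use \<alpha> in \<open>auto simp: indicator_def\<close>)
  also have "\<dots> = (\<integral>\<^sup>+t. g t * indicator {\<alpha>..<2*pi} t \<partial>lborel) + (\<integral>\<^sup>+t. g t * indicator {2*pi..<\<alpha>+2*pi} t \<partial>lborel)"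
    by (rule nn_integral_add) measurable
  also have "(\<integral>\<^sup>+t. g t * indicator {2*pi..<\<alpha>+2*pi} t \<partial>lborel) = (\<integral>\<^sup>+t. g t * indicator {0..<\<alpha>} t \<partial>lborel)"
    by (subst nn_integral_real_affine[of _ 1 "2*pi"]) (auto simp: per indicator_def intro!: nn_integral_cong)
  also have "(\<integral>\<^sup>+t. g t * indicator {\<alpha>..<2*pi} t \<partial>lborel) + \<dots>
      = (\<integral>\<^sup>+t. g t * indicator {\<alpha>..<2*pi} t + g t * indicator {0..<\<alpha>} t \<partial>lborel)"
    by (rule nn_integral_add[symmetric]) measurable
  also have "\<dots> = (\<integral>\<^sup>+t. g t * indicator {0..<2*pi} t \<partial>lborel)"
    by (intro nn_integral_cong) (use \<alpha> in \<open>auto simp: indicator_def\<close>)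
  also have "\<dots> = (\<integral>\<^sup>+x. f x \<partial>circle_measure)"
    unfolding nn_integral_circle[OF assms(1)] g_def ..
  finally show ?thesis .
qed

lemma circle_measure_rotate:
  assumes c: "norm c = 1"
  shows "distr circle_measure circle_space (\<lambda>x. c * x) = circle_measure"
proof (rule measure_eqI)
  note [measurable] = times_measurable_circle[OF c]
  have cm: "(\<lambda>x. c * x) \<in> circle_measure \<rightarrow>\<^sub>M circle_space"
    using times_measurable_circle[OF c] by (simp cong: measurable_cong_sets)
  fix A assume "A \<in> sets (distr circle_measure circle_space (\<lambda>x. c * x))"
  then have A: "A \<in> sets circle_space" by simp
  have "emeasure (distr circle_measure circle_space (\<lambda>x. c * x)) A
      = (\<integral>\<^sup>+x. indicator A x \<partial>distr circle_measure circle_space (\<lambda>x. c * x))"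
    using A by (simp add: nn_integral_indicator)
  also have "\<dots> = (\<integral>\<^sup>+x. indicator A (c * x) \<partial>circle_measure)"
    using A by (intro nn_integral_distr cm) simp
  also have "\<dots> = (\<integral>\<^sup>+x. indicator A x \<partial>circle_measure)"
    using A by (intro nn_integral_circle_rotate c) simp
  also have "\<dots> = emeasure circle_measure A"
    using A by (simp add: nn_integral_indicator)
  finally show "emeasure (distr circle_measure circle_space (\<lambda>x. c * x)) A = emeasure circle_measure A" .
qed simp

lemma integral_circle_rotate:
  fixes f :: "complex \<Rightarrow> 'a::{banach, second_countable_topology}"
  assumes f: "f \<in> borel_measurable circle_space" and c: "norm c = 1"
  shows "(\<integral>x. f (c * x) \<partial>circle_measure) = (\<integral>x. f x \<partial>circle_measure)"
proof -
  have cm: "(\<lambda>x. c * x) \<in> circle_measure \<rightarrow>\<^sub>M circle_space"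
    using times_measurable_circle[OF c] by (simp cong: measurable_cong_sets)
  have "(\<integral>x. f x \<partial>distr circle_measure circle_space (\<lambda>x. c * x)) = (\<integral>x. f (c * x) \<partial>circle_measure)"
    by (rule integral_distr[OF cm f])
  then show ?thesis unfolding circle_measure_rotate[OF c] by (rule sym)
qed

lemma circle_integral_monomial:
  "(\<integral>x. x ^ n * cnj x ^ m \<partial>circle_measure) = (if n = m then of_real (2 * pi) else 0)"
proof (cases "n = m")
  case True
  have "x ^ n * cnj x ^ m = 1" if "x \<in> sphere 0 1" for x
  proof -
    have "x * cnj x = 1" using that by (simp add: complex_norm_square[symmetric])
    then show ?thesis using True by (metis power_mult_distrib power_one)
  qed
  then have "(\<integral>x. x ^ n * cnj x ^ m \<partial>circle_measure) = (\<integral>x. (1::complex) \<partial>circle_measure)"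
    by (intro Bochner_Integration.integral_cong) simp_all
  also have "\<dots> = of_real (2 * pi)"
    by (simp add: measure_def emeasure_circle scaleR_conv_of_real)
  finally show ?thesis using True by simp
next
  case False
  obtain c :: complex where c: "norm c = 1" "c ^ n * cnj c ^ m = -1"
    by (rule unimodular_power_cnj[OF False])
  let ?I = "\<integral>x. x ^ n * cnj x ^ m \<partial>circle_measure"
  have "?I = (\<integral>x. (c * x) ^ n * cnj (c * x) ^ m \<partial>circle_measure)"
    by (rule integral_circle_rotate[OF _ c(1), symmetric])
      (intro borel_measurable_circle continuous_intros)
  also have "\<dots> = (\<integral>x. (c ^ n * cnj c ^ m) * (x ^ n * cnj x ^ m) \<partial>circle_measure)"
    by (simp add: power_mult_distrib mult_ac)
  also have "\<dots> = - ?I" unfolding c(2) by simp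
  finally show ?thesis using False by simp
qed

lemma borel_measurable_circle_measure:
  fixes f :: "complex \<Rightarrow> 'a::topological_space"
  shows "continuous_on (sphere 0 1) f \<Longrightarrow> f \<in> borel_measurable circle_measure"
  using borel_measurable_circle[of f] by (simp cong: measurable_cong_sets)

lemma integrable_circle_continuous:
  fixes f :: "complex \<Rightarrow> 'a::{banach, second_countable_topology}"
  assumes "continuous_on (sphere 0 1) f"
  shows "integrable circle_measure f"
proof -
  interpret finite_measure circle_measure by (rule finite_measure_circle)
  have "compact (f ` sphere 0 1)" using assms by (intro compact_continuous_image) auto
  then obtain B where "\<And>x. x \<in> sphere 0 1 \<Longrightarrow> norm (f x) \<le> B"
    using compact_imp_bounded bounded_iff by (metis imageI)
  then show ?thesis
    by (intro integrable_const_bound[of _ B] borel_measurable_circle_measure assms AE_I2) simp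
qed

text \<open>
  The real part of \<open>F\<close> is half of \<open>F\<close> plus half of its conjugate. The
  conjugate consists of non-positive frequencies, so it contributes nothing to a coefficient of
  positive order.
\<close>

lemma fourier_coefficient_Re:
  assumes F: "F holomorphic_on ball 0 1" and r: "0 \<le> r" "r < 1" and n: "0 < n"
  shows "(\<integral>x. of_real (Re (F (r *\<^sub>R x))) * cnj x ^ n \<partial>circle_measure)
    = of_real pi * ((deriv ^^ n) F 0 / fact n) * of_real (r ^ n)"
proof -
  define d where "d k = (deriv ^^ k) F 0 / fact k" for k
  have sums: "(\<lambda>k. d k * w ^ k) sums F w" if "norm w < 1" for w
    using holomorphic_power_series[OF F, of w] that by (simp add: d_def)
  have "norm (complex_of_real ((1 + r) / 2)) < 1" unfolding norm_of_real using r by simp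
  from sums_summable[OF sums[OF this]]
  have summ: "summable (\<lambda>k. norm (d k * of_real r ^ k))"
    by (rule powser_insidea) (unfold norm_of_real, use r in simp)
  have cont: "continuous_on (sphere 0 1) (\<lambda>x. F (r *\<^sub>R x))"
    by (rule continuous_on_compose2[OF holomorphic_on_imp_continuous_on[OF F]])
      (use r in \<open>auto intro!: continuous_intros\<close>)
  have nx: "norm (r *\<^sub>R x) < 1" if "x \<in> sphere 0 1" for x :: complex using that r by simp
  have 1: "(\<lambda>k. \<integral>x. d k * (r *\<^sub>R x) ^ k * cnj x ^ n \<partial>circle_measure) sums
      (\<integral>x. F (r *\<^sub>R x) * cnj x ^ n \<partial>circle_measure)"
  proof (rule integral_termwise[OF finite_measure_circle _ _ summ])
    show "(\<lambda>x. d k * (r *\<^sub>R x) ^ k * cnj x ^ n) \<in> borel_measurable circle_measure" for k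
      by (intro borel_measurable_circle_measure continuous_intros)
    show "norm (d k * (r *\<^sub>R x) ^ k * cnj x ^ n) \<le> norm (d k * of_real r ^ k)"
      if "x \<in> space circle_measure" for k x
      using that r by (simp add: norm_mult norm_power)
    show "(\<lambda>k. d k * (r *\<^sub>R x) ^ k * cnj x ^ n) sums (F (r *\<^sub>R x) * cnj x ^ n)"
      if "x \<in> space circle_measure" for x
      using that by (intro sums_mult2 sums nx) simp
  qed
  have 2: "(\<lambda>k. \<integral>x. cnj (d k * (r *\<^sub>R x) ^ k) * cnj x ^ n \<partial>circle_measure) sums
      (\<integral>x. cnj (F (r *\<^sub>R x)) * cnj x ^ n \<partial>circle_measure)"
  proof (rule integral_termwise[OF finite_measure_circle _ _ summ])
    show "(\<lambda>x. cnj (d k * (r *\<^sub>R x) ^ k) * cnj x ^ n) \<in> borel_measurable circle_measure" for k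
      by (intro borel_measurable_circle_measure continuous_intros)
    show "norm (cnj (d k * (r *\<^sub>R x) ^ k) * cnj x ^ n) \<le> norm (d k * of_real r ^ k)"
      if "x \<in> space circle_measure" for k x
      using that r by (simp add: norm_mult norm_power)
    show "(\<lambda>k. cnj (d k * (r *\<^sub>R x) ^ k) * cnj x ^ n) sums (cnj (F (r *\<^sub>R x)) * cnj x ^ n)"
      if "x \<in> space circle_measure" for x
      using that by (intro sums_mult2 sums_cnj[THEN iffD2] sums nx) simp
  qed
  have t1: "(\<integral>x. d k * (r *\<^sub>R x) ^ k * cnj x ^ n \<partial>circle_measure)
      = (if k = n then d n * of_real (r ^ n) * of_real (2 * pi) else 0)" for k
  proof -
    have "(\<integral>x. d k * (r *\<^sub>R x) ^ k * cnj x ^ n \<partial>circle_measure)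
        = (\<integral>x. (d k * of_real (r ^ k)) * (x ^ k * cnj x ^ n) \<partial>circle_measure)"
      by (simp add: scaleR_conv_of_real power_mult_distrib mult_ac)
    also have "\<dots> = (d k * of_real (r ^ k)) * (\<integral>x. x ^ k * cnj x ^ n \<partial>circle_measure)"
      by (rule integral_mult_right_zero)
    finally show ?thesis by (simp add: circle_integral_monomial)
  qed
  have t2: "(\<integral>x. cnj (d k * (r *\<^sub>R x) ^ k) * cnj x ^ n \<partial>circle_measure) = 0" for k
  proof -
    have "(\<integral>x. cnj (d k * (r *\<^sub>R x) ^ k) * cnj x ^ n \<partial>circle_measure)
        = (\<integral>x. (cnj (d k) * of_real (r ^ k)) * (x ^ 0 * cnj x ^ (k + n)) \<partial>circle_measure)"
      by (simp add: scaleR_conv_of_real power_mult_distrib power_add mult_ac)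
    also have "\<dots> = (cnj (d k) * of_real (r ^ k)) * (\<integral>x. x ^ 0 * cnj x ^ (k + n) \<partial>circle_measure)"
      by (rule integral_mult_right_zero)
    finally show ?thesis using n unfolding circle_integral_monomial by simp
  qed
  have I1: "(\<integral>x. F (r *\<^sub>R x) * cnj x ^ n \<partial>circle_measure) = d n * of_real (r ^ n) * of_real (2 * pi)"
    using 1 unfolding t1 by (rule sums_unique2[OF _ sums_single])
  have I2: "(\<integral>x. cnj (F (r *\<^sub>R x)) * cnj x ^ n \<partial>circle_measure) = 0"
    using 2 unfolding t2 by (rule sums_unique2[OF _ sums_zero])
  have split: "of_real (Re w) * p = (w * p + cnj w * p) / 2" for w p :: complex
    unfolding distrib_right[symmetric] complex_add_cnj by simp
  have "(\<integral>x. of_real (Re (F (r *\<^sub>R x))) * cnj x ^ n \<partial>circle_measure)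
      = (\<integral>x. (F (r *\<^sub>R x) * cnj x ^ n + cnj (F (r *\<^sub>R x)) * cnj x ^ n) / 2 \<partial>circle_measure)"
    by (intro Bochner_Integration.integral_cong refl split)
  also have "\<dots> = (\<integral>x. F (r *\<^sub>R x) * cnj x ^ n + cnj (F (r *\<^sub>R x)) * cnj x ^ n \<partial>circle_measure) / 2"
    by (rule integral_divide_zero)
  also have "(\<integral>x. F (r *\<^sub>R x) * cnj x ^ n + cnj (F (r *\<^sub>R x)) * cnj x ^ n \<partial>circle_measure)
      = (\<integral>x. F (r *\<^sub>R x) * cnj x ^ n \<partial>circle_measure) + (\<integral>x. cnj (F (r *\<^sub>R x)) * cnj x ^ n \<partial>circle_measure)"
    by (intro Bochner_Integration.integral_add integrable_circle_continuous continuous_intros cont)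
  finally show ?thesis unfolding I1 I2 d_def by simp
qed

section \<open>Uniqueness of the gradient of the phase\<close>

text \<open>
  Real and imaginary parts of powers are admissible test functions, and their tangential
  derivatives are again of this form.
\<close>

lemma trigonometric_test_function:
  fixes c :: complex
  shows "C1_on_circle (\<lambda>x. Re (c * x ^ n))"
    and "tangential_deriv (\<lambda>x. Re (c * x ^ n)) x = - real n * Im (c * x ^ n)"
proof -
  have eq: "Re (c * (x * cis s) ^ n) = Re (c * x ^ n) * cos (real n * s) - Im (c * x ^ n) * sin (real n * s)" for x s
  proof -
    have "c * (x * cis s) ^ n = (c * x ^ n) * cis (real n * s)"
      by (simp add: power_mult_distrib Complex.DeMoivre)
    then have "Re (c * (x * cis s) ^ n) = Re ((c * x ^ n) * cis (real n * s))" by (rule arg_cong)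
    then show ?thesis by (simp only: times_complex.sel(1)[of "c * x ^ n"] cis.sel)
  qed
  have D: "((\<lambda>s. Re (c * (x * cis s) ^ n)) has_field_derivative - real n * Im (c * x ^ n)) (at 0)" for x
    unfolding eq by (auto intro!: derivative_eq_intros)
  show td: "tangential_deriv (\<lambda>x. Re (c * x ^ n)) x = - real n * Im (c * x ^ n)" for x
    unfolding tangential_deriv_def by (rule DERIV_imp_deriv[OF D])
  show "C1_on_circle (\<lambda>x. Re (c * x ^ n))"
    unfolding C1_on_circle_def td
  proof (intro conjI ballI)
    fix x
    show "(\<lambda>s. Re (c * (x * cis s) ^ n)) differentiable at 0"
      using D real_differentiable_def by blast
    show "continuous_on (sphere 0 1) (\<lambda>x. - real n * Im (c * x ^ n))"
      by (intro continuous_intros)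
  qed
qed

lemma integrable_circle_times:
  fixes g :: "complex \<Rightarrow> complex"
  assumes \<phi>: "integrable circle_measure (\<phi> :: complex \<Rightarrow> real)"
    and g: "continuous_on (sphere 0 1) g" "\<And>x. x \<in> sphere 0 1 \<Longrightarrow> norm (g x) \<le> 1"
  shows "integrable circle_measure (\<lambda>x. of_real (\<phi> x) * g x)"
proof (rule Bochner_Integration.integrable_bound[OF \<phi>])
  show "(\<lambda>x. of_real (\<phi> x) * g x) \<in> borel_measurable circle_measure"
    using borel_measurable_integrable[OF \<phi>] borel_measurable_circle_measure[OF g(1)] by measurable
  show "AE x in circle_measure. norm (of_real (\<phi> x) * g x) \<le> norm (\<phi> x)"
    by (intro AE_I2) (simp add: norm_mult mult_left_le g(2))
qed

text \<open>
  For a positive order, the trigonometric functions are tangential derivatives of test functions.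
  The distributional derivative therefore determines all Fourier coefficients except the mean.
\<close>

lemma BV_derivative_fourier:
  assumes \<phi>1: "has_BV_tangential_derivative \<phi>1 \<mu> \<nu>" and \<phi>2: "has_BV_tangential_derivative \<phi>2 \<mu> \<nu>"
    and n: "0 < n"
  shows "(\<integral>x. of_real (\<phi>1 x - \<phi>2 x) * cnj x ^ n \<partial>circle_measure) = 0"
proof -
  have i: "integrable circle_measure \<phi>1" "integrable circle_measure \<phi>2"
    using \<phi>1 \<phi>2 by (auto simp: has_BV_tangential_derivative_def)
  then have id: "integrable circle_measure (\<lambda>x. \<phi>1 x - \<phi>2 x)" by simp
  have ii: "integrable circle_measure (\<lambda>x. of_real (\<phi>1 x - \<phi>2 x) * cnj x ^ n)"
    by (rule integrable_circle_times[OF id]) (auto intro!: continuous_intros simp: norm_power)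
  have test: "(\<integral>x. (\<phi>1 x - \<phi>2 x) * (- real n * Im (c * x ^ n)) \<partial>circle_measure) = 0"
    if c: "norm c = 1" for c
  proof -
    let ?\<zeta> = "\<lambda>x. Re (c * x ^ n)"
    have C1: "C1_on_circle ?\<zeta>" by (rule trigonometric_test_function)
    have int: "integrable circle_measure (\<lambda>x. \<phi> x * (- real n * Im (c * x ^ n)))"
      if \<phi>: "integrable circle_measure \<phi>" for \<phi>
    proof -
      have "integrable circle_measure (\<lambda>x. of_real (\<phi> x) * (c * x ^ n))"
        by (rule integrable_circle_times[OF \<phi>]) (auto intro!: continuous_intros simp: norm_power norm_mult c)
      then have "integrable circle_measure (\<lambda>x. - real n * Im (of_real (\<phi> x) * (c * x ^ n)))"
        by (intro integrable_mult_right integrable_Im)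
      moreover have "(\<lambda>x. - real n * Im (of_real (\<phi> x) * (c * x ^ n))) = (\<lambda>x. \<phi> x * (- real n * Im (c * x ^ n)))"
        by (rule ext) (simp add: algebra_simps)
      ultimately show ?thesis by (simp only:)
    qed
    have "(\<integral>x. \<phi>1 x * tangential_deriv ?\<zeta> x \<partial>circle_measure) = (\<integral>x. \<phi>2 x * tangential_deriv ?\<zeta> x \<partial>circle_measure)"
      using \<phi>1 \<phi>2 C1 unfolding has_BV_tangential_derivative_def by metis
    then have eq: "(\<integral>x. \<phi>1 x * (- real n * Im (c * x ^ n)) \<partial>circle_measure)
        = (\<integral>x. \<phi>2 x * (- real n * Im (c * x ^ n)) \<partial>circle_measure)"
      unfolding trigonometric_test_function(2) .
    have "(\<integral>x. (\<phi>1 x - \<phi>2 x) * (- real n * Im (c * x ^ n)) \<partial>circle_measure)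
      = (\<integral>x. \<phi>1 x * (- real n * Im (c * x ^ n)) - \<phi>2 x * (- real n * Im (c * x ^ n)) \<partial>circle_measure)"
      unfolding left_diff_distrib ..
    also have "\<dots> = 0"
      unfolding Bochner_Integration.integral_diff[OF int[OF i(1)] int[OF i(2)]] eq by simp
    finally show ?thesis .
  qed
  show ?thesis
  proof (rule complex_eqI)
    have "Re (\<integral>x. of_real (\<phi>1 x - \<phi>2 x) * cnj x ^ n \<partial>circle_measure)
        = (\<integral>x. Re (of_real (\<phi>1 x - \<phi>2 x) * cnj x ^ n) \<partial>circle_measure)"
      by (rule integral_Re[OF ii, symmetric])
    also have "\<dots> = (\<integral>x. - (1 / real n) * ((\<phi>1 x - \<phi>2 x) * (- real n * Im (\<i> * x ^ n))) \<partial>circle_measure)"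
      using n by (intro Bochner_Integration.integral_cong refl) (simp flip: complex_cnj_power)
    also have "\<dots> = - (1 / real n) * (\<integral>x. (\<phi>1 x - \<phi>2 x) * (- real n * Im (\<i> * x ^ n)) \<partial>circle_measure)"
      by (rule integral_mult_right_zero)
    also have "\<dots> = 0" by (simp only: test norm_ii mult_zero_right)
    finally show "Re (\<integral>x. of_real (\<phi>1 x - \<phi>2 x) * cnj x ^ n \<partial>circle_measure) = Re 0" by simp
    have "Im (\<integral>x. of_real (\<phi>1 x - \<phi>2 x) * cnj x ^ n \<partial>circle_measure)
        = (\<integral>x. Im (of_real (\<phi>1 x - \<phi>2 x) * cnj x ^ n) \<partial>circle_measure)"
      by (rule integral_Im[OF ii, symmetric])
    also have "\<dots> = (\<integral>x. (1 / real n) * ((\<phi>1 x - \<phi>2 x) * (- real n * Im (1 * x ^ n))) \<partial>circle_measure)"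
      using n by (intro Bochner_Integration.integral_cong refl) (simp flip: complex_cnj_power)
    also have "\<dots> = (1 / real n) * (\<integral>x. (\<phi>1 x - \<phi>2 x) * (- real n * Im (1 * x ^ n)) \<partial>circle_measure)"
      by (rule integral_mult_right_zero)
    also have "\<dots> = 0" by (simp only: test norm_one mult_zero_right)
    finally show "Im (\<integral>x. of_real (\<phi>1 x - \<phi>2 x) * cnj x ^ n \<partial>circle_measure) = Im 0" by simp
  qed
qed

text \<open>
  The difference of the two extensions is the real part of a holomorphic function. Its Fourier
  coefficients on the circle of radius \<open>r\<close> are \<open>pi * d n * r ^ n\<close>, and
  the convergence in mean to the boundary values forces them to tend to those of the difference of
  the boundary values, which vanish for \<open>n > 0\<close>. Hence every \<open>d n\<close> with
  \<open>n > 0\<close> is zero and the difference is constant.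
\<close>

lemma harmonic_extension_grad_unique:
  assumes u1: "is_harmonic_extension \<phi>1 u1" and \<phi>1: "has_BV_tangential_derivative \<phi>1 \<mu> \<nu>"
    and u2: "is_harmonic_extension \<phi>2 u2" and \<phi>2: "has_BV_tangential_derivative \<phi>2 \<mu> \<nu>"
    and z: "z \<in> ball 0 1"
  shows "grad u1 z = grad u2 z"
proof -
  have h: "harmonic_on (ball 0 1) u1" "harmonic_on (ball 0 1) u2"
    and lim: "((\<lambda>r. \<integral>x. \<bar>u1 (r *\<^sub>R x) - \<phi>1 x\<bar> \<partial>circle_measure) \<longlongrightarrow> 0) (at_left 1)"
      "((\<lambda>r. \<integral>x. \<bar>u2 (r *\<^sub>R x) - \<phi>2 x\<bar> \<partial>circle_measure) \<longlongrightarrow> 0) (at_left 1)"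
    using u1 u2 unfolding is_harmonic_extension_def by blast+
  have i: "integrable circle_measure \<phi>1" "integrable circle_measure \<phi>2"
    using \<phi>1 \<phi>2 unfolding has_BV_tangential_derivative_def by blast+
  from harmonic_on_imp_Re_holomorphic[OF h(1) open_ball convex_ball]
  obtain F1 where F1: "F1 holomorphic_on ball 0 1" "\<And>z. z \<in> ball 0 1 \<Longrightarrow> u1 z = Re (F1 z)"
    by blast
  from harmonic_on_imp_Re_holomorphic[OF h(2) open_ball convex_ball]
  obtain F2 where F2: "F2 holomorphic_on ball 0 1" "\<And>z. z \<in> ball 0 1 \<Longrightarrow> u2 z = Re (F2 z)"
    by blast
  define F where "F z = F1 z - F2 z" for z
  have F: "F holomorphic_on ball 0 1"
    unfolding F_def by (intro holomorphic_intros F1 F2)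
  define d where "d k = (deriv ^^ k) F 0 / fact k" for k
  have d0: "d n = 0" if n: "0 < n" for n
  proof -
    have bound: "norm (of_real pi * d n * of_real (r ^ n))
        \<le> (\<integral>x. \<bar>u1 (r *\<^sub>R x) - \<phi>1 x\<bar> \<partial>circle_measure) + (\<integral>x. \<bar>u2 (r *\<^sub>R x) - \<phi>2 x\<bar> \<partial>circle_measure)"
      if r: "0 < r" "r < 1" for r
    proof -
      have in_ball: "r *\<^sub>R x \<in> ball 0 1" if "x \<in> sphere 0 1" for x :: complex
        using that r by simp
      have cont: "continuous_on (sphere 0 1) (\<lambda>x. Re (G (r *\<^sub>R x)))" if "G holomorphic_on ball 0 1" for G
        by (intro continuous_on_Re continuous_on_compose2[OF holomorphic_on_imp_continuous_on[OF that]] continuous_intros)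
          (use in_ball in blast)
      have c1: "continuous_on (sphere 0 1) (\<lambda>x. u1 (r *\<^sub>R x))"
        using cont[OF F1(1)] by (rule continuous_on_eq) (simp add: F1(2)[OF in_ball])
      have c2: "continuous_on (sphere 0 1) (\<lambda>x. u2 (r *\<^sub>R x))"
        using cont[OF F2(1)] by (rule continuous_on_eq) (simp add: F2(2)[OF in_ball])
      have e1: "integrable circle_measure (\<lambda>x. u1 (r *\<^sub>R x) - \<phi>1 x)"
        and e2: "integrable circle_measure (\<lambda>x. u2 (r *\<^sub>R x) - \<phi>2 x)"
        by (intro Bochner_Integration.integrable_diff integrable_circle_continuous c1 c2 i)+
      let ?e = "\<lambda>x. (u1 (r *\<^sub>R x) - \<phi>1 x) - (u2 (r *\<^sub>R x) - \<phi>2 x)"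
      have e: "integrable circle_measure ?e" using e1 e2 by (rule Bochner_Integration.integrable_diff)
      have id: "integrable circle_measure (\<lambda>x. \<phi>1 x - \<phi>2 x)"
        using i by (rule Bochner_Integration.integrable_diff)
      have I: "integrable circle_measure (\<lambda>x. of_real (\<phi> x) * cnj x ^ n)"
        if \<phi>: "integrable circle_measure \<phi>" for \<phi> :: "complex \<Rightarrow> real"
        by (rule integrable_circle_times[OF \<phi>]) (auto intro!: continuous_intros simp: norm_power)
      have "of_real pi * d n * of_real (r ^ n)
          = (\<integral>x. of_real (Re (F (r *\<^sub>R x))) * cnj x ^ n \<partial>circle_measure)"
        using fourier_coefficient_Re[OF F _ r(2) n] r(1) by (simp add: d_def)
      also have "\<dots> = (\<integral>x. of_real (?e x) * cnj x ^ n + of_real (\<phi>1 x - \<phi>2 x) * cnj x ^ n \<partial>circle_measure)"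
      proof (intro Bochner_Integration.integral_cong refl)
        fix x assume "x \<in> space circle_measure"
        then have "x \<in> sphere 0 1" by simp
        note b = in_ball[OF this]
        have eq: "Re (F (r *\<^sub>R x)) = ?e x + (\<phi>1 x - \<phi>2 x)"
          by (simp add: F_def F1(2)[OF b] F2(2)[OF b])
        show "of_real (Re (F (r *\<^sub>R x))) * cnj x ^ n = of_real (?e x) * cnj x ^ n + of_real (\<phi>1 x - \<phi>2 x) * cnj x ^ n"
          unfolding eq of_real_add distrib_right ..
      qed
      also have "\<dots> = (\<integral>x. of_real (?e x) * cnj x ^ n \<partial>circle_measure) + (\<integral>x. of_real (\<phi>1 x - \<phi>2 x) * cnj x ^ n \<partial>circle_measure)"
        by (rule Bochner_Integration.integral_add[OF I[OF e] I[OF id]])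
      also have "\<dots> = (\<integral>x. of_real (?e x) * cnj x ^ n \<partial>circle_measure)"
        unfolding BV_derivative_fourier[OF \<phi>1 \<phi>2 n] by simp
      finally have eq: "of_real pi * d n * of_real (r ^ n) = (\<integral>x. of_real (?e x) * cnj x ^ n \<partial>circle_measure)" .
      have "norm (\<integral>x. of_real (?e x) * cnj x ^ n \<partial>circle_measure)
          \<le> (\<integral>x. norm (of_real (?e x) * cnj x ^ n) \<partial>circle_measure)"
        by (rule integral_norm_bound)
      also have "\<dots> \<le> (\<integral>x. \<bar>u1 (r *\<^sub>R x) - \<phi>1 x\<bar> + \<bar>u2 (r *\<^sub>R x) - \<phi>2 x\<bar> \<partial>circle_measure)"
      proof (rule integral_mono[OF integrable_norm[OF I[OF e]]])
        show "integrable circle_measure (\<lambda>x. \<bar>u1 (r *\<^sub>R x) - \<phi>1 x\<bar> + \<bar>u2 (r *\<^sub>R x) - \<phi>2 x\<bar>)"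
          by (intro Bochner_Integration.integrable_add integrable_abs e1 e2)
        fix x assume "x \<in> space circle_measure"
        then have "norm (of_real (?e x) * cnj x ^ n) = \<bar>?e x\<bar>"
          by (simp only: norm_mult norm_of_real norm_power complex_mod_cnj) simp
        then show "norm (of_real (?e x) * cnj x ^ n) \<le> \<bar>u1 (r *\<^sub>R x) - \<phi>1 x\<bar> + \<bar>u2 (r *\<^sub>R x) - \<phi>2 x\<bar>"
          by linarith
      qed
      also have "\<dots> = (\<integral>x. \<bar>u1 (r *\<^sub>R x) - \<phi>1 x\<bar> \<partial>circle_measure) + (\<integral>x. \<bar>u2 (r *\<^sub>R x) - \<phi>2 x\<bar> \<partial>circle_measure)"
        by (intro Bochner_Integration.integral_add integrable_abs e1 e2)
      finally show ?thesis unfolding eq .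
    qed
    have l1: "((\<lambda>r. norm (of_real pi * d n * of_real (r ^ n))) \<longlongrightarrow> norm (of_real pi * d n * of_real (1 ^ n))) (at_left (1::real))"
      by (intro tendsto_intros)
    have l2: "((\<lambda>r. (\<integral>x. \<bar>u1 (r *\<^sub>R x) - \<phi>1 x\<bar> \<partial>circle_measure) + (\<integral>x. \<bar>u2 (r *\<^sub>R x) - \<phi>2 x\<bar> \<partial>circle_measure)) \<longlongrightarrow> 0 + 0) (at_left 1)"
      by (rule tendsto_add[OF lim])
    have "norm (of_real pi * d n * of_real (1 ^ n)) \<le> 0 + 0"
    proof (rule tendsto_le[OF _ l2 l1])
      show "eventually (\<lambda>r. norm (of_real pi * d n * of_real (r ^ n))
        \<le> (\<integral>x. \<bar>u1 (r *\<^sub>R x) - \<phi>1 x\<bar> \<partial>circle_measure) + (\<integral>x. \<bar>u2 (r *\<^sub>R x) - \<phi>2 x\<bar> \<partial>circle_measure)) (at_left 1)"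
        unfolding eventually_at_left_field using bound by (intro exI[of _ 0]) simp
    qed simp
    then show ?thesis by simp
  qed
  have Fc: "F w = d 0" if w: "w \<in> ball 0 1" for w
  proof -
    have "(\<lambda>k. d k * w ^ k) sums F w"
      using holomorphic_power_series[OF F w] by (simp add: d_def)
    moreover have "(\<lambda>k. d k * w ^ k) = (\<lambda>k. if k = 0 then d 0 else 0)"
      using d0 by (auto simp: fun_eq_iff)
    ultimately show ?thesis using sums_unique2[OF _ sums_single[of 0 "\<lambda>_. d 0"]] by simp
  qed
  have eq: "u2 w + Re (d 0) = u1 w" if "w \<in> ball 0 1" for w
    using Fc[OF that] F1(2)[OF that] F2(2)[OF that] by (simp add: F_def) (metis add.commute diff_add_cancel minus_complex.simps(1))
  have "GDERIV u2 z :> grad u2 z"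
    using h(2) z unfolding harmonic_on_def by (intro differentiable_GDERIV_grad) blast
  from GDERIV_add[OF this GDERIV_const[of "Re (d 0)" z]]
  have "GDERIV (\<lambda>w. u2 w + Re (d 0)) z :> grad u2 z" by simp
  then have "GDERIV u1 z :> grad u2 z"
    unfolding gderiv_def by (rule has_derivative_transform_within_open[OF _ open_ball z]) (rule eq)
  then show ?thesis by (rule grad_eq)
qed

section \<open>The argument of a pole factor\<close>

text \<open>
  The function \<open>Arg\<close> is preferred to the imaginary part of \<open>Ln\<close> because
  its value at \<open>0\<close> is specified: with \<open>Arg 0 = 0\<close> the value at the pole
  \<open>a\<close> is the radial limit there.
\<close>

definition pole_angle :: "complex \<Rightarrow> complex \<Rightarrow> real" where
  "pole_angle a z = Arg (1 - cnj a * z)"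

lemma abs_pole_angle_le: "\<bar>pole_angle a z\<bar> \<le> pi"
  using Arg_bounded[of "1 - cnj a * z"] by (simp add: pole_angle_def abs_le_iff)

text \<open>
  The number \<open>cnj a * z\<close> lies in the closed unit disc, whose only point with real
  part at least one is \<open>1\<close>.
\<close>

lemma Re_pole_factor_pos:
  assumes a: "norm a = 1" and z: "norm z \<le> 1" and za: "z \<noteq> a"
  shows "0 < Re (1 - cnj a * z)"
proof (rule ccontr)
  assume "\<not> 0 < Re (1 - cnj a * z)"
  then have R: "1 \<le> Re (cnj a * z)" by simp
  have n: "norm (cnj a * z) \<le> 1" using a z by (simp add: norm_mult)
  have "(Re (cnj a * z))\<^sup>2 + (Im (cnj a * z))\<^sup>2 \<le> 1"
    using n by (metis cmod_power2 norm_ge_zero power_le_one)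
  moreover have "1 \<le> (Re (cnj a * z))\<^sup>2" using R by (rule one_le_power)
  ultimately have "(Im (cnj a * z))\<^sup>2 \<le> 0" by linarith
  then have I: "Im (cnj a * z) = 0" by simp
  have "Re (cnj a * z) \<le> 1" using n complex_Re_le_cmod[of "cnj a * z"] by linarith
  with R I have "cnj a * z = 1" by (simp only: complex_eq_iff one_complex.sel) simp
  then have "a * (cnj a * z) = a" by simp
  then show False using za cnj_mult_unimodular[OF a] by (simp add: mult.assoc[symmetric])
qed

lemma pole_factor_slit:
  assumes "norm a = 1" "norm z \<le> 1" "z \<noteq> a"
  shows "1 - cnj a * z \<notin> \<real>\<^sub>\<le>\<^sub>0"
  using Re_pole_factor_pos[OF assms] by (auto simp: complex_nonpos_Reals_iff)

lemma pole_angle_eq_Im_Ln: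
  assumes "norm a = 1" "norm z \<le> 1" "z \<noteq> a"
  shows "pole_angle a z = Im (Ln (1 - cnj a * z))"
proof -
  have "1 - cnj a * z \<noteq> 0" using Re_pole_factor_pos[OF assms] by (metis less_irrefl zero_complex.sel(1))
  then show ?thesis by (simp add: pole_angle_def Arg_eq_Im_Ln)
qed

lemma DERIV_Ln_pole:
  assumes a: "norm a = 1" and z: "norm z < 1"
  shows "((\<lambda>z. Ln (1 - cnj a * z)) has_field_derivative 1 / (z - a)) (at z)"
proof -
  have "z \<noteq> a" using a z by auto
  then have "1 - cnj a * z \<notin> \<real>\<^sub>\<le>\<^sub>0" using a z by (intro pole_factor_slit) auto
  then have "((\<lambda>z. Ln (1 - cnj a * z)) has_field_derivative - cnj a * (1 / (1 - cnj a * z))) (at z)"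
    by (auto intro!: derivative_eq_intros simp: field_simps)
  then show ?thesis unfolding pole_eq_geometric[OF a, symmetric] .
qed

text \<open>
  This is the polar form \<open>1 - cis s = 2 * sin (s / 2) * cis ((s - pi) / 2)\<close>. Along
  the circle the angle grows at half the speed of arc length, and it drops by \<open>pi\<close> on
  passing the pole.
\<close>

lemma pole_angle_circle:
  assumes a: "norm a = 1" and s: "0 < s" "s < 2 * pi"
  shows "pole_angle a (a * cis s) = (s - pi) / 2"
proof -
  have sin: "0 < sin (s / 2)" using s by (intro sin_gt_zero) auto
  define w where "w = Complex (ln (2 * sin (s / 2))) ((s - pi) / 2)"
  have "1 - cnj a * (a * cis s) = 1 - cis s"
    using cnj_mult_unimodular[OF a] by (simp add: mult.assoc[symmetric])
  also have "\<dots> = exp w"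
  proof -
    have c: "cos s = 1 - 2 * (sin (s / 2))\<^sup>2" using cos_double_sin[of "s / 2"] by simp
    have d: "sin s = 2 * sin (s / 2) * cos (s / 2)" using sin_double[of "s / 2"] by simp
    have e: "cos ((s - pi) / 2) = sin (s / 2)" "sin ((s - pi) / 2) = - cos (s / 2)"
      by (simp_all add: diff_divide_distrib cos_diff sin_diff)
    show ?thesis
      using sin by (simp add: w_def complex_eq_iff Re_exp Im_exp c d e power2_eq_square)
  qed
  finally have eq: "1 - cnj a * (a * cis s) = exp w" .
  have "Ln (exp w) = w"
    by (rule Ln_exp) (use s in \<open>auto simp: w_def\<close>)
  then show ?thesis unfolding pole_angle_def eq by (simp add: Arg_eq_Im_Ln) (simp add: w_def)
qed

lemma pole_angle_measurable:
  assumes a: "norm a = 1"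
  shows "pole_angle a \<in> borel_measurable circle_space"
proof -
  let ?A = "{w::complex. 0 < Re w}"
  have A: "?A \<in> sets borel" by (simp add: open_halfspace_Re_gt borel_open)
  have m: "(\<lambda>w. indicator ?A w *\<^sub>R Im (Ln w)) \<in> borel_measurable borel"
    by (intro borel_measurable_continuous_on_indicator A continuous_intros)
      (auto simp: complex_nonpos_Reals_iff)
  have "(\<lambda>x. 1 - cnj a * x) \<in> borel_measurable circle_space"
    by (intro borel_measurable_circle continuous_intros)
  from measurable_compose[OF this m]
  show ?thesis
  proof (rule measurable_cong[THEN iffD2, rotated])
    fix x assume "x \<in> space circle_space"
    then have x: "norm x = 1" by (simp add: space_restrict_space)
    show "pole_angle a x = indicator ?A (1 - cnj a * x) *\<^sub>R Im (Ln (1 - cnj a * x))"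
    proof (cases "x = a")
      case True
      then show ?thesis using cnj_mult_unimodular[OF a] by (simp add: pole_angle_def Arg_zero)
    next
      case False
      then show ?thesis using Re_pole_factor_pos[OF a _ False] x pole_angle_eq_Im_Ln[OF a _ False] by simp
    qed
  qed
qed

lemma integrable_pole_angle:
  assumes "norm a = 1" shows "integrable circle_measure (pole_angle a)"
proof -
  interpret finite_measure circle_measure by (rule finite_measure_circle)
  show ?thesis
    using pole_angle_measurable[OF assms]
    by (intro integrable_const_bound[of _ pi]) (simp_all add: abs_pole_angle_le cong: measurable_cong_sets)
qed

lemma C1_on_circle_DERIV:
  assumes "C1_on_circle \<zeta>" and a: "norm a = 1"
  shows "DERIV (\<lambda>s. \<zeta> (a * cis s)) s :> tangential_deriv \<zeta> (a * cis s)"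
proof -
  have "a * cis s \<in> sphere 0 1" using a by (simp add: norm_mult)
  then have "(\<lambda>t. \<zeta> (a * cis s * cis t)) differentiable at 0"
    using assms(1) unfolding C1_on_circle_def by blast
  then have "DERIV (\<lambda>t. \<zeta> (a * cis s * cis t)) 0 :> tangential_deriv \<zeta> (a * cis s)"
    unfolding tangential_deriv_def by (simp add: DERIV_deriv_iff_real_differentiable)
  then have "DERIV (\<lambda>t. \<zeta> (a * cis (t + s))) 0 :> tangential_deriv \<zeta> (a * cis s)"
    by (simp add: cis_mult[symmetric] mult_ac)
  then show ?thesis using DERIV_shift[of "\<lambda>s. \<zeta> (a * cis s)" _ 0 s] by simp
qed

text \<open>
  Continuity of \<open>\<zeta>\<close> on the circle follows from continuity along \<open>s
  \<mapsto> x * cis s\<close>, because this curve has a continuous inverse near \<open>x\<close>,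
  the argument of \<open>cnj x * y\<close>.
\<close>

lemma C1_on_circle_continuous:
  assumes \<zeta>: "C1_on_circle \<zeta>" shows "continuous_on (sphere 0 1) (tangential_deriv \<zeta>)"
    "continuous_on (sphere 0 1) \<zeta>"
proof -
  show "continuous_on (sphere 0 1) (tangential_deriv \<zeta>)"
    using \<zeta> unfolding C1_on_circle_def by blast
  show "continuous_on (sphere 0 1) \<zeta>"
    unfolding continuous_on_eq_continuous_within
  proof
    fix x :: complex assume x: "x \<in> sphere 0 1"
    have nx: "norm x = 1" using x by simp
    have c: "isCont (\<lambda>s. \<zeta> (x * cis s)) 0"
      by (rule DERIV_isCont[OF C1_on_circle_DERIV[OF \<zeta> nx]])
    have q: "continuous (at x within sphere 0 1) (\<lambda>y. Im (Ln (cnj x * y)))"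
    proof -
      have "cnj x * x = 1" using cnj_mult_unimodular[OF nx] by simp
      then have "isCont (\<lambda>y. Ln (cnj x * y)) x"
        by (intro isCont_o2[of x "\<lambda>y. cnj x * y" Ln] continuous_at_Ln) simp_all
      from continuous_Im[OF continuous_at_imp_continuous_within[OF this]] show ?thesis .
    qed
    have l0: "Im (Ln (cnj x * x)) = 0" using cnj_mult_unimodular[OF nx] by simp
    have cont: "continuous (at x within sphere 0 1) (\<lambda>y. \<zeta> (x * cis (Im (Ln (cnj x * y)))))"
      using continuous_within_compose3[OF _ q, of "\<lambda>s. \<zeta> (x * cis s)"] c l0 by simp
    have local: "\<zeta> (x * cis (Im (Ln (cnj x * y)))) = \<zeta> y" if y: "y \<in> sphere 0 1" for y
    proof -
      have n1: "norm (cnj x * y) = 1" using nx y by (simp add: norm_mult)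
      then have "cnj x * y \<noteq> 0" by auto
      then have "cnj x * y = exp (Ln (cnj x * y))" by simp
      also have "\<dots> = cis (Im (Ln (cnj x * y)))"
        using n1 \<open>cnj x * y \<noteq> 0\<close> by (simp add: exp_eq_polar Re_Ln)
      finally have "x * (cnj x * y) = x * cis (Im (Ln (cnj x * y)))" by (rule arg_cong)
      then show ?thesis using cnj_mult_unimodular[OF nx] by (simp add: mult.assoc[symmetric])
    qed
    show "continuous (at x within sphere 0 1) \<zeta>"
      by (rule continuous_transform_within[OF cont zero_less_one x]) (rule local)
  qed
qed

text \<open>
  Integration by parts over one turn that starts and ends at the pole: the integrated terms, where
  the angle is \<open>\<plusminus>pi / 2\<close>, produce \<open>pi * \<zeta> a\<close>. So the
  tangential derivative of the angle is half the arc length minus \<open>pi\<close> times the unit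
  mass at \<open>a\<close>.
\<close>

lemma integral_pole_angle_tangential_deriv:
  assumes \<zeta>: "C1_on_circle \<zeta>" and a: "norm a = 1"
  shows "(\<integral>x. pole_angle a x * tangential_deriv \<zeta> x \<partial>circle_measure)
    = pi * \<zeta> a - (1 / 2) * (\<integral>x. \<zeta> x \<partial>circle_measure)"
    and "(\<integral>x. tangential_deriv \<zeta> x \<partial>circle_measure) = 0"
proof -
  let ?D = "tangential_deriv \<zeta>"
  define Z where "Z s = \<zeta> (a * cis s)" for s
  define Z' where "Z' s = ?D (a * cis s)" for s
  have Z: "DERIV Z s :> Z' s" for s
    unfolding Z_def Z'_def by (rule C1_on_circle_DERIV[OF \<zeta> a])
  have "continuous_on UNIV Z'"
    unfolding Z'_def by (rule continuous_on_compose2[OF C1_on_circle_continuous(1)[OF \<zeta>]])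
      (auto intro!: continuous_intros simp: norm_mult a)
  then have Z'c: "isCont Z' s" for s by (simp add: continuous_on_eq_continuous_at)
  have Z0: "Z 0 = \<zeta> a" "Z (2 * pi) = \<zeta> a" by (simp_all add: Z_def)
  note mD = borel_measurable_circle[OF C1_on_circle_continuous(1)[OF \<zeta>]]
  note m\<zeta> = borel_measurable_circle[OF C1_on_circle_continuous(2)[OF \<zeta>]]
  note rot = times_measurable_circle[OF a]
  have AE: "AE s in lborel. s \<noteq> 0 \<and> s \<noteq> 2 * pi"
    using AE_lborel_singleton[of 0] AE_lborel_singleton[of "2 * pi"] by eventually_elim simp
  have half: "(\<integral>x. f x \<partial>circle_measure) = (\<integral>s. g s * indicator {0..2*pi} s \<partial>lborel)"
    if f: "f \<in> borel_measurable circle_space" and g: "g \<in> borel_measurable borel"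
      and fg: "\<And>s. 0 < s \<Longrightarrow> s < 2 * pi \<Longrightarrow> f (a * cis s) = g s" for f g :: "_ \<Rightarrow> real"
  proof -
    have fa: "(\<lambda>x. f (a * x)) \<in> borel_measurable circle_space" by (rule measurable_compose[OF rot f])
    have fac: "(\<lambda>s. f (a * cis s)) \<in> borel_measurable borel"
      by (rule measurable_compose[OF cis_measurable_circle fa])
    have "(\<integral>x. f x \<partial>circle_measure) = (\<integral>s. indicator {0..<2*pi} s *\<^sub>R f (a * cis s) \<partial>lborel)"
      unfolding integral_circle_rotate[OF f a, symmetric] by (rule integral_circle[OF fa])
    also have "\<dots> = (\<integral>s. g s * indicator {0..2*pi} s \<partial>lborel)"
    proof (rule integral_cong_AE)
      show "AE s in lborel. indicator {0..<2*pi} s *\<^sub>R f (a * cis s) = g s * indicator {0..2*pi} s"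
        using AE by eventually_elim (auto simp: indicator_def fg)
      show "(\<lambda>s. indicator {0..<2*pi} s *\<^sub>R f (a * cis s)) \<in> borel_measurable lborel"
        using fac by simp
      show "(\<lambda>s. g s * indicator {0..2*pi} s) \<in> borel_measurable lborel"
        using g by simp
    qed
    finally show ?thesis .
  qed
  have Zm: "Z \<in> borel_measurable borel" "Z' \<in> borel_measurable borel"
    using DERIV_isCont[OF Z] Z'c
    by (auto intro!: borel_measurable_continuous_onI simp: continuous_on_eq_continuous_at)
  have "(\<integral>x. pole_angle a x * ?D x \<partial>circle_measure) = (\<integral>s. ((s - pi) / 2 * Z' s) * indicator {0..2*pi} s \<partial>lborel)"
  proof (rule half)
    show "(\<lambda>x. pole_angle a x * ?D x) \<in> borel_measurable circle_space"
      by (intro borel_measurable_times pole_angle_measurable a mD)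
    show "(\<lambda>s. (s - pi) / 2 * Z' s) \<in> borel_measurable borel"
      by (intro borel_measurable_times Zm(2)) simp
  qed (simp add: pole_angle_circle[OF a] Z'_def)
  also have "\<dots> = (2 * pi - pi) / 2 * Z (2 * pi) - (0 - pi) / 2 * Z 0
      - (\<integral>s. (1 / 2 * Z s) * indicator {0..2*pi} s \<partial>lborel)"
    by (rule integral_by_parts) (auto intro!: derivative_eq_intros Z Z'c)
  also have "(\<integral>s. (1 / 2 * Z s) * indicator {0..2*pi} s \<partial>lborel) = (\<integral>x. 1 / 2 * \<zeta> x \<partial>circle_measure)"
  proof (rule half[symmetric])
    show "(\<lambda>x. 1 / 2 * \<zeta> x) \<in> borel_measurable circle_space" by (intro borel_measurable_times m\<zeta>) simp
    show "(\<lambda>s. 1 / 2 * Z s) \<in> borel_measurable borel" by (intro borel_measurable_times Zm) simp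
  qed (simp add: Z_def)
  also have "\<dots> = 1 / 2 * (\<integral>x. \<zeta> x \<partial>circle_measure)" by (rule integral_mult_right_zero)
  finally show "(\<integral>x. pole_angle a x * ?D x \<partial>circle_measure) = pi * \<zeta> a - (1 / 2) * (\<integral>x. \<zeta> x \<partial>circle_measure)"
    unfolding Z0 by (simp add: field_simps)
  have "(\<integral>x. ?D x \<partial>circle_measure) = (\<integral>s. Z' s * indicator {0..2*pi} s \<partial>lborel)"
    by (rule half[OF mD Zm(2)]) (simp add: Z'_def)
  also have "\<dots> = Z (2 * pi) - Z 0"
    by (rule integral_FTC_Icc_real) (auto intro!: Z Z'c)
  finally show "(\<integral>x. ?D x \<partial>circle_measure) = 0" unfolding Z0 by simp
qed

section \<open>The phase of two vortices and its energy\<close>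

lemma vortex_measure_integral:
  assumes a: "norm a = 1" and b: "norm b = 1" and ab: "a \<noteq> b"
    and f: "f \<in> borel_measurable circle_space"
  shows "(\<integral>x. f x \<partial>vortex_measure a b) = pi * f a + pi * (f b :: real)"
    and "finite_measure (vortex_measure a b)"
proof -
  let ?P = "point_measure {a, b} (\<lambda>_. ennreal pi)"
  have m: "(\<lambda>x. x) \<in> ?P \<rightarrow>\<^sub>M circle_space"
    using a b by (simp add: measurable_point_measure_eq1 space_restrict_space)
  have "(\<integral>x. f x \<partial>vortex_measure a b) = (\<integral>x. f x \<partial>?P)"
    unfolding vortex_measure_def by (rule integral_distr[OF m f])
  also have "\<dots> = pi * f a + pi * f b"
    using ab by (subst lebesgue_integral_point_measure_finite) auto
  finally show "(\<integral>x. f x \<partial>vortex_measure a b) = pi * f a + pi * f b" .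
  have "finite_measure ?P"
    by (intro finite_measureI) (simp add: space_point_measure emeasure_point_measure_finite ennreal_mult_eq_top_iff)
  then show "finite_measure (vortex_measure a b)"
    unfolding vortex_measure_def by (rule finite_measure.finite_measure_distr[OF _ m])
qed

text \<open>
  On the unit circle the product equals \<open>2 * Re (\<beta> * cnj x) - 2 * Re (\<beta> * cnj
  a)\<close>: the choice of \<open>\<beta>\<close> as a square root of \<open>a * b\<close> makes
  its terms pairwise conjugate.
\<close>

lemma pole_factors_real:
  assumes a: "norm a = 1" and b: "norm b = 1" and x: "norm x = 1" and \<beta>: "norm \<beta> = 1" "\<beta> * \<beta> = a * b"
  shows "Im ((1 - cnj a * x) * (1 - cnj b * x) * \<beta> * cnj x) = 0"
proof -
  note ca = cnj_mult_unimodular[OF a] and cb = cnj_mult_unimodular[OF b]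
    and cx = cnj_mult_unimodular[OF x] and cB = cnj_mult_unimodular[OF \<beta>(1)]
  have 0: "\<beta> = a * b * cnj \<beta>"
    using \<beta>(2) cB by (metis mult.assoc mult.right_neutral)
  have 1: "\<beta> * cnj a = b * cnj \<beta>"
    by (subst 0) (use ca in \<open>simp add: mult_ac\<close>)
  have 2: "\<beta> * cnj b = a * cnj \<beta>"
    by (subst 0) (use cb in \<open>simp add: mult_ac\<close>)
  have 3: "\<beta> * cnj a * cnj b = cnj \<beta>"
    unfolding 1 using cb by (simp add: mult_ac)
  have "(1 - cnj a * x) * (1 - cnj b * x) * \<beta> * cnj x
      = \<beta> * cnj x - \<beta> * cnj a * (x * cnj x) - \<beta> * cnj b * (x * cnj x) + \<beta> * cnj a * cnj b * x * (x * cnj x)"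
    by (simp add: algebra_simps)
  also have "\<dots> = (\<beta> * cnj x + cnj (\<beta> * cnj x)) - (\<beta> * cnj a + cnj (\<beta> * cnj a))"
    unfolding cx 3 2 by (simp add: mult_ac)
  finally show ?thesis by simp
qed

lemma cis_pole_angle:
  assumes "norm a = 1" "norm x \<le> 1" "x \<noteq> a"
  shows "cis (pole_angle a x) = (1 - cnj a * x) / of_real (norm (1 - cnj a * x))"
proof -
  have "1 - cnj a * x \<noteq> 0" using Re_pole_factor_pos[OF assms] by (metis less_irrefl zero_complex.sel(1))
  then show ?thesis by (simp add: pole_angle_def cis_Arg sgn_eq)
qed

text \<open>
  Two pole angles together grow at the speed of arc length, with a jump of \<open>-pi\<close> at
  each vortex. The constant \<open>c\<close> turns the resulting unit vector field into one that
  is tangent to the circle.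
\<close>

lemma boundary_phase_pole_angles:
  assumes a: "norm a = 1" and b: "norm b = 1" and ab: "a \<noteq> b"
    and \<beta>: "norm \<beta> = 1" "\<beta> * \<beta> = a * b" and c: "cis c = \<i> * \<beta>"
  shows "is_boundary_phase a b (\<lambda>x. pole_angle a x + pole_angle b x + c)"
  unfolding is_boundary_phase_def has_BV_tangential_derivative_def
proof (intro conjI ballI allI impI)
  fix x assume "x \<in> sphere 0 1 - {a, b}"
  then have x: "norm x = 1" "x \<noteq> a" "x \<noteq> b" by auto
  let ?p = "1 - cnj a * x" and ?q = "1 - cnj b * x"
  have "cis (pole_angle a x + pole_angle b x + c) = cis (pole_angle a x) * cis (pole_angle b x) * cis c"
    by (simp only: cis_mult)
  also have "\<dots> * cnj x = \<i> * (?p * ?q * \<beta> * cnj x) / of_real (norm ?p * norm ?q)"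
    using x by (simp add: cis_pole_angle a b c)
  finally have eq: "cis (pole_angle a x + pole_angle b x + c) * cnj x = \<i> * (?p * ?q * \<beta> * cnj x) / of_real (norm ?p * norm ?q)" .
  have dot: "u \<bullet> x = Re (u * cnj x)" for u by (simp add: inner_complex_def)
  have "cis (pole_angle a x + pole_angle b x + c) \<bullet> x = Re (\<i> * (?p * ?q * \<beta> * cnj x) / of_real (norm ?p * norm ?q))"
    unfolding dot eq ..
  also have "\<dots> = - Im (?p * ?q * \<beta> * cnj x) / (norm ?p * norm ?q)"
    by (simp only: Re_divide_of_real) simp
  finally show "cis (pole_angle a x + pole_angle b x + c) \<bullet> x = 0"
    unfolding pole_factors_real[OF a b x(1) \<beta>] by simp
next
  interpret finite_measure circle_measure by (rule finite_measure_circle)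
  show int: "integrable circle_measure (\<lambda>x. pole_angle a x + pole_angle b x + c)"
    by (intro Bochner_Integration.integrable_add integrable_pole_angle a b integrable_const)
  fix \<zeta> assume \<zeta>: "C1_on_circle \<zeta>"
  let ?D = "tangential_deriv \<zeta>"
  have intD: "integrable circle_measure ?D"
    by (rule integrable_circle_continuous[OF C1_on_circle_continuous(1)[OF \<zeta>]])
  have intp: "integrable circle_measure (\<lambda>x. pole_angle d x * ?D x)" if d: "norm d = 1" for d
  proof (rule Bochner_Integration.integrable_bound)
    show "integrable circle_measure (\<lambda>x. pi * ?D x)" using intD by (rule integrable_mult_right)
    show "(\<lambda>x. pole_angle d x * ?D x) \<in> borel_measurable circle_measure"
      by (intro borel_measurable_times borel_measurable_integrable integrable_pole_angle d intD)
    show "AE x in circle_measure. norm (pole_angle d x * ?D x) \<le> norm (pi * ?D x)"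
      by (intro AE_I2) (simp add: abs_mult abs_pole_angle_le mult_right_mono)
  qed
  have "(\<integral>x. (pole_angle a x + pole_angle b x + c) * ?D x \<partial>circle_measure)
      = (\<integral>x. pole_angle a x * ?D x + pole_angle b x * ?D x + c * ?D x \<partial>circle_measure)"
    unfolding distrib_right ..
  also have "\<dots> = (\<integral>x. pole_angle a x * ?D x \<partial>circle_measure) + (\<integral>x. pole_angle b x * ?D x \<partial>circle_measure)
      + c * (\<integral>x. ?D x \<partial>circle_measure)"
    using intp[OF a] intp[OF b] intD by simp
  also have "\<dots> = - ((\<integral>x. \<zeta> x \<partial>circle_measure) - (pi * \<zeta> a + pi * \<zeta> b))"
    unfolding integral_pole_angle_tangential_deriv[OF \<zeta> a] integral_pole_angle_tangential_deriv(1)[OF \<zeta> b]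
    by simp
  also have "pi * \<zeta> a + pi * \<zeta> b = (\<integral>x. \<zeta> x \<partial>vortex_measure a b)"
    by (rule vortex_measure_integral(1)[OF a b ab borel_measurable_circle[OF C1_on_circle_continuous(2)[OF \<zeta>]], symmetric])
  finally show "(\<integral>x. (pole_angle a x + pole_angle b x + c) * ?D x \<partial>circle_measure)
      = - ((\<integral>x. \<zeta> x \<partial>circle_measure) - (\<integral>x. \<zeta> x \<partial>vortex_measure a b))" .
next
  show "finite_measure (vortex_measure a b)"
    by (rule vortex_measure_integral(2)[OF a b ab, of "\<lambda>_. 0"]) simp
qed (simp_all add: finite_measure_circle vortex_measure_def)

text \<open>
  Along the radius that ends in the pole the factor \<open>1 - cnj a * z\<close> is real and
  non-negative, so its argument is constantly zero.
\<close>

lemma pole_angle_radial_limit: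
  assumes a: "norm a = 1" and x: "norm x = 1" and S: "S \<longlonglongrightarrow> 1" "\<And>n::nat. S n < 1"
  shows "(\<lambda>n. pole_angle a (S n *\<^sub>R x)) \<longlonglongrightarrow> pole_angle a x"
proof (cases "x = a")
  case True
  have "1 - cnj a * (S n *\<^sub>R a) = of_real (1 - S n)" for n
    using cnj_mult_unimodular[OF a] by (simp add: scaleR_conv_of_real mult_ac)
  then have "pole_angle a (S n *\<^sub>R x) = 0" for n
    unfolding pole_angle_def True by (simp only: Arg_of_real) (use S(2)[of n] in simp)
  moreover have "pole_angle a x = 0"
    unfolding pole_angle_def True cnj_mult_unimodular[OF a] by (simp add: Arg_zero)
  ultimately show ?thesis by simp
next
  case False
  have cont: "isCont Arg (1 - cnj a * x)"
    by (intro continuous_at_Arg pole_factor_slit a False) (simp add: x)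
  have "(\<lambda>n. 1 - cnj a * (S n *\<^sub>R x)) \<longlonglongrightarrow> 1 - cnj a * (1 *\<^sub>R x)"
    by (intro tendsto_intros S)
  then have "(\<lambda>n. 1 - cnj a * (S n *\<^sub>R x)) \<longlonglongrightarrow> 1 - cnj a * x" by (simp only: scaleR_one)
  then show ?thesis
    unfolding pole_angle_def by (rule isCont_tendsto_compose[OF cont])
qed

text \<open>
  A holomorphic function whose real part is the sum of the pole angles plus \<open>c\<close> on
  the disc.
\<close>

definition pole_potential :: "complex \<Rightarrow> complex \<Rightarrow> real \<Rightarrow> complex \<Rightarrow> complex" where
  "pole_potential a b c z = - \<i> * (Ln (1 - cnj a * z) + Ln (1 - cnj b * z)) + of_real c"

lemma DERIV_pole_potential:
  assumes "norm a = 1" "norm b = 1" "norm z < 1"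
  shows "(pole_potential a b c has_field_derivative - \<i> * (1 / (z - a) + 1 / (z - b))) (at z)"
proof -
  have "((\<lambda>z. - \<i> * (Ln (1 - cnj a * z) + Ln (1 - cnj b * z)) + of_real c)
      has_field_derivative - \<i> * (1 / (z - a) + 1 / (z - b)) + 0) (at z)"
    by (intro DERIV_add DERIV_cmult DERIV_const DERIV_Ln_pole assms)
  then show ?thesis by (simp add: pole_potential_def[abs_def])
qed

text \<open>
  The pole angles are bounded and converge radially at every point of the circle, so the boundary
  values are attained in the mean by dominated convergence.
\<close>

lemma pole_potential_harmonic_extension:
  assumes a: "norm a = 1" and b: "norm b = 1"
  shows "is_harmonic_extension (\<lambda>x. pole_angle a x + pole_angle b x + c) (\<lambda>z. Re (pole_potential a b c z))"
  unfolding is_harmonic_extension_def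
proof
  let ?\<phi> = "\<lambda>x. pole_angle a x + pole_angle b x + c"
  let ?u = "\<lambda>z. Re (pole_potential a b c z)"
  have hol: "pole_potential a b c holomorphic_on ball 0 1"
    unfolding holomorphic_on_open[OF open_ball] by (intro ballI exI, rule DERIV_pole_potential[OF a b]) simp
  then show "harmonic_on (ball 0 1) ?u" by (rule harmonic_on_Re) simp
  have u: "?u z = ?\<phi> z" if z: "norm z < 1" for z
  proof -
    have "z \<noteq> a" "z \<noteq> b" using a b z by auto
    then show ?thesis using a b z by (simp add: pole_potential_def pole_angle_eq_Im_Ln)
  qed
  show "((\<lambda>r. \<integral>x. \<bar>?u (r *\<^sub>R x) - ?\<phi> x\<bar> \<partial>circle_measure) \<longlongrightarrow> 0) (at_left 1)"
  proof (rule tendsto_at_left_sequentially[of 0])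
    fix S :: "nat \<Rightarrow> real" assume S: "\<And>n. S n < 1" "\<And>n. 0 < S n" "S \<longlonglongrightarrow> 1"
    have nS: "norm (S n *\<^sub>R x) < 1" if "norm x = 1" for n and x :: complex
      using that S(1)[of n] S(2)[of n] by simp
    interpret finite_measure circle_measure by (rule finite_measure_circle)
    have m\<phi>: "?\<phi> \<in> borel_measurable circle_measure"
      by (intro borel_measurable_add borel_measurable_const borel_measurable_integrable integrable_pole_angle a b)
    have "(\<lambda>n. \<integral>x. \<bar>?u (S n *\<^sub>R x) - ?\<phi> x\<bar> \<partial>circle_measure) \<longlonglongrightarrow> (\<integral>x. 0 \<partial>circle_measure)"
    proof (rule integral_dominated_convergence[where w = "\<lambda>_. 4 * pi"])
      show "integrable circle_measure (\<lambda>_. 4 * pi)" by (rule integrable_const)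
      show "(\<lambda>x. \<bar>?u (S n *\<^sub>R x) - ?\<phi> x\<bar>) \<in> borel_measurable circle_measure" for n
      proof -
        have "continuous_on (sphere 0 1) (\<lambda>x. ?u (S n *\<^sub>R x))"
          by (intro continuous_on_Re continuous_on_compose2[OF holomorphic_on_imp_continuous_on[OF hol]] continuous_intros)
            (use nS in auto)
        from borel_measurable_circle_measure[OF this] m\<phi> show ?thesis by measurable
      qed
      show "AE x in circle_measure. (\<lambda>n. \<bar>?u (S n *\<^sub>R x) - ?\<phi> x\<bar>) \<longlonglongrightarrow> 0"
      proof (intro AE_I2)
        fix x assume "x \<in> space circle_measure"
        then have x: "norm x = 1" by simp
        have "(\<lambda>n. \<bar>?\<phi> (S n *\<^sub>R x) - ?\<phi> x\<bar>) \<longlonglongrightarrow> \<bar>?\<phi> x - ?\<phi> x\<bar>"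
          by (intro tendsto_rabs tendsto_diff tendsto_add tendsto_const pole_angle_radial_limit a b x S)
        then show "(\<lambda>n. \<bar>?u (S n *\<^sub>R x) - ?\<phi> x\<bar>) \<longlonglongrightarrow> 0"
          by (simp add: u[OF nS[OF x]])
      qed
      show "AE x in circle_measure. norm \<bar>?u (S n *\<^sub>R x) - ?\<phi> x\<bar> \<le> 4 * pi" for n
      proof (intro AE_I2)
        fix x assume "x \<in> space circle_measure"
        then have x: "norm x = 1" by simp
        show "norm \<bar>?u (S n *\<^sub>R x) - ?\<phi> x\<bar> \<le> 4 * pi"
          unfolding u[OF nS[OF x]]
          using abs_pole_angle_le[of a x] abs_pole_angle_le[of b x]
            abs_pole_angle_le[of a "S n *\<^sub>R x"] abs_pole_angle_le[of b "S n *\<^sub>R x"]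
          unfolding real_norm_def by linarith
      qed
    qed simp
    then show "(\<lambda>n. \<integral>x. \<bar>?u (S n *\<^sub>R x) - ?\<phi> x\<bar> \<partial>circle_measure) \<longlonglongrightarrow> 0" by simp
  qed simp
qed

text \<open>
  The phase is chosen arbitrarily among the admissible ones; all of them have the gradient of the
  explicit one.
\<close>

lemma grad_vortex_phase:
  assumes a: "norm a = 1" and b: "norm b = 1" and ab: "a \<noteq> b" and z: "z \<in> ball 0 1"
  shows "grad (vortex_phase a b) z = \<i> * cnj (1 / (z - a) + 1 / (z - b))"
proof -
  \<comment> \<open>The field \<open>cis\<close> of the two pole angles is \<open>\<plusminus>x / \<beta>\<close>; rotating it by \<open>\<i> * \<beta>\<close> makes it tangent.\<close>
  define \<beta> where "\<beta> = csqrt (a * b)"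
  have \<beta>2: "\<beta> * \<beta> = a * b" unfolding \<beta>_def by (metis power2_csqrt power2_eq_square)
  then have "norm \<beta> * norm \<beta> = 1" using a b by (metis mult_1 norm_mult)
  then have \<beta>1: "norm \<beta> = 1" using norm_ge_zero[of \<beta>] by (simp add: square_eq_1_iff)
  define c where "c = Arg (\<i> * \<beta>)"
  have "norm (\<i> * \<beta>) = 1" using \<beta>1 by (simp add: norm_mult)
  then have c: "cis c = \<i> * \<beta>"
    unfolding c_def by (subst cis_Arg) (auto simp: sgn_eq)
  let ?\<phi> = "\<lambda>x. pole_angle a x + pole_angle b x + c"
  let ?u = "\<lambda>z. Re (pole_potential a b c z)"
  have \<phi>: "is_boundary_phase a b ?\<phi>" by (rule boundary_phase_pole_angles[OF a b ab \<beta>1 \<beta>2 c])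
  have u: "is_harmonic_extension ?\<phi> ?u" by (rule pole_potential_harmonic_extension[OF a b])
  have "\<exists>u \<phi>. is_boundary_phase a b \<phi> \<and> is_harmonic_extension \<phi> u" using \<phi> u by blast
  from someI_ex[OF this] obtain \<psi> where \<psi>: "is_boundary_phase a b \<psi>" "is_harmonic_extension \<psi> (vortex_phase a b)"
    unfolding vortex_phase_def[symmetric] by blast
  have "grad (vortex_phase a b) z = grad ?u z"
    using \<phi> \<psi>(1) unfolding is_boundary_phase_def
    by (intro harmonic_extension_grad_unique[OF \<psi>(2) _ u _ z]) blast+
  also have "\<dots> = cnj (- \<i> * (1 / (z - a) + 1 / (z - b)))"
    by (intro grad_eq GDERIV_Re DERIV_pole_potential a b) (use z in simp)
  also have "\<dots> = \<i> * cnj (1 / (z - a) + 1 / (z - b))"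
    unfolding complex_cnj_mult by simp
  finally show ?thesis .
qed

lemma renormalised_energy_formula:
  "\<exists>K. \<forall>\<delta> a b. norm a = 1 \<longrightarrow> norm b = 1 \<longrightarrow> a \<noteq> b \<longrightarrow>
     renormalised_energy \<delta> a b = ereal (K - 2 * pi * ln (norm (a - b)) + 2 * pi * (\<delta> \<bullet> (\<i> * (a + b))))"
proof -
  obtain K where K: "\<And>a. norm a = 1 \<Longrightarrow> ((\<lambda>r. self_energy a r - pi * ln (1 / r)) \<longlongrightarrow> K) (at_right 0)"
    by (rule self_energy_asymptotics) blast
  show ?thesis
  proof (intro exI allI impI)
    fix \<delta> a b :: complex assume ab: "norm a = 1" "norm b = 1" "a \<noteq> b"
    let ?S = "\<lambda>r. ball 0 1 - (ball a r \<union> ball b r)"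
    have "(LINT z:?S r|lborel. (norm (grad (vortex_phase a b) z))\<^sup>2 - 2 * (\<delta> \<bullet> grad (vortex_phase a b) z))
       = (LINT z:?S r|lborel. (norm (1 / (z - a) + 1 / (z - b)))\<^sup>2 - 2 * (\<delta> \<bullet> (\<i> * cnj (1 / (z - a) + 1 / (z - b)))))" for r
    proof (rule set_lebesgue_integral_cong)
      show "\<forall>z. z \<in> ?S r \<longrightarrow> (norm (grad (vortex_phase a b) z))\<^sup>2 - 2 * (\<delta> \<bullet> grad (vortex_phase a b) z)
        = (norm (1 / (z - a) + 1 / (z - b)))\<^sup>2 - 2 * (\<delta> \<bullet> (\<i> * cnj (1 / (z - a) + 1 / (z - b))))"
      proof (intro allI impI)
        fix z assume "z \<in> ?S r"
        then have z: "z \<in> ball 0 1" by blast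
        have "norm (\<i> * cnj w) = norm w" for w by (simp add: norm_mult)
        then show "(norm (grad (vortex_phase a b) z))\<^sup>2 - 2 * (\<delta> \<bullet> grad (vortex_phase a b) z)
          = (norm (1 / (z - a) + 1 / (z - b)))\<^sup>2 - 2 * (\<delta> \<bullet> (\<i> * cnj (1 / (z - a) + 1 / (z - b))))"
          unfolding grad_vortex_phase[OF ab z] by (simp only:)
      qed
    qed simp
    then have "renormalised_energy \<delta> a b = Liminf (at_right 0) (\<lambda>r. ereal ((LINT z:?S r|lborel.
        (norm (1 / (z - a) + 1 / (z - b)))\<^sup>2 - 2 * (\<delta> \<bullet> (\<i> * cnj (1 / (z - a) + 1 / (z - b)))))
        - 2 * pi * ln (1 / r)))"
      unfolding renormalised_energy_def by (simp only:)
    also have "\<dots> = ereal (2 * K - 2 * pi * ln (norm (a - b)) + 2 * pi * (\<delta> \<bullet> (\<i> * (a + b))))"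
      by (intro lim_imp_Liminf tendsto_ereal two_pole_energy_limit ab K) (simp_all add: trivial_limit_at_right_real)
    finally show "renormalised_energy \<delta> a b
      = ereal (2 * K - 2 * pi * ln (norm (a - b)) + 2 * pi * (\<delta> \<bullet> (\<i> * (a + b))))" .
  qed
qed

section \<open>Minimisation\<close>

text \<open>
  The number \<open>s\<close> is the positive root of \<open>2 * D * (1 - s\<^sup>2) = s\<close>,
  the condition for a critical point of \<open>- ln (2 * sqrt (1 - x\<^sup>2)) - 2 * D *
  x\<close>.
\<close>

lemma sine_of_optimal_angle:
  assumes D: "0 < (D::real)" and s: "s = sqrt (1 + 1 / (16 * D\<^sup>2)) - 1 / (4 * D)"
  shows "0 < s" "s < 1" "2 * D * (1 - s\<^sup>2) = s"
proof -
  define p where "p = 1 / (4 * D)"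
  have p: "0 < p" using D by (simp add: p_def)
  have "1 / (16 * D\<^sup>2) = p\<^sup>2" by (simp add: p_def power2_eq_square)
  then have s': "s = sqrt (1 + p\<^sup>2) - p" unfolding s p_def by simp
  then have sq: "(s + p)\<^sup>2 = 1 + p\<^sup>2" by simp
  have "sqrt (p\<^sup>2) < sqrt (1 + p\<^sup>2)" by (rule real_sqrt_less_mono) simp
  then show "0 < s" using p s' by simp
  have "sqrt (1 + p\<^sup>2) < sqrt ((1 + p)\<^sup>2)"
    using p by (intro real_sqrt_less_mono) (simp add: power2_eq_square algebra_simps)
  then show "s < 1" using p s' by simp
  have "1 - s\<^sup>2 = 2 * p * s" using sq by (simp add: power2_eq_square algebra_simps)
  then have "2 * D * (1 - s\<^sup>2) = (4 * D * p) * s" by simp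
  also have "4 * D * p = 1" using D by (simp add: p_def)
  finally show "2 * D * (1 - s\<^sup>2) = s" by simp
qed

text \<open>
  By the parallelogram law, \<open>(norm (c1 - c2))\<^sup>2 = 4 - (norm (c1 +
  c2))\<^sup>2\<close>, so only the sum of the two points matters. Bounding the logarithm by its
  tangent at the claimed minimum leaves, thanks to the equation for \<open>s\<close>, a sum of
  squares. It vanishes only if the sum of the two points is \<open>2 * \<i> * s\<close>.
\<close>

lemma reduced_energy_lower_bound:
  assumes c: "norm c1 = 1" "norm c2 = 1" "c1 \<noteq> c2"
    and s: "0 < s" "s < 1" and D: "2 * D * (1 - s\<^sup>2) = s"
  shows "((Re (c1 + c2))\<^sup>2 + (Im (c1 + c2) - 2 * s)\<^sup>2) / (8 * (1 - s\<^sup>2))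
    \<le> (- ln (norm (c1 - c2)) - D * Im (c1 + c2)) - (- ln (2 * sqrt (1 - s\<^sup>2)) - 2 * D * s)"
proof -
  define q where "q = 1 - s\<^sup>2"
  define R where "R = Re (c1 + c2)"
  define \<sigma> where "\<sigma> = Im (c1 + c2) / 2"
  have q: "0 < q" using s by (simp add: q_def power_less_one_iff abs_square_less_1)
  have D': "D = s / (2 * q)" using D q by (simp add: q_def field_simps)
  have N0: "0 < norm (c1 - c2)" using c by simp
  have "(norm (c1 - c2))\<^sup>2 = 2 * (norm c1)\<^sup>2 + 2 * (norm c2)\<^sup>2 - (norm (c1 + c2))\<^sup>2"
    unfolding cmod_power2 by (simp add: power2_eq_square algebra_simps)
  then have N: "(norm (c1 - c2))\<^sup>2 = 4 - R\<^sup>2 - 4 * \<sigma>\<^sup>2"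
    unfolding c cmod_power2[of "c1 + c2"] R_def \<sigma>_def by (simp add: power_divide)
  have "2 * ln (norm (c1 - c2) / (2 * sqrt q)) = ln ((norm (c1 - c2) / (2 * sqrt q))\<^sup>2)"
    using N0 q by (subst ln_realpow) auto
  also have "(norm (c1 - c2) / (2 * sqrt q))\<^sup>2 = (4 - R\<^sup>2 - 4 * \<sigma>\<^sup>2) / (4 * q)"
    using q by (simp add: power_divide power_mult_distrib N)
  also have "ln \<dots> \<le> (4 - R\<^sup>2 - 4 * \<sigma>\<^sup>2) / (4 * q) - 1"
    unfolding N[symmetric] using N0 q by (intro ln_le_minus_one divide_pos_pos) auto
  finally have "ln (norm (c1 - c2) / (2 * sqrt q)) \<le> ((4 - R\<^sup>2 - 4 * \<sigma>\<^sup>2) / (4 * q) - 1) / 2" by simp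
  then have "ln (norm (c1 - c2)) - ln (2 * sqrt q) \<le> ((4 - R\<^sup>2 - 4 * \<sigma>\<^sup>2) / (4 * q) - 1) / 2"
    using N0 q by (simp add: ln_div)
  moreover have "(R\<^sup>2 + (2 * \<sigma> - 2 * s)\<^sup>2) / (8 * q)
      = - (((4 - R\<^sup>2 - 4 * \<sigma>\<^sup>2) / (4 * q) - 1) / 2) - D * (2 * \<sigma>) + 2 * D * s"
  proof -
    \<comment> \<open>The equation for \<open>s\<close> enters as \<open>D = s / (2 * q)\<close>, which cancels the linear terms.\<close>
    have s2: "s * s = 1 - q" by (simp add: q_def power2_eq_square)
    have "- (((4 - R\<^sup>2 - 4 * \<sigma>\<^sup>2) / (4 * q) - 1) / 2) - D * (2 * \<sigma>) + 2 * D * s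
        = (- 4 + R\<^sup>2 + 4 * \<sigma>\<^sup>2 + 4 * q - 8 * (s * \<sigma>) + 8 * (s * s)) / (8 * q)"
      unfolding D' using q by (simp add: field_simps)
    moreover have "R\<^sup>2 + (2 * \<sigma> - 2 * s)\<^sup>2 = R\<^sup>2 + 4 * \<sigma>\<^sup>2 - 8 * (s * \<sigma>) + 4 * (s * s)"
      by (simp add: power2_eq_square algebra_simps)
    moreover have "\<dots> = - 4 + R\<^sup>2 + 4 * \<sigma>\<^sup>2 + 4 * q - 8 * (s * \<sigma>) + 8 * (s * s)"
      using s2 by linarith
    ultimately show ?thesis by (simp only:)
  qed
  moreover have I: "Im (c1 + c2) = 2 * \<sigma>" by (simp add: \<sigma>_def)
  ultimately show ?thesis unfolding R_def[symmetric] q_def[symmetric] I by linarith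
qed

lemma unimodular_pair_from_sum:
  assumes c: "norm c1 = 1" "norm c2 = 1" and t: "0 < sin t" "0 < cos t"
    and sum: "Re (c1 + c2) = 0" "Im (c1 + c2) = 2 * sin t"
  shows "c1 = cis t \<and> c2 = cis (pi - t) \<or> c1 = cis (pi - t) \<and> c2 = cis t"
proof -
  have n: "(Re c1)\<^sup>2 + (Im c1)\<^sup>2 = 1" "(Re c2)\<^sup>2 + (Im c2)\<^sup>2 = 1"
    using c by (simp_all add: cmod_power2[symmetric])
  have R: "Re c2 = - Re c1" using sum by simp
  have "(Im c1)\<^sup>2 = (Im c2)\<^sup>2" using n unfolding R by simp
  then have "Im c1 = Im c2 \<or> Im c1 = - Im c2" by (simp add: power2_eq_iff)
  then have I: "Im c1 = sin t" "Im c2 = sin t" using sum t by auto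
  have "(Re c1)\<^sup>2 = (cos t)\<^sup>2" using n(1)[unfolded I] sin_cos_squared_add[of t] by linarith
  then have "Re c1 = cos t \<or> Re c1 = - cos t" by (simp add: power2_eq_iff)
  then show ?thesis using R I by (auto simp: complex_eq_iff)
qed

theorem theorem1p8:
  fixes \<delta> a1 a2 :: complex and \<theta> \<theta>\<delta> :: real
  assumes "\<delta> \<noteq> 0"
    and "\<delta> = of_real (norm \<delta>) * cis \<theta>"
    and "\<theta>\<delta> = arcsin (sqrt (1 + 1 / (16 * (norm \<delta>)\<^sup>2)) - 1 / (4 * norm \<delta>))"
    and "a1 = cis (\<theta> + \<theta>\<delta>)"
    and "a2 = cis (\<theta> + pi - \<theta>\<delta>)"
  shows "({p. is_arg_min (\<lambda>(b1, b2). renormalised_energy \<delta> b1 b2)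
               (\<lambda>(b1, b2). b1 \<in> sphere 0 1 \<and> b2 \<in> sphere 0 1 \<and> b1 \<noteq> b2) p}
           = {(a1, a2), (a2, a1)})
         \<and> reflect_across_line (\<i> * \<delta>) a1 = a2"
proof -
  define D where "D = norm \<delta>"
  define s where "s = sqrt (1 + 1 / (16 * D\<^sup>2)) - 1 / (4 * D)"
  define e where "e = cis \<theta>"
  have D: "0 < D" using assms(1) by (simp add: D_def)
  note s = sine_of_optimal_angle[OF D s_def]
  have \<delta>: "\<delta> = of_real D * e" using assms(2) by (simp add: D_def e_def)
  have \<theta>\<delta>: "\<theta>\<delta> = arcsin s" using assms(3) by (simp add: s_def D_def)
  have sin: "sin \<theta>\<delta> = s" unfolding \<theta>\<delta> using s by (intro sin_arcsin) auto
  have cos: "cos \<theta>\<delta> = sqrt (1 - s\<^sup>2)" unfolding \<theta>\<delta> using s by (intro cos_arcsin) auto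
  have cos_pos: "0 < cos \<theta>\<delta>" unfolding \<theta>\<delta> using s by (intro cos_gt_zero_pi arcsin_lt_bounded[THEN conjunct1] arcsin_lt_bounded[THEN conjunct2]) auto
  have e: "norm e = 1" "e * cnj e = 1" "cnj e * e = 1"
    using cnj_mult_unimodular[of e] by (simp_all add: e_def)
  have a1: "a1 = e * cis \<theta>\<delta>" using assms(4) by (simp add: e_def cis_mult)
  have a2: "a2 = e * cis (pi - \<theta>\<delta>)" using assms(5) by (simp add: e_def cis_mult algebra_simps)
  define q where "q = 1 - s\<^sup>2"
  have q: "0 < q" using s by (simp add: q_def power_less_one_iff abs_square_less_1)
  define G where "G b1 b2 = - ln (norm (b1 - b2)) - D * Im (cnj e * b1 + cnj e * b2)" for b1 b2
  define m where "m = - ln (2 * sqrt q) - 2 * D * s"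
  obtain K where K: "\<And>b1 b2. norm b1 = 1 \<Longrightarrow> norm b2 = 1 \<Longrightarrow> b1 \<noteq> b2 \<Longrightarrow> renormalised_energy \<delta> b1 b2
      = ereal (K - 2 * pi * ln (norm (b1 - b2)) + 2 * pi * (\<delta> \<bullet> (\<i> * (b1 + b2))))"
    using renormalised_energy_formula by blast
  \<comment> \<open>Multiplication by \<open>cnj e\<close> rotates \<open>\<delta>\<close> to the positive number \<open>D\<close>.\<close>
  have W: "renormalised_energy \<delta> b1 b2 = ereal (K + 2 * pi * G b1 b2)"
    if "norm b1 = 1" "norm b2 = 1" "b1 \<noteq> b2" for b1 b2
  proof -
    have eq: "\<delta> \<bullet> (\<i> * (b1 + b2)) = - D * Im (cnj e * b1 + cnj e * b2)"
      unfolding \<delta> by (simp add: inner_complex_def algebra_simps)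
    show ?thesis unfolding K[OF that] G_def eq by (simp only: ereal.inject) argo
  qed
  have bound: "((Re (cnj e * b1 + cnj e * b2))\<^sup>2 + (Im (cnj e * b1 + cnj e * b2) - 2 * s)\<^sup>2) / (8 * q) \<le> G b1 b2 - m"
    if "norm b1 = 1" "norm b2 = 1" "b1 \<noteq> b2" for b1 b2
  proof -
    have "norm (cnj e * b1 - cnj e * b2) = norm (b1 - b2)"
      using e(1) by (metis complex_mod_cnj mult_1 norm_mult right_diff_distrib)
    moreover have "cnj e * b1 \<noteq> cnj e * b2" using that e by auto
    ultimately show ?thesis
      using reduced_energy_lower_bound[of "cnj e * b1" "cnj e * b2" s D] that s e(1)
      by (simp add: G_def m_def q_def norm_mult)
  qed
  have lower: "m \<le> G b1 b2" if "norm b1 = 1" "norm b2 = 1" "b1 \<noteq> b2" for b1 b2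
  proof -
    have "0 \<le> ((Re (cnj e * b1 + cnj e * b2))\<^sup>2 + (Im (cnj e * b1 + cnj e * b2) - 2 * s)\<^sup>2) / (8 * q)"
      using q by simp
    then show ?thesis using bound[OF that] by linarith
  qed
  have ce: "cnj e * a1 = cis \<theta>\<delta>" "cnj e * a2 = cis (pi - \<theta>\<delta>)"
    unfolding a1 a2 using e(3) by (simp_all add: mult.assoc[symmetric])
  have diff: "norm (a1 - a2) = 2 * sqrt q"
  proof -
    have "cis \<theta>\<delta> - cis (pi - \<theta>\<delta>) = of_real (2 * cos \<theta>\<delta>)" by (simp add: complex_eq_iff)
    then have "a1 - a2 = e * of_real (2 * cos \<theta>\<delta>)" unfolding a1 a2 by (simp only: right_diff_distrib[symmetric])
    then have "norm (a1 - a2) = \<bar>2 * cos \<theta>\<delta>\<bar>" by (simp only: norm_mult e(1) norm_of_real mult_1)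
    then show ?thesis using cos_pos unfolding cos q_def by simp
  qed
  have na: "norm a1 = 1" "norm a2 = 1" "a1 \<noteq> a2"
    using e(1) diff q by (auto simp: a1 a2 norm_mult)
  have opt: "G a1 a2 = m" "G a2 a1 = m"
  proof -
    show "G a1 a2 = m" unfolding G_def ce diff m_def by (simp add: sin)
    then show "G a2 a1 = m" unfolding G_def by (simp add: norm_minus_commute add.commute)
  qed
  have unique: "(b1, b2) = (a1, a2) \<or> (b1, b2) = (a2, a1)"
    if b: "norm b1 = 1" "norm b2 = 1" "b1 \<noteq> b2" and le: "G b1 b2 \<le> m" for b1 b2
  proof -
    let ?R = "Re (cnj e * b1 + cnj e * b2)" and ?I = "Im (cnj e * b1 + cnj e * b2) - 2 * s"
    have "(?R\<^sup>2 + ?I\<^sup>2) / (8 * q) \<le> 0" using bound[OF b] le by linarith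
    then have "?R\<^sup>2 + ?I\<^sup>2 \<le> 0" using q by (simp add: divide_le_0_iff)
    then have "?R = 0 \<and> ?I = 0" by (simp only: sum_power2_le_zero_iff)
    then have "cnj e * b1 = cis \<theta>\<delta> \<and> cnj e * b2 = cis (pi - \<theta>\<delta>)
        \<or> cnj e * b1 = cis (pi - \<theta>\<delta>) \<and> cnj e * b2 = cis \<theta>\<delta>"
      using b e(1) s(1) cos_pos by (intro unimodular_pair_from_sum) (simp_all add: norm_mult sin)
    moreover have "b = e * (cnj e * b)" for b using e(2) by (simp add: mult.assoc[symmetric])
    ultimately show ?thesis unfolding a1 a2 by (metis (no_types))
  qed
  have mono: "ereal (K + 2 * pi * x) < ereal (K + 2 * pi * y) \<longleftrightarrow> x < y" for x y by simp
  have "{p. is_arg_min (\<lambda>(b1, b2). renormalised_energy \<delta> b1 b2)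
               (\<lambda>(b1, b2). b1 \<in> sphere 0 1 \<and> b2 \<in> sphere 0 1 \<and> b1 \<noteq> b2) p} = {(a1, a2), (a2, a1)}"
  proof (intro equalityI subsetI)
    fix p assume "p \<in> {p. is_arg_min (\<lambda>(b1, b2). renormalised_energy \<delta> b1 b2)
               (\<lambda>(b1, b2). b1 \<in> sphere 0 1 \<and> b2 \<in> sphere 0 1 \<and> b1 \<noteq> b2) p}"
    then obtain b1 b2 where p: "p = (b1, b2)" and b: "norm b1 = 1" "norm b2 = 1" "b1 \<noteq> b2"
      and min: "\<not> renormalised_energy \<delta> a1 a2 < renormalised_energy \<delta> b1 b2"
      using na by (cases p) (auto simp: is_arg_min_def)
    have "\<not> G a1 a2 < G b1 b2" using min unfolding W[OF b] W[OF na] mono .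
    then show "p \<in> {(a1, a2), (a2, a1)}" using unique[OF b] opt p by auto
  next
    fix p assume "p \<in> {(a1, a2), (a2, a1)}"
    then obtain b1 b2 where p: "p = (b1, b2)" and b: "norm b1 = 1" "norm b2 = 1" "b1 \<noteq> b2" "G b1 b2 = m"
      using na opt by auto
    have "\<not> renormalised_energy \<delta> c1 c2 < renormalised_energy \<delta> b1 b2"
      if c: "norm c1 = 1" "norm c2 = 1" "c1 \<noteq> c2" for c1 c2
      unfolding W[OF b(1-3)] W[OF c] mono b(4) using lower[OF c] by linarith
    then show "p \<in> {p. is_arg_min (\<lambda>(b1, b2). renormalised_energy \<delta> b1 b2)
               (\<lambda>(b1, b2). b1 \<in> sphere 0 1 \<and> b2 \<in> sphere 0 1 \<and> b1 \<noteq> b2) p}"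
      unfolding p is_arg_min_def using b by auto
  qed
  moreover have "reflect_across_line (\<i> * \<delta>) a1 = a2"
  proof -
    have "(\<i> * \<delta>) \<bullet> (\<i> * \<delta>) = D\<^sup>2"
      using e(1) D by (simp add: power2_norm_eq_inner[symmetric] \<delta> norm_mult)
    moreover have "a1 \<bullet> (\<i> * \<delta>) = D * s"
    proof -
      have "a1 \<bullet> (\<i> * \<delta>) = D * Im (cnj e * a1)"
        unfolding \<delta> by (simp add: inner_complex_def algebra_simps)
      then show ?thesis unfolding ce by (simp add: sin)
    qed
    ultimately have "reflect_across_line (\<i> * \<delta>) a1 = (2 * s / D) *\<^sub>R (\<i> * \<delta>) - a1"
      unfolding reflect_across_line_def using D by (simp add: power2_eq_square)
    also have "(2 * s / D) *\<^sub>R (\<i> * \<delta>) = e * (\<i> * of_real (2 * s))"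
      unfolding \<delta> using D by (simp add: scaleR_conv_of_real)
    also have "e * (\<i> * of_real (2 * s)) - a1 = e * (\<i> * of_real (2 * s) - cis \<theta>\<delta>)"
      unfolding a1 by (simp only: right_diff_distrib)
    also have "\<i> * of_real (2 * s) - cis \<theta>\<delta> = cis (pi - \<theta>\<delta>)"
      by (simp add: complex_eq_iff sin)
    finally show ?thesis unfolding a2 .
  qed
  ultimately show ?thesis ..
qed

end
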